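(* Let $G$ be a finite group. All subgroups of $G$ (including $G$ itself) are indecomposable if and only if $G$ is of one of the following types: 1. $G$ is isomorphic to $\mathbb{Z}/p^n\mathbb{Z}$ for some prime $p$ and some integer $n \geq 0$. 2. $G$ is generalized quaternion, i.e. isomorphic to $Q_n$ for some $n \geq 3$. 3. $G$ is isomorphic to a semidirect product $\mathbb{Z}/p^{\alpha}\mathbb{Z} \rtimes \mathbb{Z}/q^{\beta}\mathbb{Z}$ (with $\mathbb{Z}/p^{\alpha}\mathbb{Z}$ the normal factor), where $p,q$ are two different primes, $p$ is odd, $\alpha,\beta \geq 1$ are integers, $q^{\beta}$ divides $p-1$, and the image of $\mathbb{Z}/q^{\beta}\mathbb{Z}$ in $(\mathbb{Z}/p^{\alpha}\mathbb{Z})^{\times} \cong \mathrm{Aut}(\mathbb{Z}/p^{\alpha}\mathbb{Z})$ under the homomorphism defining the semidirect product has order $q^{\beta}$.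
   Context: A group is called indecomposable if it is not isomorphic to a direct product of two nontrivial groups (so the trivial group is indecomposable). For $n \geq 3$, the generalized quaternion group $Q_n$ is the group of order $2^n$ defined by the presentation $$Q_n = \langle x,y \mid x^{2^{n-1}} = 1,\ y^2 = x^{2^{n-2}},\ y^{-1} x y = x^{-1}\rangle.$$ *)

theory Defs
  imports "HOL-Algebra.Elementary_Groups" "HOL-Algebra.Bij" "HOL-Algebra.Weak_Morphisms"
    "HOL-Computational_Algebra.Primes"
begin

section \<open>Indecomposable groups\<close>

text \<open>
  The two factors range over groups on the element type of \<open>G\<close>. This loses nothing, because a
  direct factor of \<open>G\<close> embeds into \<open>G\<close>: see \<open>indecomposable_factors\<close> below, where the factors have
  arbitrary types.
\<close>

definition indecomposable :: "('a, 'b) monoid_scheme \<Rightarrow> bool" where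
  "indecomposable G \<longleftrightarrow>
     \<not> (\<exists>(H :: 'a monoid) (K :: 'a monoid).
          group H \<and> group K \<and> carrier H \<noteq> {\<one>\<^bsub>H\<^esub>} \<and> carrier K \<noteq> {\<one>\<^bsub>K\<^esub>} \<and> G \<cong> H \<times>\<times> K)"

lemma indecomposable_factors:
  assumes "indecomposable G" "group G" "group H" "group K" "G \<cong> H \<times>\<times> K"
  shows "carrier H = {\<one>\<^bsub>H\<^esub>} \<or> carrier K = {\<one>\<^bsub>K\<^esub>}"
proof (rule ccontr)
  assume nontriv: "\<not> ?thesis"
  interpret H: group H by fact
  interpret K: group K by fact
  have "H \<times>\<times> K \<cong> G"
    using assms group.iso_sym by blast
  then obtain f where f: "f \<in> iso (H \<times>\<times> K) G"
    by (auto simp: is_iso_def)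
  then have inj: "inj_on f (carrier H \<times> carrier K)"
    by (simp add: iso_def bij_betw_def)
  define g where "g = (\<lambda>h. f (h, \<one>\<^bsub>K\<^esub>))"
  define k where "k = (\<lambda>x. f (\<one>\<^bsub>H\<^esub>, x))"
  have gi: "inj_on g (carrier H)" and ki: "inj_on k (carrier K)"
    using inj H.one_closed K.one_closed unfolding g_def k_def inj_on_def by blast+
  have "H \<times>\<times> K \<cong> image_group g H \<times>\<times> image_group k K"
    using H.DirProd_iso_trans[OF is_isoI is_isoI]
      inj_imp_image_group_iso[OF gi] inj_imp_image_group_iso[OF ki]
    by blast
  then have "G \<cong> image_group g H \<times>\<times> image_group k K"
    using assms(5) iso_trans by blast
  moreover have "group (image_group g H)" and "group (image_group k K)"
    using H.inj_imp_image_group_is_group[OF gi] K.inj_imp_image_group_is_group[OF ki] by auto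
  moreover have "carrier (image_group g H) \<noteq> {\<one>\<^bsub>image_group g H\<^esub>}"
  proof
    assume "carrier (image_group g H) = {\<one>\<^bsub>image_group g H\<^esub>}"
    then have "g ` carrier H = g ` {\<one>\<^bsub>H\<^esub>}"
      by (simp add: image_group_carrier image_group_one)
    then have "carrier H = {\<one>\<^bsub>H\<^esub>}"
      using inj_on_image_eq_iff[OF gi, of "carrier H" "{\<one>\<^bsub>H\<^esub>}"] by simp
    then show False using nontriv by simp
  qed
  moreover have "carrier (image_group k K) \<noteq> {\<one>\<^bsub>image_group k K\<^esub>}"
  proof
    assume "carrier (image_group k K) = {\<one>\<^bsub>image_group k K\<^esub>}"
    then have "k ` carrier K = k ` {\<one>\<^bsub>K\<^esub>}"
      by (simp add: image_group_carrier image_group_one)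
    then have "carrier K = {\<one>\<^bsub>K\<^esub>}"
      using inj_on_image_eq_iff[OF ki, of "carrier K" "{\<one>\<^bsub>K\<^esub>}"] by simp
    then show False using nontriv by simp
  qed
  ultimately show False
    using assms(1) unfolding indecomposable_def by blast
qed

section \<open>Groups given by generators and relations\<close>

text \<open>
  A word is a list of letters; \<open>(g, True)\<close> is the generator \<open>g\<close> and \<open>(g, False)\<close> its formal inverse.
  A pair \<open>(u, v)\<close> of words in \<open>R\<close> is the relation \<open>u = v\<close>.
\<close>

type_synonym 'g word = "('g \<times> bool) list"

inductive pres_cong :: "('g word \<times> 'g word) set \<Rightarrow> 'g word \<Rightarrow> 'g word \<Rightarrow> bool"
  for R where
  relation: "(u, v) \<in> R \<Longrightarrow> pres_cong R u v"
| cancel: "pres_cong R [(g, b), (g, \<not> b)] []"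
| refl: "pres_cong R u u"
| sym: "pres_cong R u v \<Longrightarrow> pres_cong R v u"
| trans: "pres_cong R u v \<Longrightarrow> pres_cong R v w \<Longrightarrow> pres_cong R u w"
| append: "pres_cong R u v \<Longrightarrow> pres_cong R u' v' \<Longrightarrow> pres_cong R (u @ u') (v @ v')"

definition word_class :: "('g word \<times> 'g word) set \<Rightarrow> 'g word \<Rightarrow> 'g word set" where
  "word_class R u = {v. pres_cong R u v}"

definition presented_group :: "('g word \<times> 'g word) set \<Rightarrow> 'g word set monoid" where
  "presented_group R =
     \<lparr>carrier = range (word_class R),
      monoid.mult = (\<lambda>A B. \<Union>u\<in>A. \<Union>v\<in>B. word_class R (u @ v)),
      one = word_class R []\<rparr>"

lemma word_class_eq_iff: "word_class R u = word_class R v \<longleftrightarrow> pres_cong R u v"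
  unfolding word_class_def set_eq_iff mem_Collect_eq
  using pres_cong.refl pres_cong.sym pres_cong.trans by metis

lemma carrier_presented_group [simp]: "carrier (presented_group R) = range (word_class R)"
  by (simp add: presented_group_def)

lemma one_presented_group [simp]: "\<one>\<^bsub>presented_group R\<^esub> = word_class R []"
  by (simp add: presented_group_def)

lemma mult_presented_group [simp]:
  "word_class R u \<otimes>\<^bsub>presented_group R\<^esub> word_class R v = word_class R (u @ v)"
proof -
  have eq: "word_class R (u' @ v') = word_class R (u @ v)"
    if "u' \<in> word_class R u" "v' \<in> word_class R v" for u' v'
  proof -
    have "pres_cong R u u'" "pres_cong R v v'"
      using that by (simp_all add: word_class_def)
    then have "pres_cong R (u @ v) (u' @ v')"
      by (rule pres_cong.append)
    then show ?thesis
      by (simp add: word_class_eq_iff pres_cong.sym)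
  qed
  have mem: "u \<in> word_class R u" "v \<in> word_class R v"
    by (simp_all add: word_class_def pres_cong.refl)
  have "(\<Union>u'\<in>word_class R u. \<Union>v'\<in>word_class R v. word_class R (u' @ v')) =
        (\<Union>u'\<in>word_class R u. \<Union>v'\<in>word_class R v. word_class R (u @ v))"
    by (intro SUP_cong HOL.refl eq)
  also have "\<dots> = word_class R (u @ v)"
    using mem by blast
  finally show ?thesis
    by (simp add: presented_group_def)
qed

definition inv_word :: "'g word \<Rightarrow> 'g word" where
  "inv_word u = rev (map (\<lambda>(g, b). (g, \<not> b)) u)"

lemma pres_cong_inv_word: "pres_cong R (inv_word u @ u) []"
proof (induction u)
  case Nil
  then show ?case by (simp add: inv_word_def pres_cong.refl)
next
  case (Cons a u)
  obtain g b where a: "a = (g, b)" by fastforce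
  have "pres_cong R [(g, \<not> b), (g, b)] []"
    using pres_cong.cancel[of R g "\<not> b"] by simp
  then have "pres_cong R (inv_word u @ ([(g, \<not> b), (g, b)] @ u)) (inv_word u @ ([] @ u))"
    by (intro pres_cong.append pres_cong.refl)
  moreover have "inv_word (a # u) @ a # u = inv_word u @ ([(g, \<not> b), (g, b)] @ u)"
    by (simp add: a inv_word_def)
  ultimately show ?case
    using Cons.IH pres_cong.trans by fastforce
qed

lemma group_presented_group: "group (presented_group R)"
proof (rule groupI)
  fix x assume "x \<in> carrier (presented_group R)"
  then obtain u where "x = word_class R u" by auto
  then have "word_class R (inv_word u) \<otimes>\<^bsub>presented_group R\<^esub> x = \<one>\<^bsub>presented_group R\<^esub>"
    by (simp add: word_class_eq_iff pres_cong_inv_word)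
  then show "\<exists>y\<in>carrier (presented_group R). y \<otimes>\<^bsub>presented_group R\<^esub> x = \<one>\<^bsub>presented_group R\<^esub>"
    by auto
qed auto

definition word_value :: "('a, 'b) monoid_scheme \<Rightarrow> ('g \<Rightarrow> 'a) \<Rightarrow> 'g word \<Rightarrow> 'a" where
  "word_value G f u =
     foldr (\<lambda>(g, b) x. (if b then f g else inv\<^bsub>G\<^esub> f g) \<otimes>\<^bsub>G\<^esub> x) u \<one>\<^bsub>G\<^esub>"

context group
begin

lemma word_value_closed: "range f \<subseteq> carrier G \<Longrightarrow> word_value G f u \<in> carrier G"
  by (induction u) (auto simp: word_value_def image_subset_iff)

lemma word_value_append:
  assumes "range f \<subseteq> carrier G"
  shows "word_value G f (u @ v) = word_value G f u \<otimes> word_value G f v"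
proof (induction u)
  case Nil
  then show ?case using word_value_closed[OF assms] by (simp add: word_value_def)
next
  case (Cons a u)
  have "f g \<in> carrier G" for g using assms by auto
  then show ?case
    using Cons word_value_closed[OF assms, of u] word_value_closed[OF assms, of v]
    by (cases a) (auto simp: word_value_def m_assoc)
qed

lemma word_value_cong:
  assumes f: "range f \<subseteq> carrier G"
    and R: "\<And>u v. (u, v) \<in> R \<Longrightarrow> word_value G f u = word_value G f v"
    and "pres_cong R u v"
  shows "word_value G f u = word_value G f v"
  using assms(3)
proof (induction rule: pres_cong.induct)
  case (cancel g b)
  have "f g \<in> carrier G" using f by auto
  then show ?case by (cases b) (auto simp: word_value_def)
qed (auto simp: R word_value_append[OF f])

theorem presented_group_universal:
  assumes f: "range f \<subseteq> carrier G"
    and R: "\<And>u v. (u, v) \<in> R \<Longrightarrow> word_value G f u = word_value G f v"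
  shows "\<exists>F \<in> hom (presented_group R) G.
           (\<forall>u. F (word_class R u) = word_value G f u) \<and> (\<forall>g. F (word_class R [(g, True)]) = f g)"
proof -
  define F where "F = (\<lambda>A. word_value G f (SOME u. u \<in> A))"
  have F: "F (word_class R u) = word_value G f u" for u
  proof -
    have "(SOME v. v \<in> word_class R u) \<in> word_class R u"
      by (rule someI[of _ u]) (auto simp: word_class_def intro: pres_cong.refl)
    then show ?thesis
      using word_value_cong[OF f R] by (auto simp: F_def word_class_def)
  qed
  moreover have "f g \<in> carrier G" for g
    using f by auto
  ultimately have "F (word_class R [(g, True)]) = f g" for g
    by (simp add: word_value_def)
  moreover have "F \<in> hom (presented_group R) G"
    by (auto simp: hom_def F word_value_append[OF f] word_value_closed[OF f])
  ultimately show ?thesis using F by blast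
qed

end

section \<open>Generalized quaternion groups\<close>

datatype quat_gen = QX | QY

definition quat_relations :: "nat \<Rightarrow> (quat_gen word \<times> quat_gen word) set" where
  "quat_relations n =
     {(replicate (2 ^ (n - 1)) (QX, True), []),
      ([(QY, True), (QY, True)], replicate (2 ^ (n - 2)) (QX, True)),
      ([(QY, False), (QX, True), (QY, True)], [(QX, False)])}"

text \<open>Meant for \<open>n \<ge> 3\<close> only; the exponents are natural-number differences.\<close>

definition gen_quaternion :: "nat \<Rightarrow> quat_gen word set monoid" where
  "gen_quaternion n = presented_group (quat_relations n)"

section \<open>Semidirect products\<close>

definition semidirect_product ::
  "('a, 'c) monoid_scheme \<Rightarrow> ('b, 'd) monoid_scheme \<Rightarrow> ('b \<Rightarrow> 'a \<Rightarrow> 'a) \<Rightarrow> ('a \<times> 'b) monoid" where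
  "semidirect_product N H \<phi> =
     \<lparr>carrier = carrier N \<times> carrier H,
      monoid.mult = (\<lambda>(n, h) (n', h'). (n \<otimes>\<^bsub>N\<^esub> \<phi> h n', h \<otimes>\<^bsub>H\<^esub> h')),
      one = (\<one>\<^bsub>N\<^esub>, \<one>\<^bsub>H\<^esub>)\<rparr>"

lemma group_semidirect_product:
  assumes "group N" "group H" and \<phi>: "\<phi> \<in> hom H (AutoGroup N)"
  shows "group (semidirect_product N H \<phi>)"
proof -
  interpret N: group N by fact
  interpret H: group H by fact
  have auto: "\<phi> h \<in> auto N" if "h \<in> carrier H" for h
    using \<phi> that by (auto simp: hom_def AutoGroup_def)
  have closed: "\<phi> h n \<in> carrier N" if "h \<in> carrier H" "n \<in> carrier N" for h n
    using auto[OF that(1)] that(2) by (auto simp: auto_def hom_def)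
  have mult: "\<phi> h (n \<otimes>\<^bsub>N\<^esub> n') = \<phi> h n \<otimes>\<^bsub>N\<^esub> \<phi> h n'"
    if "h \<in> carrier H" "n \<in> carrier N" "n' \<in> carrier N" for h n n'
    using auto[OF that(1)] that by (auto simp: auto_def hom_def)
  have comp: "\<phi> (h \<otimes>\<^bsub>H\<^esub> h') n = \<phi> h (\<phi> h' n)"
    if "h \<in> carrier H" "h' \<in> carrier H" "n \<in> carrier N" for h h' n
  proof -
    have "\<phi> (h \<otimes>\<^bsub>H\<^esub> h') = compose (carrier N) (\<phi> h) (\<phi> h')"
      using \<phi> that auto by (auto simp: hom_def AutoGroup_def BijGroup_def auto_def)
    then show ?thesis using that by (simp add: compose_eq)
  qed
  have "group_hom H (AutoGroup N) \<phi>"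
    using \<phi> H.group_axioms N.AutoGroup by (simp add: group_hom_def group_hom_axioms_def)
  then have "\<phi> \<one>\<^bsub>H\<^esub> = \<one>\<^bsub>AutoGroup N\<^esub>"
    by (rule group_hom.hom_one)
  then have one: "\<phi> \<one>\<^bsub>H\<^esub> n = n" if "n \<in> carrier N" for n
    using that by (simp add: AutoGroup_def BijGroup_def)
  show ?thesis
  proof (rule groupI)
    fix x assume "x \<in> carrier (semidirect_product N H \<phi>)"
    then obtain n h where x: "x = (n, h)" "n \<in> carrier N" "h \<in> carrier H"
      by (auto simp: semidirect_product_def)
    let ?y = "(\<phi> (inv\<^bsub>H\<^esub> h) (inv\<^bsub>N\<^esub> n), inv\<^bsub>H\<^esub> h)"
    have "\<phi> (inv\<^bsub>H\<^esub> h) (inv\<^bsub>N\<^esub> n) \<otimes>\<^bsub>N\<^esub> \<phi> (inv\<^bsub>H\<^esub> h) n = \<phi> (inv\<^bsub>H\<^esub> h) \<one>\<^bsub>N\<^esub>"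
      using x mult[of "inv\<^bsub>H\<^esub> h" "inv\<^bsub>N\<^esub> n" n] by simp
    also have "\<dots> = \<one>\<^bsub>N\<^esub>"
    proof -
      have "\<phi> (inv\<^bsub>H\<^esub> h) \<in> hom N N"
        using auto x by (simp add: auto_def)
      then show ?thesis
        using N.group_axioms hom_one by blast
    qed
    finally have "?y \<otimes>\<^bsub>semidirect_product N H \<phi>\<^esub> x = \<one>\<^bsub>semidirect_product N H \<phi>\<^esub>"
      using x by (simp add: semidirect_product_def)
    moreover have "?y \<in> carrier (semidirect_product N H \<phi>)"
      using x closed by (simp add: semidirect_product_def)
    ultimately show "\<exists>y\<in>carrier (semidirect_product N H \<phi>).
        y \<otimes>\<^bsub>semidirect_product N H \<phi>\<^esub> x = \<one>\<^bsub>semidirect_product N H \<phi>\<^esub>"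
      by blast
  qed (auto simp: semidirect_product_def closed mult comp one N.m_assoc H.m_assoc)
qed

end

theory Submission
  imports Defs "HOL-Algebra.Sylow" "HOL-Algebra.Multiplicative_Group" "HOL-Algebra.Group_Action"
    "HOL-Number_Theory.Residue_Primitive_Roots" "HOL.Complex"
begin

text \<open>
  All subgroups of \<open>G\<close> are indecomposable if and only if any two commuting elements of prime order
  generate the same subgroup (\<open>prime_rank_one\<close>): two such elements with different subgroups span a
  direct product, and a decomposable subgroup contains such a pair, one element in each factor.
  What remains is a classification of the groups of prime rank one.

  Let \<open>G\<close> be a \<open>p\<close>-group. Every element of order \<open>p\<close> is a power of a central one, so there is only one
  subgroup of order \<open>p\<close>. A normal cyclic subgroup \<open>\<langle>a\<rangle>\<close> of maximal order \<open>p\<^sup>m\<close> is its own centralizer.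
  If \<open>g\<close> lies outside it, \<open>g\<^sup>p = a\<^sup>k\<close> and \<open>g a g\<^sup>-\<^sup>1 = a\<^sup>r\<close>, then the \<open>p\<close>-th power of \<open>a\<^sup>j g\<close> is \<open>a\<close> to the
  exponent \<open>j (1 + r + \<dots> + r\<^bsup>p-1\<^esup>) + k\<close>, and no choice of \<open>j\<close> may make this divisible by \<open>p\<^sup>m\<close>.
  For odd \<open>p\<close> some \<open>j\<close> always does, so \<open>G\<close> is cyclic; for \<open>p = 2\<close> only \<open>r = -1\<close> and
  \<open>k = 2\<^bsup>m-1\<^esup>\<close> survive, and \<open>G\<close> is cyclic or generalized quaternion (\<open>prime_power_group_cases\<close>).

  Now let several primes divide the order of \<open>G\<close>. For each such \<open>p\<close> there is an element \<open>u\<close> of order \<open>p\<close>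
  whose centralizer is a Sylow \<open>p\<close>-subgroup; let \<open>s\<close> be its order. The conjugates of \<open>u\<close> inside \<open>\<langle>u\<rangle>\<close>
  correspond to a subgroup of the units modulo \<open>p\<close>, which is cyclic, so that a single \<open>b\<close>
  produces all of them; let \<open>t\<close> be their number. Every element of \<open>G\<close> has prime power order, hence
  \<open>t\<close>, a divisor of the order of \<open>b\<close> and of \<open>p - 1\<close>, is a power of one prime, which is smaller than
  \<open>p\<close>. A double count of commuting pairs shows that at least a proportion \<open>(1 - 1/s) / t\<close> of all
  elements are nontrivial \<open>p\<close>-elements (\<open>prime_element_counting\<close>). These sets are disjoint for
  different primes and do not contain \<open>\<one>\<close>, so the proportions add up to less than one. For the
  smallest prime \<open>t = 1\<close>, for the second one \<open>t \<le> s\<^sub>1\<close>, and for the third one \<open>t \<le> s\<^sub>1\<close> or \<open>t \<le> s\<^sub>2\<close>. This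
  rules out a third prime, and with two primes it forces \<open>t = s\<^sub>1\<close> for the larger one: the
  powers of \<open>b\<close> are a Sylow subgroup for the smaller prime which acts faithfully on the centralizer
  of \<open>u\<close>, and this centralizer is cyclic and normal (\<open>frobenius_structure\<close>).

  Conversely, in a generalized quaternion group all elements of prime order lie in the cyclic subgroup
  \<open>\<langle>x\<rangle>\<close>, and in the semidirect products elements outside the normal factor centralize no nontrivial
  element of it (\<open>prime_rank_one_extension\<close>).
\<close>

section \<open>Commuting elements of prime order\<close>

text \<open>
  Equivalently, \<open>G\<close> has no subgroup that is a direct product of two groups of prime order, for equal or
  different primes. Prime order is expressed by \<open>x \<noteq> \<one>\<close> and \<open>x\<^sup>p = \<one>\<close>, and equality of the generated
  subgroups by a power relation, because injective homomorphisms preserve and reflect these.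
\<close>

definition prime_rank_one :: "('a, 'b) monoid_scheme \<Rightarrow> bool" where
  "prime_rank_one G \<longleftrightarrow>
     (\<forall>(p::nat) (q::nat). \<forall>x\<in>carrier G. \<forall>y\<in>carrier G.
        prime p \<longrightarrow> prime q \<longrightarrow> x \<noteq> \<one>\<^bsub>G\<^esub> \<longrightarrow> y \<noteq> \<one>\<^bsub>G\<^esub> \<longrightarrow>
        x [^]\<^bsub>G\<^esub> p = \<one>\<^bsub>G\<^esub> \<longrightarrow> y [^]\<^bsub>G\<^esub> q = \<one>\<^bsub>G\<^esub> \<longrightarrow> x \<otimes>\<^bsub>G\<^esub> y = y \<otimes>\<^bsub>G\<^esub> x \<longrightarrow>
        (\<exists>k::nat. y = x [^]\<^bsub>G\<^esub> k))"

lemma prime_rank_oneD: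
  fixes p q :: nat
  assumes "prime_rank_one G" "prime p" "prime q" "x \<in> carrier G" "y \<in> carrier G"
    "x \<noteq> \<one>\<^bsub>G\<^esub>" "y \<noteq> \<one>\<^bsub>G\<^esub>" "x [^]\<^bsub>G\<^esub> p = \<one>\<^bsub>G\<^esub>" "y [^]\<^bsub>G\<^esub> q = \<one>\<^bsub>G\<^esub>"
    "x \<otimes>\<^bsub>G\<^esub> y = y \<otimes>\<^bsub>G\<^esub> x"
  obtains k :: nat where "y = x [^]\<^bsub>G\<^esub> k"
  using assms unfolding prime_rank_one_def by blast

lemma prime_rank_one_embed:
  assumes "group G" "group K" and f: "f \<in> hom G K" and inj: "inj_on f (carrier G)"
    and K: "prime_rank_one K"
  shows "prime_rank_one G"
proof -
  interpret group_hom G K f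
    using assms by (simp add: group_hom_def group_hom_axioms_def)
  show ?thesis
    unfolding prime_rank_one_def
  proof (intro allI ballI impI)
    fix p q :: nat and x y
    assume pq: "prime p" "prime q" and xy: "x \<in> carrier G" "y \<in> carrier G"
      and ne: "x \<noteq> \<one>\<^bsub>G\<^esub>" "y \<noteq> \<one>\<^bsub>G\<^esub>"
      and pow: "x [^]\<^bsub>G\<^esub> p = \<one>\<^bsub>G\<^esub>" "y [^]\<^bsub>G\<^esub> q = \<one>\<^bsub>G\<^esub>" and comm: "x \<otimes>\<^bsub>G\<^esub> y = y \<otimes>\<^bsub>G\<^esub> x"
    have ne': "f x \<noteq> \<one>\<^bsub>K\<^esub>" "f y \<noteq> \<one>\<^bsub>K\<^esub>"
      using xy ne inj hom_one by (metis G.one_closed inj_on_eq_iff)+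
    have pow': "f x [^]\<^bsub>K\<^esub> p = \<one>\<^bsub>K\<^esub>" "f y [^]\<^bsub>K\<^esub> q = \<one>\<^bsub>K\<^esub>"
      using pow xy by (metis hom_nat_pow hom_one)+
    have "f x \<otimes>\<^bsub>K\<^esub> f y = f y \<otimes>\<^bsub>K\<^esub> f x"
      using comm xy by (metis hom_mult)
    then obtain k :: nat where "f y = f x [^]\<^bsub>K\<^esub> k"
      using prime_rank_oneD[OF K pq _ _ ne' pow'] xy by auto
    then have "f y = f (x [^]\<^bsub>G\<^esub> k)"
      using xy by (simp add: hom_nat_pow)
    then show "\<exists>k::nat. y = x [^]\<^bsub>G\<^esub> k"
      using inj xy by (metis G.nat_pow_closed inj_on_eq_iff)
  qed
qed

corollary prime_rank_one_iso:
  assumes "group G" "group K" "G \<cong> K" "prime_rank_one K"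
  shows "prime_rank_one G"
  using assms prime_rank_one_embed unfolding is_iso_def iso_def bij_betw_def by blast

lemma prime_power_if_unique_prime_factor:
  fixes n p :: nat
  assumes n: "n > 0" and p: "prime p" and q: "\<And>q. prime q \<Longrightarrow> q dvd n \<Longrightarrow> q = p"
  shows "\<exists>k. n = p ^ k"
proof -
  obtain m where m: "n = p ^ multiplicity p n * m" "\<not> p dvd m"
    using multiplicity_decompose'[of n p] n p by (metis not_prime_unit not_gr_zero)
  have "m = 1"
    using q m prime_factor_nat[of m] by (metis dvd_mult)
  then show ?thesis using m by auto
qed

lemma prime_power_cong_inverse:
  fixes m p i :: nat
  assumes "prime p" "\<not> p dvd i"
  obtains j where "[i * j = 1] (mod p ^ m)"
  using assms cong_solve_coprime_nat[of i "p ^ m"] prime_imp_coprime[of p i]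
  by (auto simp: coprime_commute)

context group
begin

lemma ord_prime:
  fixes p :: nat
  assumes "prime p" "x \<in> carrier G" "x \<noteq> \<one>" "x [^] p = \<one>"
  shows "ord x = p"
  using assms pow_eq_id[of x p] ord_eq_1[of x] prime_nat_iff by metis

lemma finite_ord_pos:
  assumes "finite (carrier G)" "x \<in> carrier G"
  shows "ord x > 0"
  using ord_ge_1[OF assms] by simp

lemma mem_generate_iff:
  assumes "finite (carrier G)" "a \<in> carrier G"
  shows "x \<in> generate G {a} \<longleftrightarrow> (\<exists>i::nat. x = a [^] i)"
  using generate_pow_nat[of a] finite_ord_pos[OF assms] assms by auto

lemma pow_eq_iff_cong:
  fixes i j :: nat
  assumes "x \<in> carrier G"
  shows "x [^] i = x [^] j \<longleftrightarrow> [i = j] (mod ord x)"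
proof -
  have "x [^] int i = x [^] int j \<longleftrightarrow> [i = j] (mod ord x)"
    using assms by (metis cong_iff_dvd_diff cong_int_iff cong_sym_eq int_pow_eq)
  then show ?thesis by (simp add: int_pow_int)
qed

lemma pow_cong_ord:
  fixes i j :: nat
  assumes "x \<in> carrier G" "[i = j] (mod ord x)"
  shows "x [^] i = x [^] j"
  using assms pow_eq_iff_cong by blast

lemma exists_prime_order_pow:
  assumes fin: "finite (carrier G)" and x: "x \<in> carrier G" and p: "prime p" "p dvd ord x"
  obtains k :: nat where "x [^] k \<noteq> \<one>" "(x [^] k) [^] p = \<one>"
proof (rule that[of "ord x div p"])
  have "ord x > 0" using finite_ord_pos[OF fin x] .
  then have "\<not> ord x dvd ord x div p"
    using p prime_gt_1_nat[of p] by (metis div_eq_dividend_iff dvd_div_eq_0_iff dvd_imp_le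
        div_le_dividend le_antisym less_irrefl neq0_conv)
  then show "x [^] (ord x div p) \<noteq> \<one>"
    using pow_eq_id[OF x] by simp
  show "(x [^] (ord x div p)) [^] p = \<one>"
    using x p by (simp add: nat_pow_pow)
qed

text \<open>
  Sylow's theorem provides subgroups for all powers of \<open>p\<close> that divide the order; here the first
  power is used.
\<close>

lemma cauchy_prime:
  assumes fin: "finite (carrier G)" and p: "prime p" "p dvd order G"
  obtains x where "x \<in> carrier G" "x \<noteq> \<one>" "x [^] p = \<one>"
proof -
  obtain m where "order G = p ^ 1 * m" using p by auto
  then obtain H where H: "subgroup H G" "card H = p"
    using sylow_thm[OF p(1) group_axioms _ fin, of 1 m] by auto
  then obtain x where x: "x \<in> H" "x \<noteq> \<one>"
    using prime_gt_1_nat[OF p(1)] by (metis card_1_singleton_iff insertI1 insert_absorb is_singletonI'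
        is_singleton_def less_irrefl subgroup.one_closed card.empty not_less0 One_nat_def)
  interpret H: group "G\<lparr>carrier := H\<rparr>"
    using H subgroup.subgroup_is_group by blast
  have "x [^]\<^bsub>G\<lparr>carrier := H\<rparr>\<^esub> order (G\<lparr>carrier := H\<rparr>) = \<one>"
    using H.pow_order_eq_1[of x] x by simp
  then have "x [^] p = \<one>"
    using H by (simp add: order_def nat_pow_def)
  then show ?thesis
    using that x H subgroup.mem_carrier by metis
qed

lemma exists_prime_order_element:
  assumes fin: "finite (carrier G)" and ne: "carrier G \<noteq> {\<one>}"
  obtains p x where "prime (p::nat)" "x \<in> carrier G" "x \<noteq> \<one>" "x [^] p = \<one>"
proof -
  have "order G \<noteq> 1"
    using ne by (metis card_1_singleton_iff One_nat_def one_closed order_def singletonD)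
  then obtain p where "prime p" "p dvd order G"
    using prime_factor_nat by blast
  then show ?thesis
    using cauchy_prime[OF fin] that by metis
qed

text \<open>
  A prime \<open>q\<close> dividing the order of \<open>x\<close> gives a power of \<open>x\<close> of order \<open>q\<close>. It commutes with \<open>v\<close>, so it is a
  power of \<open>v\<close>, whence \<open>q = p\<close>.
\<close>

lemma prime_power_ord_if_commutes:
  fixes p :: nat
  assumes fin: "finite (carrier G)" and P: "prime_rank_one G" and p: "prime p"
    and v: "v \<in> carrier G" "v \<noteq> \<one>" "v [^] p = \<one>"
    and x: "x \<in> carrier G" "x \<otimes> v = v \<otimes> x"
  shows "\<exists>k. ord x = p ^ k"
proof (rule prime_power_if_unique_prime_factor)
  fix q :: nat assume q: "prime q" "q dvd ord x"
  obtain k :: nat where k: "x [^] k \<noteq> \<one>" "(x [^] k) [^] q = \<one>"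
    using exists_prime_order_pow[OF fin x(1) q] .
  have "v \<otimes> x [^] k = x [^] k \<otimes> v"
    using x v group_commutes_pow by metis
  then obtain l :: nat where "x [^] k = v [^] l"
    using prime_rank_oneD[OF P p q(1) v(1) _ v(2) k(1) v(3) k(2)] x(1) by auto
  then have "(x [^] k) [^] p = \<one>"
    using v by (metis mult.commute nat_pow_one nat_pow_pow)
  then show "q = p"
    using ord_prime[OF q(1) _ k(1,2)] ord_prime[OF p _ k(1)] x(1) by simp
qed (use finite_ord_pos[OF fin x(1)] p in auto)

lemma prime_power_ord:
  assumes fin: "finite (carrier G)" and P: "prime_rank_one G"
    and x: "x \<in> carrier G" "x \<noteq> \<one>"
  obtains p k :: nat where "prime p" "ord x = p ^ k"
proof -
  obtain p where p: "prime p" "p dvd ord x"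
    using x ord_eq_1 prime_factor_nat[of "ord x"] by blast
  obtain k :: nat where k: "x [^] k \<noteq> \<one>" "(x [^] k) [^] p = \<one>"
    using exists_prime_order_pow[OF fin x(1) p] .
  have "x \<otimes> x [^] k = x [^] k \<otimes> x"
    using x by (metis nat_pow_comm nat_pow_eone)
  then show ?thesis
    using prime_power_ord_if_commutes[OF fin P p(1) _ k x(1)] x p that by auto
qed

end

text \<open>
  If \<open>y\<close> is not a power of \<open>x\<close>, the cyclic subgroups of prime order generated by \<open>x\<close> and \<open>y\<close> intersect
  trivially; as they commute, multiplication embeds their direct product into \<open>G\<close>.
\<close>

lemma (in group) prime_rank_one_if_indecomposable:
  assumes fin: "finite (carrier G)"
    and ind: "\<And>H. subgroup H G \<Longrightarrow> indecomposable (G\<lparr>carrier := H\<rparr>)"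
  shows "prime_rank_one G"
  unfolding prime_rank_one_def
proof (intro allI ballI impI, rule ccontr)
  fix p q :: nat and x y
  assume pq: "prime p" "prime q" and x: "x \<in> carrier G" and y: "y \<in> carrier G"
    and ne: "x \<noteq> \<one>" "y \<noteq> \<one>" and pow: "x [^] p = \<one>" "y [^] q = \<one>"
    and comm: "x \<otimes> y = y \<otimes> x" and no: "\<not> (\<exists>k::nat. y = x [^] k)"
  let ?A = "generate G {x}" and ?B = "generate G {y}"
  have sub: "subgroup ?A G" "subgroup ?B G"
    using x y generate_is_subgroup by auto
  interpret group_disjoint_sum G ?A ?B
    using sub by (simp add: group_disjoint_sum_def group_axioms)
  have triv: "?A \<inter> ?B = {\<one>}"
  proof -
    have "w = \<one>" if w: "w \<in> ?A" "w \<in> ?B" for w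
    proof (rule ccontr)
      assume "w \<noteq> \<one>"
      obtain i j :: nat where ij: "w = x [^] i" "w = y [^] j"
        using w mem_generate_iff[OF fin] x y by blast
      have oy: "ord y = q" using ord_prime[OF pq(2) y ne(2) pow(2)] .
      have "\<not> q dvd j" using \<open>w \<noteq> \<one>\<close> ij(2) oy pow_eq_id[OF y] by metis
      then obtain l where "[j * l = 1] (mod q ^ 1)"
        using prime_power_cong_inverse[OF pq(2)] by blast
      then have "y [^] (j * l) = y [^] (1::nat)"
        using pow_cong_ord[OF y] oy by simp
      then have "y = x [^] (i * l)"
        using ij x y by (simp add: nat_pow_pow[symmetric])
      then show False using no by blast
    qed
    then show ?thesis
      by (intro subset_one[THEN iffD1] subsetI) auto
  qed
  have cAB: "a \<otimes> b = b \<otimes> a" if ab: "a \<in> ?A" "b \<in> ?B" for a b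
  proof -
    obtain i j :: nat where ij: "a = x [^] i" "b = y [^] j"
      using ab mem_generate_iff[OF fin] x y by blast
    have "x [^] i \<otimes> y = y \<otimes> x [^] i"
      using group_commutes_pow[OF comm x y] .
    then have "y [^] j \<otimes> x [^] i = x [^] i \<otimes> y [^] j"
      using x y by (intro group_commutes_pow) auto
    then show ?thesis using ij by simp
  qed
  let ?f = "\<lambda>(a, b). a \<otimes> b" and ?P = "subgroup_generated G ?A \<times>\<times> subgroup_generated G ?B"
  have mon: "?f \<in> mon ?P G"
    by (intro mon_group_mul_eq[THEN iffD2] conjI triv ballI cAB)
  have PG: "group ?P"
    by (simp add: DirProd_group)
  interpret f: group_hom ?P G ?f
    using mon PG group_axioms by (simp add: mon_def group_hom_def group_hom_axioms_def)
  let ?H = "?f ` carrier ?P"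
  have "?f \<in> iso ?P (G\<lparr>carrier := ?H\<rparr>)"
    using mon by (auto simp: mon_def iso_def hom_def bij_betw_def)
  then have "G\<lparr>carrier := ?H\<rparr> \<cong> ?P"
    using group.iso_sym[OF PG is_isoI] by blast
  moreover have "group (G\<lparr>carrier := ?H\<rparr>)"
    using f.img_is_subgroup subgroup.subgroup_is_group group_axioms by blast
  ultimately have "carrier (subgroup_generated G ?A) = {\<one>\<^bsub>subgroup_generated G ?A\<^esub>} \<or>
      carrier (subgroup_generated G ?B) = {\<one>\<^bsub>subgroup_generated G ?B\<^esub>}"
    by (intro indecomposable_factors[OF ind[OF f.img_is_subgroup]]) auto
  then have "?A = {\<one>} \<or> ?B = {\<one>}"
    using sub by (simp add: AG.carrier_subgroup_generated_subgroup BG.carrier_subgroup_generated_subgroup)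
  then show False
    using ne generate.incl[of x "{x}" G] generate.incl[of y "{y}" G] by blast
qed

text \<open>
  Elements of prime order taken from two nontrivial factors commute, but the second is not a power of
  the first.
\<close>

lemma (in group) indecomposable_if_prime_rank_one:
  assumes fin: "finite (carrier G)" and P: "prime_rank_one G" and H: "subgroup H G"
  shows "indecomposable (G\<lparr>carrier := H\<rparr>)"
  unfolding indecomposable_def
proof
  assume "\<exists>(A :: 'a monoid) (B :: 'a monoid). group A \<and> group B \<and> carrier A \<noteq> {\<one>\<^bsub>A\<^esub>} \<and>
    carrier B \<noteq> {\<one>\<^bsub>B\<^esub>} \<and> G\<lparr>carrier := H\<rparr> \<cong> A \<times>\<times> B"
  then obtain A B :: "'a monoid" where AB: "group A" "group B" "carrier A \<noteq> {\<one>\<^bsub>A\<^esub>}"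
    "carrier B \<noteq> {\<one>\<^bsub>B\<^esub>}" and iso: "G\<lparr>carrier := H\<rparr> \<cong> A \<times>\<times> B"
    by blast
  interpret A: group A by fact
  interpret B: group B by fact
  have grp: "group (G\<lparr>carrier := H\<rparr>)" "group (A \<times>\<times> B)"
    using H AB by (auto simp: DirProd_group intro: subgroup.subgroup_is_group)
  have PH: "prime_rank_one (G\<lparr>carrier := H\<rparr>)"
    by (rule prime_rank_one_embed[OF grp(1) group_axioms _ _ P, of id])
      (use subgroup.subset[OF H] in \<open>auto simp: hom_def\<close>)
  have "A \<times>\<times> B \<cong> G\<lparr>carrier := H\<rparr>"
    using iso grp group.iso_sym by blast
  then have PAB: "prime_rank_one (A \<times>\<times> B)"
    using prime_rank_one_iso grp PH by blast
  have "finite (carrier (A \<times>\<times> B))"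
    using iso_finite[OF iso] finite_subset[OF subgroup.subset[OF H] fin] by simp
  then have "finite (carrier A)" "finite (carrier B)"
    by (metis A.one_closed B.one_closed carrier_DirProd empty_iff finite_cartesian_productD1
        finite_cartesian_productD2)+
  then obtain p a q b where a: "prime (p::nat)" "a \<in> carrier A" "a \<noteq> \<one>\<^bsub>A\<^esub>" "a [^]\<^bsub>A\<^esub> p = \<one>\<^bsub>A\<^esub>"
    and b: "prime (q::nat)" "b \<in> carrier B" "b \<noteq> \<one>\<^bsub>B\<^esub>" "b [^]\<^bsub>B\<^esub> q = \<one>\<^bsub>B\<^esub>"
    using A.exists_prime_order_element B.exists_prime_order_element AB by metis
  have pow: "(u, v) [^]\<^bsub>A \<times>\<times> B\<^esub> n = (u [^]\<^bsub>A\<^esub> n, v [^]\<^bsub>B\<^esub> n)" for u v and n :: nat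
    by (induction n) (auto simp: nat_pow_def)
  obtain k :: nat where "(\<one>\<^bsub>A\<^esub>, b) = (a, \<one>\<^bsub>B\<^esub>) [^]\<^bsub>A \<times>\<times> B\<^esub> k"
    by (rule prime_rank_oneD[OF PAB a(1) b(1), of "(a, \<one>\<^bsub>B\<^esub>)" "(\<one>\<^bsub>A\<^esub>, b)"])
      (use a b in \<open>auto simp: pow\<close>)
  then show False using b by (simp add: pow)
qed

theorem (in group) all_subgroups_indecomposable_iff:
  assumes "finite (carrier G)"
  shows "(\<forall>H. subgroup H G \<longrightarrow> indecomposable (G\<lparr>carrier := H\<rparr>)) \<longleftrightarrow> prime_rank_one G"
  using assms prime_rank_one_if_indecomposable indecomposable_if_prime_rank_one by blast

section \<open>Conjugacy classes and centres of prime power groups\<close>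

definition conj_class :: "('a, 'b) monoid_scheme \<Rightarrow> 'a \<Rightarrow> 'a set" where
  "conj_class G x = {g \<otimes>\<^bsub>G\<^esub> x \<otimes>\<^bsub>G\<^esub> inv\<^bsub>G\<^esub> g | g. g \<in> carrier G}"

definition centralizer :: "('a, 'b) monoid_scheme \<Rightarrow> 'a \<Rightarrow> 'a set" where
  "centralizer G x = {g \<in> carrier G. g \<otimes>\<^bsub>G\<^esub> x = x \<otimes>\<^bsub>G\<^esub> g}"

context group
begin

lemma conj_eq_iff:
  assumes "g \<in> carrier G" "x \<in> carrier G" "y \<in> carrier G"
  shows "g \<otimes> x \<otimes> inv g = y \<longleftrightarrow> g \<otimes> x = y \<otimes> g"
  using assms by (metis inv_solve_right' m_closed)

lemma subgroup_centralizer: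
  assumes "x \<in> carrier G"
  shows "subgroup (centralizer G x) G"
proof -
  interpret group_action G "carrier G" "\<lambda>g. \<lambda>h \<in> carrier G. g \<otimes> h \<otimes> inv g"
    by (rule action_by_conjugation)
  have "stabilizer G (\<lambda>g. \<lambda>h \<in> carrier G. g \<otimes> h \<otimes> inv g) x = centralizer G x"
    unfolding stabilizer_def centralizer_def
    by (intro Collect_cong conj_cong HOL.refl) (simp add: assms conj_eq_iff)
  then show ?thesis using stabilizer_subgroup[OF assms] by simp
qed

lemma card_conj_class:
  assumes "x \<in> carrier G"
  shows "card (conj_class G x) * card (centralizer G x) = order G"
proof -
  interpret group_action G "carrier G" "\<lambda>g. \<lambda>h \<in> carrier G. g \<otimes> h \<otimes> inv g"
    by (rule action_by_conjugation)
  have "stabilizer G (\<lambda>g. \<lambda>h \<in> carrier G. g \<otimes> h \<otimes> inv g) x = centralizer G x"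
    unfolding stabilizer_def centralizer_def
    by (intro Collect_cong conj_cong HOL.refl) (simp add: assms conj_eq_iff)
  moreover have "orbit G (\<lambda>g. \<lambda>h \<in> carrier G. g \<otimes> h \<otimes> inv g) x = conj_class G x"
    using assms by (auto simp: orbit_def conj_class_def)
  ultimately show ?thesis using orbit_stabilizer_theorem[OF assms] by simp
qed

lemma conj_class_subset: "x \<in> carrier G \<Longrightarrow> conj_class G x \<subseteq> carrier G"
  by (auto simp: conj_class_def)

lemma conj_class_self: "x \<in> carrier G \<Longrightarrow> x \<in> conj_class G x"
  unfolding conj_class_def by (auto intro!: exI[of _ \<one>])

lemma conj_conj:
  assumes "g \<in> carrier G" "h \<in> carrier G" "x \<in> carrier G"
  shows "g \<otimes> (h \<otimes> x \<otimes> inv h) \<otimes> inv g = (g \<otimes> h) \<otimes> x \<otimes> inv (g \<otimes> h)"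
  using assms by (simp add: m_assoc inv_mult_group)

lemma conj_class_eq:
  assumes x: "x \<in> carrier G" and y: "y \<in> conj_class G x"
  shows "conj_class G y = conj_class G x"
proof -
  have sub: "conj_class G v \<subseteq> conj_class G u" if u: "u \<in> carrier G" and v: "v \<in> conj_class G u" for u v
  proof
    fix w assume "w \<in> conj_class G v"
    then obtain g where g: "g \<in> carrier G" "w = g \<otimes> v \<otimes> inv g" by (auto simp: conj_class_def)
    obtain h where h: "h \<in> carrier G" "v = h \<otimes> u \<otimes> inv h" using v by (auto simp: conj_class_def)
    have "w = (g \<otimes> h) \<otimes> u \<otimes> inv (g \<otimes> h)"
      using g h u conj_conj by simp
    then show "w \<in> conj_class G u" using g h unfolding conj_class_def by blast
  qed
  obtain h where h: "h \<in> carrier G" "y = h \<otimes> x \<otimes> inv h"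
    using y by (auto simp: conj_class_def)
  have "inv h \<otimes> y \<otimes> inv (inv h) = inv h \<otimes> h \<otimes> x \<otimes> inv (inv h \<otimes> h)"
    unfolding h(2) by (rule conj_conj) (use h x in auto)
  then have "inv h \<otimes> y \<otimes> inv (inv h) = x" using h x by simp
  then have "x \<in> conj_class G y" using h unfolding conj_class_def by (metis (mono_tags, lifting) inv_closed mem_Collect_eq)
  then show ?thesis using sub[OF x y] sub[of y x] y x conj_class_subset by blast
qed

text \<open>
  The conjugacy classes of the noncentral elements of \<open>N\<close> have sizes divisible by \<open>p\<close>, and so has \<open>N\<close>.
  Hence \<open>p\<close> divides the number of central elements in \<open>N\<close>, one of which is \<open>\<one>\<close>.
\<close>

lemma prime_power_group_center:
  fixes p n :: nat
  assumes p: "prime p" and ord: "order G = p ^ n" and N: "N \<lhd> G" and ne: "N \<noteq> {\<one>}"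
  obtains z where "z \<in> N" "z \<noteq> \<one>" "z [^] p = \<one>" "\<And>g. g \<in> carrier G \<Longrightarrow> g \<otimes> z = z \<otimes> g"
proof -
  have fin: "finite (carrier G)"
    using ord p order_gt_0_iff_finite by (simp add: prime_gt_0_nat)
  have sN: "subgroup N G" and inv: "\<And>x h. x \<in> carrier G \<Longrightarrow> h \<in> N \<Longrightarrow> x \<otimes> h \<otimes> inv x \<in> N"
    using N normal_inv_iff by blast+
  have NG: "N \<subseteq> carrier G" using sN subgroup.subset by blast
  have finN: "finite N" using NG fin finite_subset by blast
  define Z where "Z = {z \<in> N. \<forall>g\<in>carrier G. g \<otimes> z = z \<otimes> g}"
  have oneZ: "\<one> \<in> Z" using sN by (auto simp: Z_def subgroup.one_closed)
  have cl: "conj_class G x \<subseteq> N - Z" if x: "x \<in> N - Z" for x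
  proof
    fix y assume y: "y \<in> conj_class G x"
    have xG: "x \<in> carrier G" using x NG by auto
    have "y \<in> N" using y x inv by (auto simp: conj_class_def)
    moreover have "y \<notin> Z"
    proof
      assume "y \<in> Z"
      have "x \<in> conj_class G y"
        using conj_class_eq[OF xG y] conj_class_self[OF xG] by simp
      then obtain g where g: "g \<in> carrier G" "x = g \<otimes> y \<otimes> inv g" by (auto simp: conj_class_def)
      have yG: "y \<in> carrier G" using conj_class_subset[OF xG] y by blast
      have "g \<otimes> y = y \<otimes> g" using \<open>y \<in> Z\<close> g by (simp add: Z_def)
      then have "x = y" using conj_eq_iff[OF g(1) yG yG] g by simp
      then show False using \<open>y \<in> Z\<close> x by simp
    qed
    ultimately show "y \<in> N - Z" by simp
  qed
  have "p dvd card (\<Union> (conj_class G ` (N - Z)))"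
  proof (rule dvd_partition)
    show "finite (\<Union> (conj_class G ` (N - Z)))"
      using cl finN by (meson SUP_least finite_Diff finite_subset)
    show "\<forall>c\<in>conj_class G ` (N - Z). p dvd card c"
    proof
      fix c assume "c \<in> conj_class G ` (N - Z)"
      then obtain x where x: "x \<in> N" "x \<notin> Z" and c: "c = conj_class G x" by blast
      have xG: "x \<in> carrier G" using x NG by auto
      have "card c dvd p ^ n"
        using card_conj_class[OF xG] ord c by (metis dvd_triv_left)
      then obtain i where i: "card c = p ^ i"
        using p divides_primepow_nat by blast
      have "i \<noteq> 0"
      proof
        assume "i = 0"
        then have "c = {x}" using i c conj_class_self[OF xG] by (auto simp: card_Suc_eq)
        then have "g \<otimes> x \<otimes> inv g = x" if "g \<in> carrier G" for g
          using that c unfolding conj_class_def by blast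
        then have "x \<in> Z" using x xG by (auto simp: Z_def conj_eq_iff)
        then show False using x by simp
      qed
      then show "p dvd card c" using i by simp
    qed
    show "\<forall>c1\<in>conj_class G ` (N - Z). \<forall>c2\<in>conj_class G ` (N - Z). c1 \<noteq> c2 \<longrightarrow> c1 \<inter> c2 = {}"
      using conj_class_eq NG by blast
  qed
  moreover have "\<Union> (conj_class G ` (N - Z)) = N - Z"
    using cl conj_class_self NG by blast
  ultimately have dvd: "p dvd card (N - Z)" by simp
  have ZN: "Z \<subseteq> N" by (auto simp: Z_def)
  have "card N dvd p ^ n" using lagrange[OF sN] ord by (metis dvd_triv_right)
  then obtain j where j: "card N = p ^ j" using p divides_primepow_nat by blast
  have "j \<noteq> 0"
  proof
    assume "j = 0"
    then have "card N = 1" using j by simp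
    then show False using ne sN by (metis card_1_singletonE singletonD subgroup.one_closed)
  qed
  then have "p dvd card N" using j by simp
  moreover have "card N = card (N - Z) + card Z"
    using ZN finN by (metis add.commute card_Diff_subset card_mono finite_subset le_add_diff_inverse)
  ultimately have "p dvd card Z" using dvd by (metis dvd_add_right_iff)
  moreover have "card Z > 0" using oneZ ZN finN by (metis card_gt_0_iff empty_iff finite_subset)
  ultimately have "card Z \<noteq> 1" using prime_gt_1_nat[OF p] by auto
  then have "Z \<noteq> {\<one>}" by auto
  then obtain w where w: "w \<in> Z" "w \<noteq> \<one>" using oneZ by blast
  have wG: "w \<in> carrier G" using w ZN NG by blast
  have "ord w dvd p ^ n" using ord_dvd_group_order[OF wG] ord by simp
  moreover have "ord w \<noteq> 1" using w wG ord_eq_1 by blast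
  ultimately have "p dvd ord w"
    using p divides_primepow_nat by (metis dvd_power power_0 neq0_conv)
  then obtain k :: nat where k: "w [^] k \<noteq> \<one>" "(w [^] k) [^] p = \<one>"
    using exists_prime_order_pow[OF fin wG p] by blast
  show ?thesis
  proof (rule that[OF _ k])
    show "w [^] k \<in> N" using w ZN subgroup_int_pow_closed[OF sN, of w "int k"] by (auto simp: int_pow_int)
    show "g \<otimes> w [^] k = w [^] k \<otimes> g" if g: "g \<in> carrier G" for g
    proof -
      have "w \<otimes> g = g \<otimes> w" using w g by (simp add: Z_def)
      then show ?thesis using group_commutes_pow[of w g] wG g by simp
    qed
  qed
qed

text \<open>
  This is the previous lemma for the normal subgroup \<open>B / A\<close> of \<open>G / A\<close>, expressed in terms of
  representatives.
\<close>

lemma prime_power_group_central_step: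
  fixes p n :: nat
  assumes p: "prime p" and ord: "order G = p ^ n" and A: "A \<lhd> G" and B: "B \<lhd> G" and AB: "A \<subset> B"
  obtains y where "y \<in> B - A" "y [^] p \<in> A" "\<And>g. g \<in> carrier G \<Longrightarrow> g \<otimes> y \<otimes> inv g \<otimes> inv y \<in> A"
proof -
  interpret A: normal A G by fact
  interpret B: normal B G by fact
  let ?Q = "G Mod A"
  interpret h: group_hom G ?Q "\<lambda>x. A #> x"
    using A.r_coset_hom_Mod A.factorgroup_is_group group_axioms
    by (simp add: group_hom_def group_hom_axioms_def)
  have surj: "(\<lambda>x. A #> x) ` carrier G = carrier ?Q"
    by (simp add: carrier_FactGroup)
  have B': "(\<lambda>x. A #> x) ` B \<lhd> ?Q"
    by (rule B.surj_hom_normal_subgroup[OF h.group_hom_axioms surj])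
  have "order ?Q dvd p ^ n"
    using lagrange[OF A.subgroup_axioms] ord by (metis FactGroup_def dvd_triv_left order_def partial_object.select_convs(1))
  then obtain m where m: "order ?Q = p ^ m" using p divides_primepow_nat by blast
  have ker: "A #> x = A \<longleftrightarrow> x \<in> A" if "x \<in> carrier G" for x
    using that coset_join1[OF _ that A.subgroup_axioms] coset_join2[OF that A.subgroup_axioms] by blast
  have "(\<lambda>x. A #> x) ` B \<noteq> {\<one>\<^bsub>?Q\<^esub>}"
  proof
    assume eq: "(\<lambda>x. A #> x) ` B = {\<one>\<^bsub>?Q\<^esub>}"
    obtain x where "x \<in> B" "x \<notin> A" using AB by blast
    moreover have "A #> x = A" using eq \<open>x \<in> B\<close> by auto
    ultimately show False using ker[of x] by simp
  qed
  then obtain Z where Z: "Z \<in> (\<lambda>x. A #> x) ` B" "Z \<noteq> \<one>\<^bsub>?Q\<^esub>" "Z [^]\<^bsub>?Q\<^esub> p = \<one>\<^bsub>?Q\<^esub>"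
    and cent: "\<And>g. g \<in> carrier ?Q \<Longrightarrow> g \<otimes>\<^bsub>?Q\<^esub> Z = Z \<otimes>\<^bsub>?Q\<^esub> g"
    using h.H.prime_power_group_center[OF p m B'] by blast
  obtain y where y: "y \<in> B" "Z = A #> y" using Z by blast
  have yG: "y \<in> carrier G" using y by simp
  show ?thesis
  proof (rule that[of y])
    show "y \<in> B - A" using y Z(2) ker[OF yG] by simp
    have "A #> (y [^] p) = A" using Z(3) h.hom_nat_pow[OF yG, of p] y by simp
    then show "y [^] p \<in> A" using ker yG by simp
    show "g \<otimes> y \<otimes> inv g \<otimes> inv y \<in> A" if g: "g \<in> carrier G" for g
    proof -
      have "(A #> g) \<otimes>\<^bsub>?Q\<^esub> (A #> y) = (A #> y) \<otimes>\<^bsub>?Q\<^esub> (A #> g)"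
        using cent[of "A #> g"] g surj y by blast
      then have "A #> (g \<otimes> y) = A #> (y \<otimes> g)"
        using g yG by (metis h.hom_mult)
      then have "g \<otimes> y \<in> A #> (y \<otimes> g)"
        using g yG repr_independenceD[OF A.subgroup_axioms, of "g \<otimes> y" "y \<otimes> g"] by simp
      then obtain a where a: "a \<in> A" "g \<otimes> y = a \<otimes> (y \<otimes> g)" by (auto simp: r_coset_def)
      then have "g \<otimes> y \<otimes> inv (y \<otimes> g) = a"
        using g yG by (metis A.mem_carrier inv_solve_right' m_closed)
      then show ?thesis using g yG a by (simp add: inv_mult_group m_assoc)
    qed
  qed
qed

end

section \<open>Prime power groups of prime rank one\<close>

lemma solve_linear_prime_power:
  fixes p m T k :: nat
  assumes p: "prime p" and T: "\<not> p dvd T"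
  shows "\<exists>j. p ^ m dvd j * T + k"
proof -
  obtain i where i: "[T * i = 1] (mod p ^ m)"
    using prime_power_cong_inverse[OF p T] .
  have "[T * i * ((p ^ m - 1) * k) + k = 1 * ((p ^ m - 1) * k) + k] (mod p ^ m)"
    using i by (intro cong_add cong_mult) auto
  moreover have "1 * ((p ^ m - 1) * k) + k = p ^ m * k"
    using p prime_gt_0_nat[of p] by (simp add: algebra_simps diff_mult_distrib)
  ultimately have "p ^ m dvd T * i * ((p ^ m - 1) * k) + k"
    by (metis cong_dvd_iff dvd_triv_left)
  then show ?thesis
    by (intro exI[of _ "i * ((p ^ m - 1) * k)"]) (simp add: ac_simps)
qed

lemma power_one_plus_cong:
  fixes c d :: nat
  shows "[(1 + d * c) ^ i = 1 + i * (d * c)] (mod d ^ 2)"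
proof (induction i)
  case (Suc i)
  have "[(1 + d * c) * (1 + d * c) ^ i = (1 + d * c) * (1 + i * (d * c))] (mod d ^ 2)"
    using Suc by (intro cong_mult) auto
  also have "(1 + d * c) * (1 + i * (d * c)) = (1 + Suc i * (d * c)) + d ^ 2 * (i * c * c)"
    by (simp add: algebra_simps power2_eq_square)
  also have "[\<dots> = 1 + Suc i * (d * c)] (mod d ^ 2)"
    by (simp add: cong_def)
  finally show ?case by simp
qed auto

text \<open>
  The sum is the exponent that appears in \<open>twisted_power\<close>. By Fermat's theorem \<open>r = 1 + p c\<close> for some \<open>c\<close>,
  so modulo \<open>p\<^sup>2\<close> the sum is \<open>p + p c (0 + 1 + \<dots> + (p - 1))\<close>. For odd \<open>p\<close> the inner sum is a multiple of
  \<open>p\<close>, and the geometric sum is \<open>p\<close> times a number prime to \<open>p\<close>. After division by \<open>p\<close> a linear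
  congruence with invertible coefficient remains.
\<close>

lemma geometric_sum_solvable_odd:
  fixes p m r k :: nat
  assumes p: "prime p" "odd p" and m: "m \<ge> 1" and r: "[r ^ p = 1] (mod p ^ m)" and k: "p dvd k"
  shows "\<exists>j. p ^ m dvd j * (\<Sum>i<p. r ^ i) + k"
proof -
  have "[r ^ p = 1] (mod p)"
    using r m cong_dvd_modulus_nat[of "r ^ p" 1 "p ^ m" p] by (simp add: dvd_power)
  moreover have "[r ^ p = r] (mod p)"
  proof (cases "p dvd r")
    case True
    then have "[r ^ p = 0] (mod p)" "[r = 0] (mod p)"
      using p prime_gt_0_nat[of p] by (auto simp: cong_0_iff intro: dvd_power dvd_trans)
    then show ?thesis by (meson cong_sym cong_trans)
  next
    case False
    then have "[r * r ^ (p - 1) = r * 1] (mod p)"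
      using fermat_theorem[OF p(1)] by (intro cong_mult) auto
    then show ?thesis using p prime_gt_0_nat[of p] by (simp add: power_eq_if)
  qed
  ultimately have r1: "[r = 1] (mod p)" by (meson cong_sym cong_trans)
  have "r > 0"
  proof (rule ccontr)
    assume "\<not> r > 0"
    then show False using r1 p prime_gt_1_nat[of p] by (simp add: cong_def)
  qed
  then have "p dvd r - 1"
    using r1 by (metis Suc_leI One_nat_def cong_altdef_nat)
  then obtain c where "r - 1 = p * c" by (elim dvdE)
  then have rc: "r = 1 + p * c" using \<open>r > 0\<close> by linarith
  define s where "s = (p - 1) div 2"
  have ps: "p = 2 * s + 1" using p s_def by (auto elim: oddE)
  have sum_id: "(\<Sum>i<p. i) = p * s"
  proof -
    have "(\<Sum>i<p. i) = p * (p - 1) div 2"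
      using Sum_Ico_nat[of 0 p] by (simp add: lessThan_atLeast0)
    also have "\<dots> = p * s" using ps by simp
    finally show ?thesis .
  qed
  have "[(\<Sum>i<p. r ^ i) = (\<Sum>i<p. 1 + i * (p * c))] (mod p ^ 2)"
    unfolding rc by (intro cong_sum power_one_plus_cong)
  also have "(\<Sum>i<p. 1 + i * (p * c)) = p + (\<Sum>i<p. i) * (p * c)"
    by (simp only: sum.distrib sum_distrib_right) simp
  also have "\<dots> = p + p ^ 2 * (s * c)" by (simp add: sum_id power2_eq_square)
  also have "[\<dots> = p] (mod p ^ 2)" by (simp add: cong_def)
  finally have T: "[(\<Sum>i<p. r ^ i) = p] (mod p ^ 2)" .
  then have "p dvd (\<Sum>i<p. r ^ i)"
    using cong_dvd_modulus_nat[OF T, of p] by (metis cong_dvd_iff dvd_refl dvd_power zero_less_numeral)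
  then obtain T' where T': "(\<Sum>i<p. r ^ i) = p * T'" by (elim dvdE)
  have "\<not> p dvd T'"
  proof
    assume "p dvd T'"
    then have "p ^ 2 dvd p * T'" by (simp add: power2_eq_square)
    then have "p ^ 2 dvd p" using T T' by (metis cong_dvd_iff)
    then show False
      using prime_gt_1_nat[OF p(1)] by (auto simp: power2_eq_square dest: dvd_imp_le)
  qed
  obtain k' where k': "k = p * k'" using k by (elim dvdE)
  obtain j where "p ^ m dvd j * T' + k'"
    using solve_linear_prime_power[OF p(1) \<open>\<not> p dvd T'\<close>] by blast
  then have "p ^ m dvd p * (j * T' + k')" by simp
  then show ?thesis
    by (intro exI[of _ j]) (simp add: T' k' algebra_simps)
qed

text \<open>
  For \<open>p = 2\<close> the geometric sum is \<open>1 + r\<close>. If \<open>r\<close> is \<open>1\<close> modulo \<open>4\<close>, it is twice an odd number and some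
  \<open>j\<close> works as in the odd case. Otherwise \<open>r - 1\<close> is twice an odd number, and the congruences for \<open>r\<^sup>2\<close>
  and for \<open>r k\<close> show that \<open>2\<^bsup>m-1\<^esup>\<close> divides \<open>r + 1\<close> and \<open>k\<close>. Taking \<open>j = 0\<close> determines \<open>k\<close>, and then \<open>j = 1\<close>
  excludes that \<open>r + 1\<close> is an odd multiple of \<open>2\<^bsup>m-1\<^esup>\<close>.
\<close>

lemma geometric_sum_unsolvable_two:
  fixes m r k :: nat
  assumes m: "m \<ge> 1" and r: "[r ^ 2 = 1] (mod 2 ^ m)" and k: "even k"
    and fixed: "[r * k = k] (mod 2 ^ m)" and no: "\<And>j. \<not> 2 ^ m dvd j * (1 + r) + k"
  shows "2 ^ m dvd r + 1 \<and> m \<ge> 2 \<and> [k = 2 ^ (m - 1)] (mod 2 ^ m)"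
proof -
  have pow: "2 ^ m = 2 * (2::nat) ^ (m - 1)" using m by (simp add: power_eq_if)
  have half: "[x = 2 ^ (m - 1)] (mod 2 ^ m)" if "2 ^ (m - 1) dvd x" "\<not> 2 ^ m dvd x" for x :: nat
  proof -
    obtain y where y: "x = 2 ^ (m - 1) * y" using \<open>2 ^ (m - 1) dvd x\<close> by (elim dvdE)
    have "odd y" using y \<open>\<not> 2 ^ m dvd x\<close> pow by (auto elim!: evenE)
    then obtain z where "y = 2 * z + 1" by (elim oddE)
    then have "x = 2 ^ m * z + 2 ^ (m - 1)" using y pow by (simp add: algebra_simps)
    then show ?thesis by (simp add: cong_def)
  qed
  have m2: "m \<ge> 2"
  proof (rule ccontr)
    assume "\<not> m \<ge> 2"
    then have "m = 1" using m by simp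
    then show False using no[of 0] k by simp
  qed
  have "[r ^ 2 = 1] (mod 2)"
    using r m cong_dvd_modulus_nat[of "r ^ 2" 1 "2 ^ m" 2] by (simp add: dvd_power)
  then have "odd r"
    by (metis cong_dvd_iff dvd_refl even_power odd_one zero_less_numeral)
  have r3: "r mod 4 = 3"
  proof (rule ccontr)
    assume "r mod 4 \<noteq> 3"
    then have "r mod 4 = 1" using \<open>odd r\<close> by presburger
    then have "r = 4 * (r div 4) + 1" by presburger
    then obtain t where t: "1 + r = 2 * (2 * t + 1)" by (metis (no_types) mult.assoc numeral_Bit0
        add.assoc add.commute distrib_left mult.right_neutral mult_2 one_add_one)
    obtain k' where k': "k = 2 * k'" using k by (elim evenE)
    obtain j where "2 ^ m dvd j * (2 * t + 1) + k'"
      using solve_linear_prime_power[OF two_is_prime_nat, of "2 * t + 1"] by auto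
    then have "2 ^ m dvd 2 * (j * (2 * t + 1) + k')" by (rule dvd_mult)
    moreover have "j * (1 + r) + k = 2 * (j * (2 * t + 1) + k')" unfolding t k' by (simp add: algebra_simps)
    ultimately have "2 ^ m dvd j * (1 + r) + k" by metis
    then show False using no by blast
  qed
  define o' where "o' = (r - 1) div 2"
  have o': "r = 2 * o' + 1" "odd o'" using r3 \<open>odd r\<close> unfolding o'_def by presburger+
  have cop: "coprime (2 ^ (m - 1)) o'" using o' by simp
  have "2 ^ m dvd r * k - k"
    using fixed o' by (metis cong_altdef_nat le_add2 mult_eq_if mult_is_0 nat_le_linear add.commute
        le_add1 mult.commute mult_le_mono1 mult_1 odd_pos Suc_leI One_nat_def \<open>odd r\<close>)
  moreover have "r * k - k = 2 * (o' * k)" using o' by (simp add: algebra_simps)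
  ultimately have "2 ^ (m - 1) dvd o' * k" by (simp add: pow)
  then have kd: "2 ^ (m - 1) dvd k" using cop coprime_dvd_mult_right_iff by blast
  have k1: "[k = 2 ^ (m - 1)] (mod 2 ^ m)" using half[OF kd] no[of 0] by simp
  have "2 ^ m dvd r ^ 2 - 1"
    using r o' by (metis cong_altdef_nat le_add2 one_le_power)
  moreover have "r ^ 2 - 1 = 2 * (o' * (r + 1))" using o' by (simp add: algebra_simps power2_eq_square)
  ultimately have "2 ^ (m - 1) dvd o' * (r + 1)" 
    by (metis dvd_times_left_cancel_iff pow zero_neq_numeral)
  then have rd: "2 ^ (m - 1) dvd r + 1" using cop coprime_dvd_mult_right_iff by blast
  have "2 ^ m dvd r + 1"
  proof (rule ccontr)
    assume "\<not> 2 ^ m dvd r + 1"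
    then have "[(r + 1) + k = 2 ^ (m - 1) + 2 ^ (m - 1)] (mod 2 ^ m)"
      using half[OF rd] k1 by (intro cong_add)
    moreover have "2 ^ (m - 1) + 2 ^ (m - 1) = (2::nat) ^ m" using pow by simp
    ultimately have "2 ^ m dvd r + 1 + k" by (metis cong_dvd_iff dvd_refl)
    then have "2 ^ m dvd 1 * (1 + r) + k" by (simp add: ac_simps)
    then show False using no by blast
  qed
  then show ?thesis using m2 k1 by simp
qed

context group
begin

lemma conj_pow:
  fixes i :: nat
  assumes "g \<in> carrier G" "x \<in> carrier G"
  shows "(g \<otimes> x \<otimes> inv g) [^] i = g \<otimes> x [^] i \<otimes> inv g"
proof (induction i)
  case (Suc i)
  have "inv g \<otimes> (g \<otimes> (x \<otimes> inv g)) = x \<otimes> inv g"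
    using assms by (simp add: m_assoc[symmetric])
  then show ?case using assms Suc by (simp add: m_assoc)
qed (use assms in simp)

lemma twisted_commute:
  fixes r i j :: nat
  assumes a: "a \<in> carrier G" and g: "g \<in> carrier G" and r: "g \<otimes> a = a [^] r \<otimes> g"
  shows "g [^] i \<otimes> a [^] j = a [^] (r ^ i * j) \<otimes> g [^] i"
proof -
  have one: "g \<otimes> a [^] j = a [^] (r * j) \<otimes> g" for j :: nat
  proof -
    have "g \<otimes> a \<otimes> inv g = a [^] r" by (subst conj_eq_iff) (use r a g in auto)
    then have "g \<otimes> a [^] j \<otimes> inv g = a [^] (r * j)"
      using conj_pow[OF g a] a by (metis nat_pow_pow)
    then show ?thesis using a g conj_eq_iff by simp
  qed
  show ?thesis
  proof (induction i arbitrary: j)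
    case 0
    then show ?case using a by simp
  next
    case (Suc i)
    have "g [^] Suc i \<otimes> a [^] j = g [^] i \<otimes> (g \<otimes> a [^] j)"
      using a g by (simp add: m_assoc)
    also have "\<dots> = g [^] i \<otimes> a [^] (r * j) \<otimes> g"
      using a g one by (simp add: m_assoc)
    also have "g [^] i \<otimes> a [^] (r * j) = a [^] (r ^ i * (r * j)) \<otimes> g [^] i"
      by (rule Suc.IH)
    finally show ?case using a g by (simp add: m_assoc ac_simps)
  qed
qed

text \<open>
  Each factor \<open>g\<close> that is moved to the right end multiplies the exponents of \<open>a\<close> behind it by \<open>r\<close>.
\<close>

lemma twisted_power:
  fixes r i j :: nat
  assumes a: "a \<in> carrier G" and g: "g \<in> carrier G" and r: "g \<otimes> a = a [^] r \<otimes> g"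
  shows "(a [^] j \<otimes> g) [^] i = a [^] (j * (\<Sum>t<i. r ^ t)) \<otimes> g [^] i"
proof (induction i)
  case 0
  then show ?case by simp
next
  case (Suc i)
  have "(a [^] j \<otimes> g) [^] Suc i = a [^] (j * (\<Sum>t<i. r ^ t)) \<otimes> (g [^] i \<otimes> a [^] j) \<otimes> g"
    using a g Suc by (simp add: m_assoc)
  also have "\<dots> = a [^] (j * (\<Sum>t<i. r ^ t)) \<otimes> (a [^] (r ^ i * j) \<otimes> g [^] i) \<otimes> g"
    using twisted_commute[OF a g r] by simp
  also have "\<dots> = a [^] (j * (\<Sum>t<i. r ^ t)) \<otimes> a [^] (r ^ i * j) \<otimes> g [^] Suc i"
    using a g by (simp add: m_assoc)
  also have "a [^] (j * (\<Sum>t<i. r ^ t)) \<otimes> a [^] (r ^ i * j) = a [^] (j * (\<Sum>t<Suc i. r ^ t))"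
    using a by (simp add: nat_pow_mult algebra_simps)
  finally show ?case .
qed

lemma commute_inv:
  assumes "y \<in> carrier G" "b \<in> carrier G" "y \<otimes> b = b \<otimes> y"
  shows "y \<otimes> inv b = inv b \<otimes> y"
proof -
  have "b \<otimes> (y \<otimes> inv b) = (y \<otimes> b) \<otimes> inv b"
    unfolding assms(3) using assms(1,2) by (simp add: m_assoc)
  also have "\<dots> = y" using assms(1,2) by (simp add: m_assoc)
  finally have "b \<otimes> (y \<otimes> inv b) = y" .
  then show ?thesis using assms by (metis inv_solve_left inv_closed m_closed)
qed

lemma inverting_element:
  assumes g: "g \<in> carrier G" and a: "a \<in> carrier G" and eq: "g \<otimes> a = inv a \<otimes> g"
  shows "g \<otimes> inv a = a \<otimes> g" "inv g \<otimes> a = inv a \<otimes> inv g"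
proof -
  have "g \<otimes> a \<otimes> inv g = inv a" by (subst conj_eq_iff) (use assms in auto)
  then have "inv (g \<otimes> a \<otimes> inv g) = a" using a by simp
  then have "g \<otimes> inv a \<otimes> inv g = a" using a g by (simp add: inv_mult_group m_assoc)
  then show 1: "g \<otimes> inv a = a \<otimes> g" by (rule iffD1[OF conj_eq_iff, rotated -1]) (use a g in auto)
  have "inv g \<otimes> a \<otimes> inv (inv g) = inv g \<otimes> (a \<otimes> g)" using a g by (simp add: m_assoc)
  also have "\<dots> = inv a" unfolding 1[symmetric] using a g by (simp add: m_assoc[symmetric])
  finally show "inv g \<otimes> a = inv a \<otimes> inv g" by (rule iffD1[OF conj_eq_iff, rotated -1]) (use a g in auto)
qed

lemma normal_generate_singleton:
  assumes a: "a \<in> carrier G" and "\<And>g. g \<in> carrier G \<Longrightarrow> g \<otimes> a \<otimes> inv g \<in> generate G {a}"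
    and fin: "finite (carrier G)"
  shows "generate G {a} \<lhd> G"
proof (rule normal_invI)
  show sub: "subgroup (generate G {a}) G" using a generate_is_subgroup by simp
  fix g h assume g: "g \<in> carrier G" and "h \<in> generate G {a}"
  then obtain i :: nat where i: "h = a [^] i" using mem_generate_iff[OF fin a] by blast
  obtain j :: nat where j: "g \<otimes> a \<otimes> inv g = a [^] j"
    using assms(2)[OF g] mem_generate_iff[OF fin a] by blast
  have "g \<otimes> h \<otimes> inv g = a [^] (j * i)"
    using conj_pow[OF g a, of i] i j a by (simp add: nat_pow_pow)
  then show "g \<otimes> h \<otimes> inv g \<in> generate G {a}" using mem_generate_iff[OF fin a] by blast
qed

lemma generate_mono_pow:
  assumes fin: "finite (carrier G)" and a: "a \<in> carrier G" and y: "y \<in> generate G {a}"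
  shows "generate G {y} \<subseteq> generate G {a}"
  using generate_subgroup_incl[of "{y}" "generate G {a}"] generate_is_subgroup[of "{a}"] a y by simp

lemma pow_inverse_exponent:
  fixes p m k :: nat
  assumes x: "x \<in> carrier G" and ord: "ord x = p ^ m" and p: "prime p" and k: "\<not> p dvd k"
  obtains l :: nat where "(x [^] k) [^] l = x"
proof -
  obtain l where "[k * l = 1] (mod p ^ m)" using prime_power_cong_inverse[OF p k] .
  then have "x [^] (k * l) = x [^] (1::nat)" using pow_cong_ord[OF x] ord by simp
  then show ?thesis using x that by (simp add: nat_pow_pow)
qed

text \<open>
  Take \<open>a\<close> of the largest order among the generators of normal cyclic subgroups. If its centralizer were
  larger than \<open>\<langle>a\<rangle>\<close>, it would contain some \<open>y\<close> outside \<open>\<langle>a\<rangle>\<close> that is central modulo \<open>\<langle>a\<rangle>\<close> and satisfies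
  \<open>y\<^sup>p = a\<^sup>k\<close>. If \<open>p\<close> does not divide \<open>k\<close>, then \<open>\<langle>y\<rangle>\<close> contains \<open>a\<close> and is a normal cyclic subgroup of larger
  order. If it does, then the \<open>p\<close>-th power of \<open>y a\<^bsup>-k/p\<^esup>\<close> is trivial, so this element lies in \<open>\<langle>a\<rangle>\<close>,
  and with it \<open>y\<close>.
\<close>

lemma maximal_normal_cyclic_subgroup:
  fixes p n :: nat
  assumes p: "prime p" and ord: "order G = p ^ n" and P: "prime_rank_one G" and ne: "carrier G \<noteq> {\<one>}"
  obtains a m where "a \<in> carrier G" "ord a = p ^ m" "m \<ge> 1" "generate G {a} \<lhd> G"
    "\<And>v. v \<in> carrier G \<Longrightarrow> v [^] p = \<one> \<Longrightarrow> v \<in> generate G {a}"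
    "centralizer G a \<subseteq> generate G {a}"
proof -
  have fin: "finite (carrier G)"
    using ord p order_gt_0_iff_finite by (simp add: prime_gt_0_nat)
  have "carrier G \<lhd> G" by (rule normal_invI) (auto simp: subgroup_self)
  then obtain z where z: "z \<in> carrier G" "z \<noteq> \<one>" "z [^] p = \<one>"
    and cent: "\<And>g. g \<in> carrier G \<Longrightarrow> g \<otimes> z = z \<otimes> g"
    using prime_power_group_center[OF p ord _ ne] by blast
  \<comment> \<open>\<open>S\<close> has nontrivial elements, namely the central ones\<close>
  define S where "S = {a \<in> carrier G. generate G {a} \<lhd> G}"
  have "g \<otimes> z \<otimes> inv g \<in> generate G {z}" if g: "g \<in> carrier G" for g
  proof -
    have "g \<otimes> z \<otimes> inv g = z" by (subst conj_eq_iff) (use cent[OF g] g z in auto)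
    then show ?thesis by (simp add: generate.incl)
  qed
  then have zS: "z \<in> S"
    using normal_generate_singleton[OF z(1) _ fin] z by (simp add: S_def)
  have "finite (ord ` S)" using fin by (auto simp: S_def)
  then have "Max (ord ` S) \<in> ord ` S" using zS by (intro Max_in) auto
  then obtain a where aS: "a \<in> S" and max: "ord a = Max (ord ` S)" by auto
  have amax: "ord b \<le> ord a" if "b \<in> S" for b
    using that max \<open>finite (ord ` S)\<close> by simp
  have a: "a \<in> carrier G" and nA: "generate G {a} \<lhd> G" using aS by (auto simp: S_def)
  interpret A: normal "generate G {a}" G by fact
  have "ord a dvd p ^ n" using ord_dvd_group_order[OF a] ord by simp
  then obtain m where m: "ord a = p ^ m" using p divides_primepow_nat by blast
  have "ord z > 1" using ord_prime[OF p z] prime_gt_1_nat[OF p] by simp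
  then have "ord a \<noteq> 1" using amax[OF zS] by simp
  then have m1: "m \<ge> 1" using m by (cases m) auto
  obtain k :: nat where k: "a [^] k \<noteq> \<one>" "(a [^] k) [^] p = \<one>"
    using exists_prime_order_pow[OF fin a p] m m1 by (metis dvd_power zero_less_one order_less_le_trans)
  have small: "v \<in> generate G {a}" if v: "v \<in> carrier G" "v [^] p = \<one>" for v
  proof (cases "v = \<one>")
    case False
    have "a [^] k \<otimes> z = z \<otimes> a [^] k" using cent a by simp
    then obtain i :: nat where i: "z = (a [^] k) [^] i"
      using prime_rank_oneD[OF P p p _ z(1) k(1) z(2) k(2) z(3)] a by auto
    have "z \<otimes> v = v \<otimes> z" using cent v by simp
    then obtain j :: nat where j: "v = z [^] j"
      using prime_rank_oneD[OF P p p z(1) v(1) z(2) False z(3) v(2)] by auto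
    have "v = a [^] (k * i * j)" using i j a by (simp add: nat_pow_pow)
    then show ?thesis using mem_generate_iff[OF fin a] by blast
  qed (use A.one_closed in auto)
  have cen: "centralizer G a \<subseteq> generate G {a}"
  proof (rule ccontr)
    assume not: "\<not> centralizer G a \<subseteq> generate G {a}"
    have sC: "subgroup (centralizer G a) G" using subgroup_centralizer[OF a] .
    have AC: "generate G {a} \<subseteq> centralizer G a"
      using generate_subgroup_incl[OF _ sC, of "{a}"] a by (auto simp: centralizer_def)
    have nC: "centralizer G a \<lhd> G"
    proof (rule normal_invI[OF sC])
      fix g h assume g: "g \<in> carrier G" and h: "h \<in> centralizer G a"
      have hG: "h \<in> carrier G" and ha: "h \<otimes> a = a \<otimes> h" using h by (auto simp: centralizer_def)
      have "inv g \<otimes> a \<otimes> g \<in> generate G {a}"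
        using A.inv_op_closed1[OF g] a by (simp add: generate.incl)
      then obtain j :: nat where j: "inv g \<otimes> a \<otimes> g = a [^] j" using mem_generate_iff[OF fin a] by blast
      have c: "a [^] j \<otimes> h = h \<otimes> a [^] j" using group_commutes_pow[of a h j] ha a hG by simp
      have ag: "a \<otimes> g = g \<otimes> a [^] j"
        using j a g by (metis inv_closed inv_solve_left m_closed m_assoc nat_pow_closed)
      have ga: "inv g \<otimes> a = a [^] j \<otimes> inv g"
        using j a g by (metis inv_closed inv_solve_right' m_closed nat_pow_closed)
      have "g \<otimes> h \<otimes> inv g \<otimes> a = g \<otimes> h \<otimes> a [^] j \<otimes> inv g"
        using g hG a ga by (simp add: m_assoc)
      also have "\<dots> = g \<otimes> (a [^] j \<otimes> h) \<otimes> inv g" using g hG a c by (simp add: m_assoc)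
      also have "\<dots> = a \<otimes> g \<otimes> h \<otimes> inv g" unfolding ag using g hG a by (simp add: m_assoc)
      finally show "g \<otimes> h \<otimes> inv g \<in> centralizer G a"
        using g hG a by (simp add: centralizer_def m_assoc)
    qed
    obtain y where y: "y \<in> centralizer G a - generate G {a}" "y [^] p \<in> generate G {a}"
      and yc: "\<And>g. g \<in> carrier G \<Longrightarrow> g \<otimes> y \<otimes> inv g \<otimes> inv y \<in> generate G {a}"
      using prime_power_group_central_step[OF p ord nA nC] not AC by blast
    have yG: "y \<in> carrier G" and ya: "y \<otimes> a = a \<otimes> y" using y by (auto simp: centralizer_def)
    obtain k :: nat where k: "y [^] p = a [^] k" using y(2) mem_generate_iff[OF fin a] by blast
    show False
    proof (cases "p dvd k")
      case False
      obtain l :: nat where "(a [^] k) [^] l = a" using pow_inverse_exponent[OF a m p False] .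
      then have "a = y [^] (p * l)" using k yG by (simp add: nat_pow_pow[symmetric])
      then have aY: "a \<in> generate G {y}" using mem_generate_iff[OF fin yG] by blast
      have AY: "generate G {a} \<subseteq> generate G {y}" using generate_mono_pow[OF fin yG aY] .
      have sY: "subgroup (generate G {y}) G" using generate_is_subgroup yG by simp
      have yY: "y \<in> generate G {y}" by (simp add: generate.incl)
      have "g \<otimes> y \<otimes> inv g \<in> generate G {y}" if g: "g \<in> carrier G" for g
      proof -
        have "g \<otimes> y \<otimes> inv g \<otimes> inv y \<otimes> y \<in> generate G {y}"
          by (rule subgroup.m_closed[OF sY subsetD[OF AY yc[OF g]] yY])
        then show ?thesis using g yG by (simp add: m_assoc)
      qed
      then have "y \<in> S" using normal_generate_singleton[OF yG _ fin] yG by (simp add: S_def)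
      moreover have "generate G {a} \<subset> generate G {y}" using AY yY y by blast
      then have "card (generate G {a}) < card (generate G {y})"
        using fin sY subgroup.subset finite_subset psubset_card_mono by metis
      then have "ord a < ord y" using generate_pow_card a yG by simp
      ultimately show False using amax by (meson not_le)
    next
      case True
      then obtain k' where k': "k = p * k'" by (elim dvdE)
      let ?w = "y \<otimes> inv (a [^] k')"
      have w: "?w \<in> carrier G" using yG a by simp
      have "y \<otimes> inv (a [^] k') = inv (a [^] k') \<otimes> y"
        using commute_inv[of y "a [^] k'"] ya yG a group_commutes_pow[of a y k'] by simp
      then have "?w [^] p = y [^] p \<otimes> inv (a [^] k') [^] p"
        using pow_mult_distrib yG a by simp
      also have "\<dots> = a [^] k \<otimes> inv (a [^] k)"
        using k k' a by (simp add: nat_pow_inv nat_pow_pow mult.commute)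
      also have "\<dots> = \<one>" using a by simp
      finally have "?w \<in> generate G {a}" using small w by blast
      moreover have "a [^] k' \<in> generate G {a}" using mem_generate_iff[OF fin a] by blast
      ultimately have "?w \<otimes> a [^] k' \<in> generate G {a}" by (rule A.m_closed)
      then have "y \<in> generate G {a}" using yG a by (simp add: m_assoc)
      then show False using y by simp
    qed
  qed
  show ?thesis by (rule that[OF a m m1 nA small cen])
qed

text \<open>
  Let \<open>g a g\<^sup>-\<^sup>1 = a\<^sup>r\<close> and \<open>g\<^sup>p = a\<^sup>k\<close>. If \<open>p\<close> did not divide \<open>k\<close>, then \<open>a\<close> would be a power of \<open>g\<close> and \<open>g\<close> would
  centralize it. The elements \<open>a\<^sup>j g\<close> are not in \<open>\<langle>a\<rangle>\<close>, so their \<open>p\<close>-th powers are nontrivial; by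
  \<open>twisted_power\<close> this is the unsolvable congruence of the two lemmas on geometric sums.
\<close>

lemma outside_maximal_normal_cyclic:
  fixes p m :: nat
  assumes fin: "finite (carrier G)" and p: "prime p"
    and a: "a \<in> carrier G" "ord a = p ^ m" "m \<ge> 1" and nA: "generate G {a} \<lhd> G"
    and small: "\<And>v. v \<in> carrier G \<Longrightarrow> v [^] p = \<one> \<Longrightarrow> v \<in> generate G {a}"
    and cen: "centralizer G a \<subseteq> generate G {a}"
    and g: "g \<in> carrier G" "g \<notin> generate G {a}" "g [^] p \<in> generate G {a}"
  shows "p = 2 \<and> m \<ge> 2 \<and> g \<otimes> a \<otimes> inv g = inv a \<and> g \<otimes> g = a [^] ((2::nat) ^ (m - 1))"
proof -
  interpret A: normal "generate G {a}" G by fact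
  have "g \<otimes> a \<otimes> inv g \<in> generate G {a}"
    using A.inv_op_closed2[OF g(1)] by (simp add: generate.incl)
  then obtain r :: nat where r': "g \<otimes> a \<otimes> inv g = a [^] r" using mem_generate_iff[OF fin a(1)] by blast
  then have r: "g \<otimes> a = a [^] r \<otimes> g" using conj_eq_iff g a by simp
  obtain k :: nat where k: "g [^] p = a [^] k" using g(3) mem_generate_iff[OF fin a(1)] by blast
  have pk: "p dvd k"
  proof (rule ccontr)
    assume "\<not> p dvd k"
    then obtain l :: nat where "(a [^] k) [^] l = a" using pow_inverse_exponent[OF a(1,2) p] by blast
    then have "a = g [^] (p * l)" using k g by (simp add: nat_pow_pow[symmetric])
    then have "g \<otimes> a = a \<otimes> g" using g by (metis group_commutes_pow)
    then show False using cen g by (auto simp: centralizer_def)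
  qed
  have "g [^] p \<otimes> a [^] (1::nat) = a [^] (r ^ p * 1) \<otimes> g [^] p"
    using twisted_commute[OF a(1) g(1) r] .
  moreover have "g [^] p \<otimes> a = a \<otimes> g [^] p" unfolding k using a by (metis nat_pow_comm nat_pow_eone)
  ultimately have "a [^] (r ^ p) = a [^] (1::nat)" using a g by simp
  then have rp: "[r ^ p = 1] (mod p ^ m)" using pow_eq_iff_cong[OF a(1)] a(2) by metis
  have no: "\<not> p ^ m dvd j * (\<Sum>t<p. r ^ t) + k" for j
  proof
    assume "p ^ m dvd j * (\<Sum>t<p. r ^ t) + k"
    then have "a [^] (j * (\<Sum>t<p. r ^ t) + k) = \<one>" using a pow_eq_id by simp
    then have "(a [^] j \<otimes> g) [^] p = \<one>"
      using twisted_power[OF a(1) g(1) r] k a by (simp add: nat_pow_mult)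
    then have "a [^] j \<otimes> g \<in> generate G {a}" using small a g by simp
    moreover have "inv (a [^] j) \<in> generate G {a}" using mem_generate_iff[OF fin a(1)] by blast
    ultimately have "inv (a [^] j) \<otimes> (a [^] j \<otimes> g) \<in> generate G {a}" by blast
    then show False using a g by (simp add: m_assoc[symmetric])
  qed
  have p2: "p = 2"
  proof (rule ccontr)
    assume "p \<noteq> 2"
    then have "odd p" using p prime_odd_nat prime_ge_2_nat by (metis le_neq_implies_less)
    then show False using geometric_sum_solvable_odd[OF p _ a(3) rp pk] no by blast
  qed
  have "g \<otimes> g [^] p = g [^] p \<otimes> g" using g by (metis nat_pow_comm nat_pow_eone)
  then have "a [^] (r * k) \<otimes> g = a [^] k \<otimes> g"
    using twisted_commute[OF a(1) g(1) r, of 1 k] k g by simp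
  then have "a [^] (r * k) = a [^] k" using a g by simp
  then have fixed: "[r * k = k] (mod 2 ^ m)" using pow_eq_iff_cong[OF a(1)] a(2) p2 by simp
  have res: "2 ^ m dvd r + 1 \<and> m \<ge> 2 \<and> [k = 2 ^ (m - 1)] (mod 2 ^ m)"
    by (rule geometric_sum_unsolvable_two)
      (use a rp pk fixed no p2 in \<open>auto simp: numeral_2_eq_2\<close>)
  have "a [^] r \<otimes> a = \<one>"
    using res a p2 pow_eq_id[OF a(1), of "r + 1"] by simp
  then have "a [^] r = inv a" using a inv_equality by (metis nat_pow_closed)
  moreover have "a [^] k = a [^] ((2::nat) ^ (m - 1))"
    using res pow_cong_ord[OF a(1)] a(2) p2 by simp
  moreover have "g \<otimes> g = g [^] p" using p2 g by (simp add: numeral_2_eq_2)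
  ultimately show ?thesis using p2 res r' k by simp
qed

text \<open>
  A suitable power of any element outside \<open>\<langle>a\<rangle>\<close> satisfies the hypotheses of the previous lemma. So \<open>p = 2\<close>
  unless \<open>G = \<langle>a\<rangle>\<close>. In fact every \<open>y\<close> outside \<open>\<langle>a\<rangle>\<close> has its square in \<open>\<langle>a\<rangle>\<close> and inverts \<open>a\<close>: otherwise some
  power \<open>w\<close> of \<open>y\<close> would have a square that inverts \<open>a\<close>, and \<open>w a w\<^sup>-\<^sup>1 = a\<^sup>s\<close> would make \<open>-1\<close> a square
  modulo \<open>4\<close>. Two elements that invert \<open>a\<close> differ by an element of the centralizer \<open>\<langle>a\<rangle>\<close>, so the index of
  \<open>\<langle>a\<rangle>\<close> is two.
\<close>

theorem prime_power_group_cases: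
  fixes p n :: nat
  assumes p: "prime p" and ord: "order G = p ^ n" and P: "prime_rank_one G"
  obtains (cyclic) a where "a \<in> carrier G" "carrier G = generate G {a}"
  | (quaternion) a g m where "p = 2" "m \<ge> 2" "a \<in> carrier G" "ord a = 2 ^ m" "g \<in> carrier G"
      "g \<notin> generate G {a}" "carrier G = generate G {a} \<union> (generate G {a} #> g)"
      "g \<otimes> a \<otimes> inv g = inv a" "g \<otimes> g = a [^] ((2::nat) ^ (m - 1))"
proof (cases "carrier G = {\<one>}")
  case True
  then have "carrier G = generate G {\<one>}" by (simp add: generate_one)
  then show ?thesis using cyclic one_closed by blast
next
  case False
  have fin: "finite (carrier G)"
    using ord p order_gt_0_iff_finite by (simp add: prime_gt_0_nat)
  obtain a m where a: "a \<in> carrier G" "ord a = p ^ m" "m \<ge> 1" and nA: "generate G {a} \<lhd> G"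
    and small: "\<And>v. v \<in> carrier G \<Longrightarrow> v [^] p = \<one> \<Longrightarrow> v \<in> generate G {a}"
    and cen: "centralizer G a \<subseteq> generate G {a}"
    using maximal_normal_cyclic_subgroup[OF p ord P False] by metis
  interpret A: normal "generate G {a}" G by fact
  have out: "p = 2 \<and> m \<ge> 2 \<and> y \<otimes> a \<otimes> inv y = inv a \<and> y \<otimes> y = a [^] ((2::nat) ^ (m - 1))"
    if "y \<in> carrier G" "y \<notin> generate G {a}" "y [^] p \<in> generate G {a}" for y
    by (rule outside_maximal_normal_cyclic[OF fin p a nA _ cen]) (use small that in auto)
  have last_power: "\<exists>i. y [^] (p ^ i) \<notin> generate G {a} \<and> (y [^] (p ^ i)) [^] p \<in> generate G {a}"
    if y: "y \<in> carrier G" "y \<notin> generate G {a}" for y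
  proof -
    have "y [^] (p ^ n) = \<one>" using pow_order_eq_1[OF y(1)] ord by simp
    then have ex: "y [^] (p ^ n) \<in> generate G {a}" by simp
    define l where "l = (LEAST i. y [^] (p ^ i) \<in> generate G {a})"
    have l: "y [^] (p ^ l) \<in> generate G {a}" unfolding l_def by (rule LeastI[of _ n]) (rule ex)
    have "l \<noteq> 0" using l y by (cases l) auto
    then obtain i where i: "l = Suc i" by (cases l) auto
    have "y [^] (p ^ i) \<notin> generate G {a}"
      using not_less_Least[of i "\<lambda>i. y [^] (p ^ i) \<in> generate G {a}"] i l_def by simp
    moreover have "(y [^] (p ^ i)) [^] p \<in> generate G {a}"
      using l i y by (simp add: nat_pow_pow mult.commute)
    ultimately show ?thesis by blast
  qed
  show ?thesis
  proof (cases "carrier G = generate G {a}")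
    case True
    then show ?thesis using cyclic a by blast
  next
    case False
    then obtain g0 where g0: "g0 \<in> carrier G" "g0 \<notin> generate G {a}" using A.subset by blast
    then obtain i where "g0 [^] (p ^ i) \<notin> generate G {a}" "(g0 [^] (p ^ i)) [^] p \<in> generate G {a}"
      using last_power by blast
    then have p2: "p = 2" and m2: "m \<ge> 2" using out[of "g0 [^] (p ^ i)"] g0 by auto
    have inverts: "y \<otimes> a \<otimes> inv y = inv a \<and> y \<otimes> y = a [^] ((2::nat) ^ (m - 1))"
      if y: "y \<in> carrier G" "y \<notin> generate G {a}" for y
    proof -
      obtain i where i: "y [^] (p ^ i) \<notin> generate G {a}" "(y [^] (p ^ i)) [^] p \<in> generate G {a}"
        using last_power[OF y] by blast
      show ?thesis
      proof (cases i)
        case 0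
        then show ?thesis using i out[OF y] y by simp
      next
        case (Suc l)
        let ?w = "y [^] (p ^ l)"
        have w: "?w \<in> carrier G" using y by simp
        have ww: "y [^] (p ^ i) = ?w [^] (2::nat)" using Suc y p2 by (simp add: nat_pow_pow mult.commute)
        have "?w \<otimes> a \<otimes> inv ?w \<in> generate G {a}"
          using A.inv_op_closed2[OF w] by (simp add: generate.incl)
        then obtain s :: nat where "?w \<otimes> a \<otimes> inv ?w = a [^] s" using mem_generate_iff[OF fin a(1)] by blast
        then have s: "?w \<otimes> a = a [^] s \<otimes> ?w" using conj_eq_iff w a by simp
        have "?w [^] (2::nat) \<otimes> a [^] (1::nat) = a [^] (s ^ 2 * 1) \<otimes> ?w [^] (2::nat)"
          using twisted_commute[OF a(1) w s] .
        then have "?w [^] (2::nat) \<otimes> a \<otimes> inv (?w [^] (2::nat)) = a [^] (s ^ 2)"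
          by (subst conj_eq_iff) (use a w in auto)
        moreover have "?w [^] (2::nat) \<otimes> a \<otimes> inv (?w [^] (2::nat)) = inv a"
          using out[OF nat_pow_closed[OF y(1)] i] unfolding ww by blast
        ultimately have "a [^] (s ^ 2) = inv a" by simp
        then have "a [^] (s ^ 2 + 1) = \<one>" using a by simp
        then have "2 ^ m dvd s ^ 2 + 1" using pow_eq_id[OF a(1)] a(2) p2 by metis
        then have "2 ^ 2 dvd s ^ 2 + 1" using m2 le_imp_power_dvd dvd_trans by blast
        then have "s ^ 2 mod 4 = 3" by (simp add: dvd_eq_mod_eq_0) presburger
        moreover have "s ^ 2 mod 4 = (s mod 4) ^ 2 mod 4" by (simp add: power_mod)
        moreover have "s mod 4 = 0 \<or> s mod 4 = 1 \<or> s mod 4 = 2 \<or> s mod 4 = 3" by presburger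
        ultimately show ?thesis by auto
      qed
    qed
    have "carrier G = generate G {a} \<union> (generate G {a} #> g0)"
    proof
      show "generate G {a} \<union> (generate G {a} #> g0) \<subseteq> carrier G"
        using A.subset g0 r_coset_subset_G by blast
      show "carrier G \<subseteq> generate G {a} \<union> (generate G {a} #> g0)"
      proof
        fix y assume y: "y \<in> carrier G"
        show "y \<in> generate G {a} \<union> (generate G {a} #> g0)"
        proof (cases "y \<in> generate G {a}")
          case False
          have ya: "y \<otimes> a = inv a \<otimes> y" and ga: "g0 \<otimes> a = inv a \<otimes> g0"
            using inverts[OF y False] inverts[OF g0] conj_eq_iff[OF y a(1)] conj_eq_iff[OF g0(1) a(1)] a by auto
          have ga': "inv g0 \<otimes> a = inv a \<otimes> inv g0" and ya': "y \<otimes> inv a = a \<otimes> y"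
            using inverting_element[OF g0(1) a(1) ga] inverting_element[OF y a(1) ya] by auto
          have "y \<otimes> inv g0 \<otimes> a = y \<otimes> inv a \<otimes> inv g0" using y g0 a ga' by (simp add: m_assoc)
          also have "\<dots> = a \<otimes> (y \<otimes> inv g0)" unfolding ya' using y g0 a by (simp add: m_assoc)
          finally have "y \<otimes> inv g0 \<in> generate G {a}" using cen y g0 by (auto simp: centralizer_def)
          moreover have "y = y \<otimes> inv g0 \<otimes> g0" using y g0 by (simp add: m_assoc)
          ultimately show ?thesis unfolding r_coset_def by blast
        qed simp
      qed
    qed
    then show ?thesis
      using quaternion[OF p2 m2 a(1) _ g0] a p2 inverts[OF g0] by simp
  qed
qed

end

section \<open>Counting the elements of prime power order\<close>

lemma prime_residue_generator:
  fixes p :: nat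
  assumes p: "prime p"
  obtains z where "coprime z p" "\<And>k. coprime k p \<Longrightarrow> \<exists>d. [k = z ^ d] (mod p)"
proof -
  obtain z where z: "residue_primroot p z" using prime_primitive_root_exists[OF prime_gt_1_nat[OF p] p] by blast
  show ?thesis
  proof (rule that[of z])
    show "coprime z p" using z by (simp add: residue_primroot_def coprime_commute)
    fix k assume k: "coprime k p"
    have p1: "p > 1" using p prime_gt_1_nat by blast
    have "\<not> p dvd k" using k p1 by (metis coprime_common_divisor_nat dvd_refl nat_neq_iff)
    then have "k mod p \<in> totatives p"
      using k p1 by (auto simp: totatives_def dvd_eq_mod_eq_0 less_imp_le)
    then obtain d where "k mod p = z ^ d mod p"
      using residue_primroot_is_generator[OF p1 z] unfolding bij_betw_def by blast
    then show "\<exists>d. [k = z ^ d] (mod p)" by (auto simp: cong_def)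
  qed
qed

context group
begin

text \<open>
  Choose \<open>u\<close> in the centre of a Sylow \<open>p\<close>-subgroup. The centralizer of \<open>u\<close> contains this subgroup, and it
  is a \<open>p\<close>-group because everything that commutes with \<open>u\<close> has \<open>p\<close>-power order.
\<close>

lemma centralizer_of_prime_element:
  fixes p :: nat
  assumes fin: "finite (carrier G)" and P: "prime_rank_one G" and p: "prime p" "p dvd order G"
  obtains u where "u \<in> carrier G" "u \<noteq> \<one>" "u [^] p = \<one>"
    "card (centralizer G u) = p ^ multiplicity p (order G)"
proof -
  let ?a = "multiplicity p (order G)"
  have pos: "order G > 0" using fin order_gt_0_iff_finite by blast
  have "order G = p ^ ?a * (order G div p ^ ?a)" by (simp add: multiplicity_dvd)
  then obtain T where T: "subgroup T G" "card T = p ^ ?a"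
    using sylow_thm[OF p(1) group_axioms _ fin] by blast
  interpret T: group "G\<lparr>carrier := T\<rparr>" using T subgroup.subgroup_is_group group_axioms by blast
  have le_a: "i \<le> ?a" if "p ^ i dvd order G" for i
    by (rule multiplicity_geI[OF _ _ that]) (use pos not_prime_unit[of p] p in auto)
  have "?a \<noteq> 0" using le_a[of 1] p by simp
  then have "card T \<noteq> 1" using T p(1) prime_gt_1_nat[of p] by simp
  then have Tne: "T \<noteq> {\<one>}" by auto
  have nT: "T \<lhd> G\<lparr>carrier := T\<rparr>"
    by (rule T.normal_invI) (use T.subgroup_self T.inv_closed T.m_closed in auto)
  obtain u where u: "u \<in> T" "u \<noteq> \<one>" "u [^] p = \<one>" and cent: "\<And>g. g \<in> T \<Longrightarrow> g \<otimes> u = u \<otimes> g"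
    by (rule T.prime_power_group_center[OF p(1) _ nT]) (use T Tne in \<open>auto simp: order_def simp flip: nat_pow_consistent\<close>)
  have TG: "T \<subseteq> carrier G" using T subgroup.subset by blast
  have uG: "u \<in> carrier G" using u TG by blast
  let ?C = "centralizer G u"
  have sC: "subgroup ?C G" using subgroup_centralizer[OF uG] .
  have CG: "?C \<subseteq> carrier G" using sC subgroup.subset by blast
  have finC: "finite ?C" using CG fin finite_subset by blast
  interpret C: group "G\<lparr>carrier := ?C\<rparr>" using sC subgroup.subgroup_is_group group_axioms by blast
  have "\<exists>l. card ?C = p ^ l"
  proof (rule prime_power_if_unique_prime_factor)
    show "card ?C > 0" using finC subgroup.one_closed[OF sC] by (auto simp: card_gt_0_iff)
    fix q :: nat assume q: "prime q" "q dvd card ?C"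
    obtain x where x: "x \<in> ?C" "x \<noteq> \<one>" "x [^] q = \<one>"
      using C.cauchy_prime[of q] q finC by (auto simp: order_def simp flip: nat_pow_consistent)
    have "x \<in> carrier G" "x \<otimes> u = u \<otimes> x" using x by (auto simp: centralizer_def)
    then obtain k where "ord x = p ^ k"
      using prime_power_ord_if_commutes[OF fin P p(1) uG u(2,3)] by blast
    moreover have "ord x = q" using ord_prime[OF q(1) _ x(2,3)] x CG by blast
    ultimately have "q dvd p ^ k" by simp
    then have "q dvd p" using q(1) prime_dvd_power by blast
    then show "q = p" using q(1) p(1) primes_dvd_imp_eq by blast
  qed (rule p)
  then obtain l where l: "card ?C = p ^ l" by blast
  have "card ?C dvd order G" using lagrange[OF sC] by (metis dvd_triv_right)
  then have "p ^ l dvd order G" using l by simp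
  then have "l \<le> ?a" by (rule le_a)
  have "T \<subseteq> ?C" using cent TG by (auto simp: centralizer_def)
  then have "p ^ ?a \<le> p ^ l" using card_mono[OF finC] T l by metis
  then have "?a \<le> l" using prime_gt_1_nat[OF p(1)] power_le_imp_le_exp by blast
  then have "card ?C = p ^ ?a" using l \<open>l \<le> ?a\<close> by simp
  then show ?thesis using that[OF uG u(2,3)] by blast
qed

text \<open>
  The exponents \<open>k\<close> for which \<open>u\<^sup>k\<close> is conjugate to \<open>u\<close> form a subgroup of the units modulo \<open>p\<close>, which are the
  powers of a primitive root \<open>z\<close>. The subgroup is generated by \<open>z\<^sup>e\<close> for the least positive \<open>e\<close> that occurs.
\<close>

lemma conjugation_exponent_generator:
  fixes p :: nat
  assumes p: "prime p" and u: "u \<in> carrier G" "u \<noteq> \<one>" "u [^] p = \<one>"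
  obtains b \<kappa> where "b \<in> carrier G" "b \<otimes> u = u [^] \<kappa> \<otimes> b" "coprime \<kappa> p"
    "\<And>g k::nat. g \<in> carrier G \<Longrightarrow> g \<otimes> u = u [^] k \<otimes> g \<Longrightarrow> \<exists>j. [k = \<kappa> ^ j] (mod p)"
proof -
  have ou: "ord u = p" using ord_prime[OF p u] .
  obtain z where z: "coprime z p" and gen: "\<And>k. coprime k p \<Longrightarrow> \<exists>d. [k = z ^ d] (mod p)"
    using prime_residue_generator[OF p] by blast
  define D where "D = {d. \<exists>g\<in>carrier G. g \<otimes> u = u [^] (z ^ d) \<otimes> g}"
  have upow: "u [^] i = u [^] j" if "[i = j] (mod p)" for i j :: nat
    using pow_cong_ord[OF u(1)] that ou by simp
  have "totient p \<in> D"
  proof -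
    have "[z ^ totient p = 1] (mod p)" using euler_theorem z by (simp add: coprime_commute)
    then have "\<one> \<otimes> u = u [^] (z ^ totient p) \<otimes> \<one>" using upow[of "z ^ totient p" 1] u by simp
    then show ?thesis unfolding D_def by blast
  qed
  moreover have "totient p > 0" using p prime_gt_0_nat by simp
  ultimately have ex: "\<exists>d. d \<in> D \<and> d > 0" by blast
  define e where "e = (LEAST d. d \<in> D \<and> d > 0)"
  have e: "e \<in> D" "e > 0" using LeastI_ex[OF ex] unfolding e_def by auto
  obtain b where b: "b \<in> carrier G" "b \<otimes> u = u [^] (z ^ e) \<otimes> b" using e by (auto simp: D_def)
  have mult: "e dvd d" if d: "d \<in> D" for d
  proof -
    define q r where "q = d div e" and "r = d mod e"
    have dqr: "d = e * q + r" by (simp add: q_def r_def)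
    obtain g where g: "g \<in> carrier G" "g \<otimes> u = u [^] (z ^ d) \<otimes> g" using d by (auto simp: D_def)
    let ?h = "b [^] q"
    have hG: "?h \<in> carrier G" using b by simp
    have "?h \<otimes> u [^] (z ^ r) = u [^] ((z ^ e) ^ q * z ^ r) \<otimes> ?h"
      using twisted_commute[OF u(1) b] .
    also have "(z ^ e) ^ q * z ^ r = z ^ d" by (simp add: dqr power_add power_mult)
    finally have h: "?h \<otimes> u [^] (z ^ r) = u [^] (z ^ d) \<otimes> ?h" .
    have "inv ?h \<otimes> g \<otimes> u = inv ?h \<otimes> (u [^] (z ^ d) \<otimes> ?h) \<otimes> inv ?h \<otimes> g"
      using g hG u by (simp add: m_assoc inv_solve_left')
    also have "\<dots> = u [^] (z ^ r) \<otimes> (inv ?h \<otimes> g)"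
      unfolding h[symmetric] using g hG u by (simp add: m_assoc[symmetric])
    finally have "r \<in> D" using g hG unfolding D_def by blast
    moreover have "r < e" using e by (simp add: r_def)
    ultimately have "r = 0" using not_less_Least[of r "\<lambda>d. d \<in> D \<and> d > 0"] e_def by auto
    then show ?thesis using dqr by simp
  qed
  show ?thesis
  proof (rule that[OF b])
    show "coprime (z ^ e) p" using z by simp
    fix g and k :: nat assume g: "g \<in> carrier G" "g \<otimes> u = u [^] k \<otimes> g"
    have "\<not> p dvd k"
    proof
      assume "p dvd k"
      then have "u [^] k = \<one>" using pow_eq_id[OF u(1)] ou by simp
      then show False using g u by simp
    qed
    then have "coprime k p" using p prime_imp_coprime coprime_commute by blast
    then obtain d where d: "[k = z ^ d] (mod p)" using gen by blast
    then have "d \<in> D" using g upow[OF d] unfolding D_def by auto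
    then obtain j where "d = e * j" using mult by blast
    then show "\<exists>j. [k = (z ^ e) ^ j] (mod p)" using d by (auto simp: power_mult)
  qed
qed

text \<open>
  Let \<open>s\<close> be the order of the centralizer of \<open>u\<close>. The pairs \<open>(v, x)\<close> of a conjugate \<open>v\<close> of \<open>u\<close> and a
  nontrivial \<open>x\<close> commuting with \<open>v\<close> are counted in two ways. Every \<open>v\<close> occurs \<open>s - 1\<close> times. Every \<open>x\<close> that
  occurs is a \<open>p\<close>-element, and the conjugates of \<open>u\<close> commuting with it are powers of a power of \<open>x\<close> of
  order \<open>p\<close>, so they all lie in one conjugate of \<open>\<langle>u\<rangle>\<close>, where there are \<open>t\<close> of them.
\<close>

lemma prime_element_counting:
  fixes p :: nat
  assumes fin: "finite (carrier G)" and P: "prime_rank_one G" and p: "prime p" "p dvd order G"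
  obtains u b \<kappa> t where "u \<in> carrier G" "u \<noteq> \<one>" "u [^] p = \<one>"
    "card (centralizer G u) = p ^ multiplicity p (order G)"
    "b \<in> carrier G" "b \<otimes> u = u [^] (\<kappa>::nat) \<otimes> b" "t > 0" "t dvd p - 1" "t dvd ord b"
    "order G * (p ^ multiplicity p (order G) - 1)
       \<le> t * p ^ multiplicity p (order G) * card {x \<in> carrier G. x \<noteq> \<one> \<and> (\<exists>k. ord x = p ^ k)}"
proof -
  let ?s = "p ^ multiplicity p (order G)"
  let ?E = "{x \<in> carrier G. x \<noteq> \<one> \<and> (\<exists>k. ord x = p ^ k)}"
  obtain u where u: "u \<in> carrier G" "u \<noteq> \<one>" "u [^] p = \<one>" and C: "card (centralizer G u) = ?s"
    using centralizer_of_prime_element[OF fin P p] by metis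
  obtain b \<kappa> where b: "b \<in> carrier G" "b \<otimes> u = u [^] (\<kappa>::nat) \<otimes> b" and cop: "coprime \<kappa> p"
    and gen: "\<And>g k::nat. g \<in> carrier G \<Longrightarrow> g \<otimes> u = u [^] k \<otimes> g \<Longrightarrow> \<exists>j. [k = \<kappa> ^ j] (mod p)"
    using conjugation_exponent_generator[OF p(1) u] by metis
  have ou: "ord u = p" using ord_prime[OF p(1) u] .
  \<comment> \<open>the number of conjugates of \<open>u\<close> inside \<open>\<langle>u\<rangle>\<close>\<close>
  define t where "t = Pocklington.ord p \<kappa>"
  have t: "[\<kappa> ^ i = 1] (mod p) \<longleftrightarrow> t dvd i" for i
    unfolding t_def by (rule ord_divides)
  have tpos: "t > 0" using cop by (simp add: t_def coprime_commute)
  have tp: "t dvd p - 1"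
    using order_divides_totient[of p \<kappa>] cop p(1) by (simp add: t_def coprime_commute totient_prime)
  have "b [^] ord b \<otimes> u [^] (1::nat) = u [^] (\<kappa> ^ ord b * 1) \<otimes> b [^] ord b"
    using twisted_commute[OF u(1) b] .
  then have "u [^] (\<kappa> ^ ord b) = u [^] (1::nat)" using u b by simp
  then have tb: "t dvd ord b" using pow_eq_iff_cong[OF u(1)] ou t by metis
  let ?cl = "conj_class G u"
  have finE: "finite ?E" using fin by simp
  have clG: "?cl \<subseteq> carrier G" using conj_class_subset[OF u(1)] .
  have fincl: "finite ?cl" using clG fin finite_subset by blast
  have clpow: "v [^] p = \<one> \<and> v \<noteq> \<one>" if v: "v \<in> ?cl" for v
  proof -
    obtain g where g: "g \<in> carrier G" "v = g \<otimes> u \<otimes> inv g" using v by (auto simp: conj_class_def)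
    have "v [^] p = \<one>" using conj_pow[OF g(1) u(1), of p] g u by simp
    moreover have "v \<noteq> \<one>" using conj_eq_iff[OF g(1) u(1), of \<one>] g u by auto
    ultimately show ?thesis by blast
  qed
  have cardC: "card (centralizer G v - {\<one>}) = ?s - 1" if v: "v \<in> ?cl" for v
  proof -
    have vG: "v \<in> carrier G" using v clG by blast
    have "card ?cl * card (centralizer G v) = card ?cl * ?s"
      using card_conj_class[OF vG] card_conj_class[OF u(1)] conj_class_eq[OF u(1) v] C by simp
    moreover have "card ?cl > 0" using fincl v by (auto simp: card_gt_0_iff)
    ultimately have "card (centralizer G v) = ?s" by simp
    then show ?thesis using subgroup.one_closed[OF subgroup_centralizer[OF vG]] by simp
  qed
  define F where "F x = {v \<in> ?cl. v \<otimes> x = x \<otimes> v}" for x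
  have fibre: "card (F x) \<le> t" if x: "x \<in> ?E" for x
  proof (cases "F x = {}")
    case False
    then obtain v where v: "v \<in> ?cl" "v \<otimes> x = x \<otimes> v" by (auto simp: F_def)
    then obtain g where g: "g \<in> carrier G" "v = g \<otimes> u \<otimes> inv g" by (auto simp: conj_class_def)
    have xG: "x \<in> carrier G" and xne: "x \<noteq> \<one>" using x by auto
    obtain k where k: "ord x = p ^ k" using x by blast
    then have "k \<noteq> 0" using xne ord_eq_1[OF xG] by (cases k) auto
    then have "p dvd ord x" using k by simp
    then obtain i :: nat where i: "x [^] i \<noteq> \<one>" "(x [^] i) [^] p = \<one>"
      using exists_prime_order_pow[OF fin xG p(1)] by blast
    have xi: "x [^] i \<in> carrier G" using xG by simp
    have pow: "\<exists>j::nat. w = (x [^] i) [^] j" if w: "w \<in> F x" for w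
    proof -
      have w': "w \<in> ?cl" "w \<in> carrier G" "x \<otimes> w = w \<otimes> x" using w clG by (auto simp: F_def)
      have "x [^] i \<otimes> w = w \<otimes> x [^] i" using group_commutes_pow[OF w'(3) xG w'(2)] .
      then show ?thesis
        using prime_rank_oneD[OF P p(1) p(1) xi w'(2) i(1) _ i(2)] clpow[OF w'(1)] by metis
    qed
    obtain jv :: nat where jv: "v = (x [^] i) [^] jv" using pow[of v] v by (auto simp: F_def)
    have vG: "v \<in> carrier G" using v clG by blast
    have "F x \<subseteq> (\<lambda>j. g \<otimes> u [^] (\<kappa> ^ j) \<otimes> inv g) ` {..<t}"
    proof
      fix w assume w: "w \<in> F x"
      obtain jw :: nat where jw: "w = (x [^] i) [^] jw" using pow[OF w] by blast
      have w': "w \<in> ?cl" "w \<in> carrier G" using w clG by (auto simp: F_def)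
      have "v \<otimes> w = w \<otimes> v" using jv jw xi by (simp add: nat_pow_comm)
      then obtain l :: nat where l: "w = v [^] l"
        using prime_rank_oneD[OF P p(1) p(1) vG w'(2)] clpow[OF w'(1)] clpow[OF v(1)] by metis
      obtain h where h: "h \<in> carrier G" "w = h \<otimes> u \<otimes> inv h" using w' by (auto simp: conj_class_def)
      have wl: "w = g \<otimes> u [^] l \<otimes> inv g" using l g conj_pow[OF g(1) u(1)] by simp
      have "inv g \<otimes> h \<otimes> u = inv g \<otimes> (h \<otimes> u \<otimes> inv h) \<otimes> h" using g h u by (simp add: m_assoc)
      also have "\<dots> = inv g \<otimes> (g \<otimes> u [^] l \<otimes> inv g) \<otimes> h" using h wl by simp
      also have "\<dots> = u [^] l \<otimes> (inv g \<otimes> h)" using g h u by (simp add: m_assoc[symmetric])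
      finally obtain j where j: "[l = \<kappa> ^ j] (mod p)" using gen[of "inv g \<otimes> h" l] g h by auto
      have "[\<kappa> ^ j = \<kappa> ^ (j mod t)] (mod p)"
        using order_divides_expdiff[of p \<kappa> j "j mod t"] cop by (simp add: t_def coprime_commute cong_def)
      then have "u [^] l = u [^] (\<kappa> ^ (j mod t))"
        using pow_cong_ord[OF u(1)] ou j cong_trans by blast
      then have "w = g \<otimes> u [^] (\<kappa> ^ (j mod t)) \<otimes> inv g" using wl by simp
      then show "w \<in> (\<lambda>j. g \<otimes> u [^] (\<kappa> ^ j) \<otimes> inv g) ` {..<t}" using tpos by auto
    qed
    then have "card (F x) \<le> card {..<t}" by (rule surj_card_le[rotated]) simp
    then show ?thesis by simp
  qed simp
  let ?R = "SIGMA v:?cl. centralizer G v - {\<one>}"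
  have finR: "finite (centralizer G v - {\<one>})" for v
    using fin by (auto simp: centralizer_def)
  have "card ?R = (\<Sum>v\<in>?cl. card (centralizer G v - {\<one>}))"
    using fincl finR by (intro card_SigmaI) auto
  also have "\<dots> = card ?cl * (?s - 1)" using cardC by simp
  finally have cR: "card ?R = card ?cl * (?s - 1)" .
  have "?R \<subseteq> prod.swap ` (SIGMA x:?E. F x)"
  proof
    fix y assume "y \<in> ?R"
    then obtain v x where y: "y = (v, x)" and v: "v \<in> ?cl" and x: "x \<in> centralizer G v" "x \<noteq> \<one>" by blast
    have xG: "x \<in> carrier G" "x \<otimes> v = v \<otimes> x" using x by (auto simp: centralizer_def)
    have "\<exists>k. ord x = p ^ k"
      using prime_power_ord_if_commutes[OF fin P p(1) _ _ _ xG] clpow[OF v] v clG by blast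
    then have "(x, v) \<in> (SIGMA x:?E. F x)" using xG x v by (auto simp: F_def)
    then show "y \<in> prod.swap ` (SIGMA x:?E. F x)" using y by force
  qed
  moreover have finS: "finite (SIGMA x:?E. F x)" using finE fincl by (auto simp: F_def)
  ultimately have "card ?R \<le> card (SIGMA x:?E. F x)" by (rule surj_card_le[rotated])
  also have "\<dots> = (\<Sum>x\<in>?E. card (F x))" using finE fincl by (intro card_SigmaI) (auto simp: F_def)
  also have "\<dots> \<le> (\<Sum>x\<in>?E. t)" using fibre by (intro sum_mono) auto
  finally have le: "card ?cl * (?s - 1) \<le> card ?E * t" using cR by simp
  have "order G * (?s - 1) = ?s * (card ?cl * (?s - 1))"
    using card_conj_class[OF u(1)] C by (metis mult.assoc mult.commute)
  also have "\<dots> \<le> ?s * (card ?E * t)" using le by simp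
  finally have "order G * (?s - 1) \<le> t * ?s * card ?E" by (simp add: ac_simps)
  then show ?thesis using that[OF u C b tpos tp tb] by blast
qed

end

text \<open>
  Here \<open>e\<^sub>i\<close> stands for the number of nontrivial \<open>p\<^sub>i\<close>-elements. With \<open>a\<close>, \<open>b\<close>, \<open>c\<close> the reciprocals of the
  Sylow orders \<open>s\<^sub>1\<close>, \<open>s\<^sub>2\<close>, \<open>s\<^sub>3\<close>, the three proportions are at least \<open>1 - a\<close>, \<open>(1 - b) a\<close> and \<open>(1 - c) a\<close> or
  \<open>(1 - c) b\<close>. As the reciprocals are at most \<open>1/2\<close>, these add up to at least \<open>1\<close> in both cases.
\<close>

lemma three_prime_count_impossible:
  fixes g s1 s2 s3 t2 t3 e1 e2 e3 :: nat
  assumes "g * (s1 - 1) \<le> s1 * e1" "g * (s2 - 1) \<le> t2 * s2 * e2" "g * (s3 - 1) \<le> t3 * s3 * e3"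
    and "t2 \<le> s1" "t3 \<le> s1 \<or> t3 \<le> s2" "s1 \<ge> 2" "s2 \<ge> 2" "s3 \<ge> 2" "e1 + e2 + e3 < g"
  shows False
proof -
  define a b c where "a = 1 / real s1" and "b = 1 / real s2" and "c = 1 / real s3"
  have abc: "0 < a" "a \<le> 1/2" "0 < b" "b \<le> 1/2" "0 < c" "c \<le> 1/2"
    using assms by (auto simp: a_def b_def c_def field_simps)
  have g: "g > 0" using assms by simp
  have bound: "(1 - 1 / real s) * (1 / real r) \<le> e / real g"
    if "g * (s - 1) \<le> t * s * e" "t \<le> r" "s \<ge> 2" "r > 0" for s t r e :: nat
  proof -
    have "t * s * e \<le> r * s * e" using that by simp
    then have "g * (s - 1) \<le> r * s * e" using that(1) by linarith
    then have "real (g * (s - 1)) \<le> real (r * s * e)" by (simp only: of_nat_le_iff)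
    then have "real g * (real s - 1) \<le> real r * real s * real e" using that by (simp add: of_nat_diff)
    then show ?thesis using that g by (simp add: field_simps)
  qed
  have 1: "1 - a \<le> e1 / real g" using bound[of s1 1 e1 1] assms by (simp add: a_def)
  have 2: "(1 - b) * a \<le> e2 / real g" using bound[of s2 t2 e2 s1] assms by (simp add: a_def b_def)
  have sum: "e1 / real g + e2 / real g + e3 / real g < 1"
    using assms(9) g by (simp add: field_simps)
  show False
  proof (cases "t3 \<le> s1")
    case True
    then have "(1 - c) * a \<le> e3 / real g" using bound[of s3 t3 e3 s1] assms by (simp add: a_def c_def)
    then have "1 - a + (1 - b) * a + (1 - c) * a < 1" using 1 2 sum by linarith
    then have "a * (1 - b - c) < 0" by (simp add: algebra_simps)
    then show False using abc by (simp add: mult_less_0_iff)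
  next
    case False
    then have "(1 - c) * b \<le> e3 / real g" using bound[of s3 t3 e3 s2] assms by (simp add: b_def c_def)
    then have "1 - a + (1 - b) * a + (1 - c) * b < 1" using 1 2 sum by linarith
    then have "b * (1 - a - c) < 0" by (simp add: algebra_simps)
    then show False using abc by (simp add: mult_less_0_iff)
  qed
qed

lemma two_prime_count:
  fixes s1 s2 t e1 e2 :: nat
  assumes "s1 * s2 * (s1 - 1) \<le> s1 * e1" "s1 * s2 * (s2 - 1) \<le> t * s2 * e2"
    and "s1 \<ge> 2" "s2 \<ge> 2" "e1 + e2 < s1 * s2"
  shows "s1 \<le> t"
proof -
  have 1: "s2 * (s1 - 1) \<le> e1" using assms(1,3) by (simp add: mult.assoc)
  have "s2 * (s1 * (s2 - 1)) \<le> s2 * (t * e2)" using assms(2) by (simp add: ac_simps)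
  then have 2: "s1 * (s2 - 1) \<le> t * e2" using assms(4) by simp
  have "s2 * (s1 - 1) = s1 * s2 - s2" by (simp add: diff_mult_distrib2 mult.commute)
  moreover have "s2 \<le> s1 * s2" using assms by simp
  ultimately have "e2 \<le> s2 - 1" using 1 assms(5) by linarith
  then have "s1 * (s2 - 1) \<le> t * (s2 - 1)" using 2 by (meson le_trans mult_le_mono2)
  then show ?thesis using assms(4) by simp
qed

section \<open>Groups whose order is not a prime power\<close>

context group
begin

text \<open>
  Since \<open>b\<close> has prime power order, the divisor \<open>t\<close> of its order is a power of a single prime, and \<open>t\<close> is
  bounded by the order of one Sylow subgroup.
\<close>

lemma automizer_order_bound:
  fixes p t :: nat
  assumes fin: "finite (carrier G)" and P: "prime_rank_one G" and p: "prime p"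
    and b: "b \<in> carrier G" and t: "t dvd p - 1" "t dvd ord b" and t1: "t \<noteq> 1"
  obtains r c :: nat where "prime r" "r < p" "r dvd order G" "ord b = r ^ c" "r ^ c dvd r ^ multiplicity r (order G)"
proof -
  have pos: "order G > 0" using fin order_gt_0_iff_finite by blast
  have "b \<noteq> \<one>" using t t1 by auto
  then obtain r c :: nat where r: "prime r" "ord b = r ^ c" using prime_power_ord[OF fin P b] by metis
  obtain i where i: "t = r ^ i" using t r divides_primepow_nat by metis
  then have "i \<noteq> 0" using t1 by (cases i) auto
  then have rt: "r dvd t" using i by simp
  then have "r dvd p - 1" using t by (meson dvd_trans)
  moreover have "p - 1 > 0" using prime_gt_1_nat[OF p] by simp
  ultimately have "r \<le> p - 1" by (simp add: dvd_imp_le)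
  then have rp: "r < p" using \<open>p - 1 > 0\<close> by linarith
  have dvd: "r ^ c dvd order G" using ord_dvd_group_order[OF b] r by simp
  then have "c \<le> multiplicity r (order G)"
    by (rule multiplicity_geI[rotated 2]) (use pos not_prime_unit[of r] r in auto)
  moreover have "r dvd order G" using rt t ord_dvd_group_order[OF b] by (meson dvd_trans)
  ultimately show ?thesis using that[OF r(1) rp _ r(2)] by (simp add: le_imp_power_dvd)
qed

lemma complement_product:
  assumes fin: "finite (carrier G)" and N: "subgroup N G" and H: "subgroup H G"
    and NH: "N \<inter> H = {\<one>}" and card: "card N * card H = order G"
  shows "N <#> H = carrier G"
proof -
  interpret group_disjoint_sum G N H
    using N H by (simp add: group_disjoint_sum_def group_axioms)
  have inj: "inj_on (\<lambda>(x, y). x \<otimes> y) (N \<times> H)"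
  proof (rule inj_onI, clarify)
    fix x y x' y' assume "x \<in> N" "y \<in> H" "x' \<in> N" "y' \<in> H" "x \<otimes> y = x' \<otimes> y'"
    then show "x = x' \<and> y = y'" using cancel NH by blast
  qed
  have eq: "N <#> H = (\<lambda>(x, y). x \<otimes> y) ` (N \<times> H)" unfolding set_mult_def by auto
  have "card (N <#> H) = card (carrier G)"
    unfolding eq using card_image[OF inj] card by (simp add: card_cartesian_product order_def)
  moreover have "N <#> H \<subseteq> carrier G" using N H subgroup.subset set_mult_closed by metis
  ultimately show ?thesis using fin card_subset_eq by blast
qed

text \<open>
  For the smallest prime \<open>t = 1\<close>, since the prime in \<open>t\<close> would be smaller still. For the second smallest
  prime, \<open>t\<close> is a power of the smallest one, and for a third prime it is a power of one of the first two.
  So the count excludes a third prime. For two primes the count gives \<open>s\<^sub>1 \<le> t\<close>, while \<open>t\<close> divides the order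
  of \<open>b\<close> and this divides \<open>s\<^sub>1\<close>; hence all three agree.
\<close>

lemma two_prime_structure:
  assumes fin: "finite (carrier G)" and P: "prime_rank_one G"
    and not_pp: "\<not> (\<exists>p n. prime p \<and> order G = p ^ n)"
  obtains p q u b \<kappa> where "prime p" "prime (q::nat)" "q < p" "p dvd order G" "q dvd order G"
    "order G = p ^ multiplicity p (order G) * q ^ multiplicity q (order G)"
    "u \<in> carrier G" "u \<noteq> \<one>" "u [^] p = \<one>"
    "card (centralizer G u) = p ^ multiplicity p (order G)"
    "b \<in> carrier G" "b \<otimes> u = u [^] (\<kappa>::nat) \<otimes> b"
    "ord b = q ^ multiplicity q (order G)" "q ^ multiplicity q (order G) dvd p - 1"
proof -
  let ?g = "order G"
  let ?s = "\<lambda>p. p ^ multiplicity p ?g"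
  have pos: "?g > 0" using fin order_gt_0_iff_finite by blast
  define E where "E p = {x \<in> carrier G. x \<noteq> \<one> \<and> (\<exists>k. ord x = p ^ k)}" for p :: nat
  have finE: "finite (E p)" for p using fin by (simp add: E_def)
  have disj: "E p \<inter> E q = {}" if "prime p" "prime q" "p \<noteq> q" for p q
  proof (rule ccontr)
    assume "E p \<inter> E q \<noteq> {}"
    then obtain x k l where x: "x \<in> carrier G" "x \<noteq> \<one>" "ord x = p ^ k" "ord x = q ^ l" by (auto simp: E_def)
    then have "k \<noteq> 0" using ord_eq_1[OF x(1)] by (cases k) auto
    then have "p dvd q ^ l" using x by (metis dvd_power neq0_conv)
    then have "p dvd q" using \<open>prime p\<close> prime_dvd_power by blast
    then show False using that primes_dvd_imp_eq by blast
  qed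
  have s2: "?s p \<ge> 2" if p: "prime p" "p dvd ?g" for p
  proof -
    have "multiplicity p ?g \<ge> 1"
      by (rule multiplicity_geI) (use p pos not_prime_unit[of p] in auto)
    then have "p ^ 1 \<le> ?s p" using prime_gt_0_nat[OF p(1)] by (intro power_increasing) auto
    then show ?thesis using prime_ge_2_nat[OF p(1)] by simp
  qed
  \<comment> \<open>the trivial group falls under the excluded case, as \<open>1 = 2\<^sup>0\<close>\<close>
  have "?g \<noteq> 1"
  proof
    assume "?g = 1"
    then have "?g = 2 ^ 0" by simp
    then show False using not_pp two_is_prime_nat by blast
  qed
  then have ex1: "\<exists>p. prime p \<and> p dvd ?g" using prime_factor_nat by blast
  define p1 where "p1 = (LEAST p. prime p \<and> p dvd ?g)"
  have p1: "prime p1" "p1 dvd ?g" using LeastI_ex[OF ex1] unfolding p1_def by auto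
  have least1: "p1 \<le> p" if "prime p" "p dvd ?g" for p
    unfolding p1_def by (rule Least_le) (use that in simp)
  have ex2: "\<exists>p. prime p \<and> p dvd ?g \<and> p \<noteq> p1"
  proof (rule ccontr)
    assume "\<not> ?thesis"
    then have "\<exists>k. ?g = p1 ^ k" using prime_power_if_unique_prime_factor[OF pos p1(1)] by blast
    then show False using not_pp p1 by blast
  qed
  define p2 where "p2 = (LEAST p. prime p \<and> p dvd ?g \<and> p \<noteq> p1)"
  have p2: "prime p2" "p2 dvd ?g" "p2 \<noteq> p1" using LeastI_ex[OF ex2] unfolding p2_def by auto
  have least2: "p2 \<le> p" if "prime p" "p dvd ?g" "p \<noteq> p1" for p
    unfolding p2_def by (rule Least_le) (use that in simp)
  obtain t1 b1 where t1: "t1 > 0" "t1 dvd p1 - 1" "t1 dvd ord b1" "b1 \<in> carrier G"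
    and c1: "?g * (?s p1 - 1) \<le> t1 * ?s p1 * card (E p1)"
    by (rule prime_element_counting[OF fin P p1, folded E_def]) (rule that; assumption)
  have t1_1: "t1 = 1"
  proof (rule ccontr)
    assume "t1 \<noteq> 1"
    then obtain r where "prime r" "r < p1" "r dvd ?g"
      using automizer_order_bound[OF fin P p1(1) t1(4,2,3)] by metis
    then show False using least1 by (meson not_le)
  qed
  obtain u b \<kappa> t2 where u: "u \<in> carrier G" "u \<noteq> \<one>" "u [^] p2 = \<one>"
    and C: "card (centralizer G u) = ?s p2" and b: "b \<in> carrier G" "b \<otimes> u = u [^] (\<kappa>::nat) \<otimes> b"
    and t2: "t2 > 0" "t2 dvd p2 - 1" "t2 dvd ord b"
    and c2: "?g * (?s p2 - 1) \<le> t2 * ?s p2 * card (E p2)"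
    by (rule prime_element_counting[OF fin P p2(1,2), folded E_def]) (rule that; assumption)
  have bound2: "t2 = 1 \<or> (\<exists>c. ord b = p1 ^ c \<and> p1 ^ c dvd ?s p1)"
  proof (cases "t2 = 1")
    case False
    then obtain r c where r: "prime r" "r < p2" "r dvd ?g" "ord b = r ^ c" "r ^ c dvd ?s r"
      using automizer_order_bound[OF fin P p2(1) b(1) t2(2,3)] by metis
    then have "r = p1" using least2 by (meson not_le)
    then show ?thesis using r by blast
  qed simp
  have t2_dvd: "t2 dvd ?s p1" using bound2 t2(3) by (auto intro: dvd_trans)
  have t2_le: "t2 \<le> ?s p1" using t2_dvd prime_gt_0_nat[OF p1(1)] by (intro dvd_imp_le) auto
  have carrier_bound: "card A < ?g" if "A \<subseteq> carrier G - {\<one>}" for A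
  proof -
    have "card A \<le> card (carrier G - {\<one>})" using that fin by (intro card_mono) auto
    also have "\<dots> < ?g" using fin pos by (simp add: order_def)
    finally show ?thesis .
  qed
  have only: "p = p1 \<or> p = p2" if p: "prime p" "p dvd ?g" for p
  proof (rule ccontr)
    assume "\<not> ?thesis"
    then have ex3: "\<exists>p. prime p \<and> p dvd ?g \<and> p \<noteq> p1 \<and> p \<noteq> p2" using p by blast
    define p3 where "p3 = (LEAST p. prime p \<and> p dvd ?g \<and> p \<noteq> p1 \<and> p \<noteq> p2)"
    have p3: "prime p3" "p3 dvd ?g" "p3 \<noteq> p1" "p3 \<noteq> p2" using LeastI_ex[OF ex3] unfolding p3_def by auto
    have least3: "p3 \<le> p" if "prime p" "p dvd ?g" "p \<noteq> p1" "p \<noteq> p2" for p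
      unfolding p3_def by (rule Least_le) (use that in simp)
    obtain t3 b3 where t3: "t3 > 0" "t3 dvd p3 - 1" "t3 dvd ord b3" "b3 \<in> carrier G"
      and c3: "?g * (?s p3 - 1) \<le> t3 * ?s p3 * card (E p3)"
      by (rule prime_element_counting[OF fin P p3(1,2), folded E_def]) (rule that; assumption)
    have t3_le: "t3 \<le> ?s p1 \<or> t3 \<le> ?s p2"
    proof (cases "t3 = 1")
      case True
      then show ?thesis using s2[OF p1] by linarith
    next
      case False
      then obtain r c where r: "prime r" "r < p3" "r dvd ?g" "ord b3 = r ^ c" "r ^ c dvd ?s r"
        using automizer_order_bound[OF fin P p3(1) t3(4,2,3)] by metis
      have "t3 dvd ?s r" using t3(3) r by (metis dvd_trans)
      then have "t3 \<le> ?s r" using prime_gt_0_nat[OF r(1)] by (intro dvd_imp_le) auto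
      moreover have "r = p1 \<or> r = p2" using least3 r by (meson not_le)
      ultimately show ?thesis by blast
    qed
    have "card (E p1 \<union> E p2 \<union> E p3) = card (E p1) + card (E p2) + card (E p3)"
      using finE disj[OF p1(1) p2(1)] disj[OF p1(1) p3(1)] disj[OF p2(1) p3(1)] p2 p3
      by (subst card_Un_disjoint; (subst card_Un_disjoint)?) auto
    moreover have "E p1 \<union> E p2 \<union> E p3 \<subseteq> carrier G - {\<one>}" by (auto simp: E_def)
    ultimately have "card (E p1) + card (E p2) + card (E p3) < ?g" using carrier_bound by metis
    then show False
      using three_prime_count_impossible[of ?g "?s p1" "card (E p1)" "?s p2" t2 "card (E p2)" "?s p3" t3 "card (E p3)"]
        c1 t1_1 c2 c3 t2_le t3_le s2[OF p1] s2[OF p2(1,2)] s2[OF p3(1,2)] by simp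
  qed
  have "prime_factors ?g = {p1, p2}" using only p1 p2 pos by (auto simp: prime_factors_dvd)
  then have g: "?g = ?s p1 * ?s p2" using prime_factorization_nat[OF pos] p2(3) by simp
  have "card (E p1 \<union> E p2) = card (E p1) + card (E p2)"
    using finE disj[OF p1(1) p2(1)] p2 by (intro card_Un_disjoint) auto
  moreover have "E p1 \<union> E p2 \<subseteq> carrier G - {\<one>}" by (auto simp: E_def)
  ultimately have "card (E p1) + card (E p2) < ?s p1 * ?s p2" using carrier_bound g by metis
  then have "?s p1 \<le> t2"
    by (intro two_prime_count[of "?s p1" "?s p2" "card (E p1)" t2 "card (E p2)"])
      (use c1 c2 t1_1 g s2[OF p1] s2[OF p2(1,2)] in simp_all)
  then have t2_eq: "t2 = ?s p1" using t2_le by simp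
  then have "t2 \<noteq> 1" using s2[OF p1] by linarith
  then have "ord b dvd ?s p1" using bound2 by auto
  then have ob: "ord b = ?s p1" using t2(3) t2_eq dvd_antisym by blast
  have lt: "p1 < p2" using least1[OF p2(1,2)] p2(3) by simp
  show ?thesis
    by (rule that[OF p2(1) p1(1) lt p2(2) p1(2) _ u C b ob]) (use g t2 t2_eq in \<open>simp_all add: mult.commute\<close>)
qed

text \<open>
  The centralizer of \<open>u\<close> is cyclic by the classification of \<open>p\<close>-groups, as \<open>q < p\<close> makes \<open>p\<close> odd. Its order is
  prime to that of \<open>b\<close> and the orders multiply to the order of \<open>G\<close>, so \<open>G\<close> is the product of both. It
  follows that all of \<open>G\<close> normalizes \<open>\<langle>u\<rangle>\<close>, which makes the centralizer of \<open>u\<close> normal. A power of \<open>b\<close>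
  that commutes with \<open>a\<close> also commutes with the power \<open>u\<close> of \<open>a\<close>.
\<close>

theorem frobenius_structure:
  assumes fin: "finite (carrier G)" and P: "prime_rank_one G"
    and not_pp: "\<not> (\<exists>p n. prime p \<and> order G = p ^ n)"
  obtains p q \<alpha> \<beta> :: nat and a b where "prime p" "prime q" "q < p" "\<alpha> \<ge> 1" "\<beta> \<ge> 1" "q ^ \<beta> dvd p - 1"
    "a \<in> carrier G" "b \<in> carrier G" "ord a = p ^ \<alpha>" "ord b = q ^ \<beta>" "generate G {a} \<lhd> G"
    "generate G {a} \<inter> generate G {b} = {\<one>}" "generate G {a} <#> generate G {b} = carrier G"
    "\<And>y. y \<in> generate G {b} \<Longrightarrow> y \<otimes> a = a \<otimes> y \<Longrightarrow> y = \<one>"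
proof -
  have pos: "order G > 0" using fin order_gt_0_iff_finite by blast
  obtain p q u b \<kappa> where p: "prime p" and q: "prime (q::nat)" and qp: "q < p"
    and pg: "p dvd order G" and qg: "q dvd order G"
    and g: "order G = p ^ multiplicity p (order G) * q ^ multiplicity q (order G)"
    and u: "u \<in> carrier G" "u \<noteq> \<one>" "u [^] p = \<one>"
    and C: "card (centralizer G u) = p ^ multiplicity p (order G)"
    and b: "b \<in> carrier G" "b \<otimes> u = u [^] (\<kappa>::nat) \<otimes> b"
    and ob: "ord b = q ^ multiplicity q (order G)" and qb: "q ^ multiplicity q (order G) dvd p - 1"
    by (rule two_prime_structure[OF fin P not_pp])
  define \<alpha> \<beta> where "\<alpha> = multiplicity p (order G)" and "\<beta> = multiplicity q (order G)"
  have \<alpha>: "\<alpha> \<ge> 1" unfolding \<alpha>_def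
    by (rule multiplicity_geI) (use pg pos p not_prime_unit[of p] in auto)
  have \<beta>: "\<beta> \<ge> 1" unfolding \<beta>_def
    by (rule multiplicity_geI) (use qg pos q not_prime_unit[of q] in auto)
  let ?C = "centralizer G u" and ?B = "generate G {b}"
  have sC: "subgroup ?C G" using subgroup_centralizer[OF u(1)] .
  have sB: "subgroup ?B G" using generate_is_subgroup b by simp
  interpret C: group "G\<lparr>carrier := ?C\<rparr>" using sC subgroup.subgroup_is_group group_axioms by blast
  have PC: "prime_rank_one (G\<lparr>carrier := ?C\<rparr>)"
    by (rule prime_rank_one_embed[OF C.group_axioms group_axioms _ _ P, of id])
      (use subgroup.subset[OF sC] in \<open>auto simp: hom_def\<close>)
  have oC: "order (G\<lparr>carrier := ?C\<rparr>) = p ^ \<alpha>" using C by (simp add: order_def \<alpha>_def)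
  have p2: "p \<noteq> 2" using qp prime_ge_2_nat[OF q] by simp
  obtain a where a: "a \<in> ?C" "?C = generate (G\<lparr>carrier := ?C\<rparr>) {a}"
    using C.prime_power_group_cases[OF p oC PC] p2 by (metis partial_object.select_convs(1)
        partial_object.surjective partial_object.update_convs(1))
  have aC: "?C = generate G {a}" using a generate_consistent[OF _ sC, of "{a}"] by simp
  have aG: "a \<in> carrier G" using a subgroup.subset[OF sC] by blast
  have oa: "ord a = p ^ \<alpha>" using generate_pow_card[OF aG] aC C by (simp add: \<alpha>_def)
  have cardB: "card ?B = q ^ \<beta>" using generate_pow_card[OF b(1)] ob by (simp add: \<beta>_def)
  have int: "?C \<inter> ?B = {\<one>}"
  proof -
    have "x = \<one>" if x: "x \<in> ?C" "x \<in> ?B" for x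
    proof -
      obtain i :: nat where i: "x = a [^] i" using x aC mem_generate_iff[OF fin aG] by blast
      obtain j :: nat where j: "x = b [^] j" using x mem_generate_iff[OF fin b(1)] by blast
      have xG: "x \<in> carrier G" using i aG by simp
      have "x [^] (p ^ \<alpha>) = (a [^] (p ^ \<alpha>)) [^] i"
        unfolding i using aG by (simp add: nat_pow_pow mult.commute)
      then have "x [^] (p ^ \<alpha>) = \<one>" using pow_ord_eq_1[OF aG] oa by simp
      then have 1: "ord x dvd p ^ \<alpha>" using pow_eq_id[OF xG] by simp
      have "x [^] (q ^ \<beta>) = (b [^] (q ^ \<beta>)) [^] j"
        unfolding j using b by (simp add: nat_pow_pow mult.commute)
      then have "x [^] (q ^ \<beta>) = \<one>" using pow_ord_eq_1[OF b(1)] ob by (simp add: \<beta>_def)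
      then have 2: "ord x dvd q ^ \<beta>" using pow_eq_id[OF xG] by simp
      have "coprime (p ^ \<alpha>) (q ^ \<beta>)" using primes_coprime[OF p q] qp by simp
      then have "ord x = 1" using 1 2 coprime_common_divisor_nat by blast
      then show ?thesis using ord_eq_1[OF xG] by simp
    qed
    then show ?thesis using subgroup.one_closed[OF sC] subgroup.one_closed[OF sB] by blast
  qed
  have prod: "?C <#> ?B = carrier G"
    by (rule complement_product[OF fin sC sB int]) (use C cardB g in \<open>simp add: \<alpha>_def \<beta>_def\<close>)
  \<comment> \<open>true for \<open>b\<close> and for the centralizer of \<open>u\<close>, hence for products of their elements\<close>
  have normalizes: "\<exists>k::nat. g \<otimes> u = u [^] k \<otimes> g" if "g \<in> carrier G" for g
  proof -
    have "g \<in> ?C <#> ?B" using that prod by simp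
    then obtain c y where cy: "c \<in> ?C" "y \<in> ?B" "g = c \<otimes> y" unfolding set_mult_def by blast
    obtain i :: nat where i: "y = b [^] i" using cy(2) mem_generate_iff[OF fin b(1)] by blast
    have c: "c \<in> carrier G" "c \<otimes> u = u \<otimes> c" using cy by (auto simp: centralizer_def)
    have yG: "y \<in> carrier G" using i b by simp
    let ?k = "\<kappa> ^ i"
    have y: "y \<otimes> u = u [^] ?k \<otimes> y"
      using twisted_commute[OF u(1) b, of i 1] u i by simp
    have ck: "c \<otimes> u [^] ?k = u [^] ?k \<otimes> c" using group_commutes_pow[of u c ?k] c u by simp
    have "g \<otimes> u = c \<otimes> (y \<otimes> u)" using cy c yG u by (simp add: m_assoc)
    also have "\<dots> = (c \<otimes> u [^] ?k) \<otimes> y" unfolding y using c yG u by (simp add: m_assoc)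
    also have "\<dots> = u [^] ?k \<otimes> g" unfolding ck using cy c yG u by (simp add: m_assoc)
    finally show ?thesis by blast
  qed
  have nC: "?C \<lhd> G"
  proof (rule normal_invI[OF sC])
    fix g x assume gG: "g \<in> carrier G" and x: "x \<in> ?C"
    have xG: "x \<in> carrier G" and xu: "x \<otimes> u = u \<otimes> x" using x by (auto simp: centralizer_def)
    obtain k :: nat where k: "inv g \<otimes> u = u [^] k \<otimes> inv g" using normalizes[of "inv g"] gG by auto
    have xk: "x \<otimes> u [^] k = u [^] k \<otimes> x" using group_commutes_pow[of u x k] xu xG u by simp
    have "u \<otimes> g = g \<otimes> (inv g \<otimes> u) \<otimes> g" using gG u by (simp add: m_assoc[symmetric])
    also have "\<dots> = g \<otimes> u [^] k" unfolding k using gG u by (simp add: m_assoc)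
    finally have ug: "u \<otimes> g = g \<otimes> u [^] k" .
    have "g \<otimes> x \<otimes> inv g \<otimes> u = g \<otimes> x \<otimes> (inv g \<otimes> u)" using gG xG u by (simp add: m_assoc)
    also have "\<dots> = g \<otimes> (x \<otimes> u [^] k) \<otimes> inv g" unfolding k using gG xG u by (simp add: m_assoc)
    also have "\<dots> = (g \<otimes> u [^] k) \<otimes> x \<otimes> inv g" unfolding xk using gG xG u by (simp add: m_assoc)
    also have "\<dots> = u \<otimes> (g \<otimes> x \<otimes> inv g)" unfolding ug[symmetric] using gG xG u by (simp add: m_assoc)
    finally show "g \<otimes> x \<otimes> inv g \<in> ?C" using gG xG by (simp add: centralizer_def)
  qed
  have faithful: "y = \<one>" if y: "y \<in> ?B" "y \<otimes> a = a \<otimes> y" for y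
  proof -
    have yG: "y \<in> carrier G" using y subgroup.subset[OF sB] by blast
    have "u \<in> ?C" using u by (simp add: centralizer_def)
    then obtain i :: nat where "u = a [^] i" using aC mem_generate_iff[OF fin aG] by blast
    then have "u \<otimes> y = y \<otimes> u" using group_commutes_pow[of a y i] y aG yG by simp
    then have "y \<in> ?C" using yG by (simp add: centralizer_def)
    then show ?thesis using y int by blast
  qed
  show ?thesis
    by (rule that[OF p q qp \<alpha> \<beta> _ aG b(1) oa]) (use qb ob nC int prod faithful aC in \<open>auto simp: \<beta>_def\<close>)
qed

end

section \<open>Cyclic groups\<close>

lemma (in group) cyclic_iso:
  assumes a: "a \<in> carrier G" and n: "ord a = n" "n > 0"
  shows "(\<lambda>i::int. a [^] i) \<in> iso (integer_mod_group n) (G\<lparr>carrier := generate G {a}\<rparr>)"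
proof -
  have car: "carrier (integer_mod_group n) = {0..<int n}" using n by (simp add: carrier_integer_mod_group)
  have modn: "a [^] (i mod int n) = a [^] i" for i :: int
    using int_pow_eq[OF a, of "i mod int n" i] n by (simp add: mod_eq_dvd_iff[symmetric])
  have mem: "generate G {a} = range (\<lambda>i::int. a [^] i)"
    using generate_pow[OF a] by auto
  have "inj_on (\<lambda>i::int. a [^] i) {0..<int n}"
  proof (rule inj_onI)
    fix i j assume ij: "i \<in> {0..<int n}" "j \<in> {0..<int n}" "a [^] i = a [^] j"
    then have "int n dvd j - i" using int_pow_eq[OF a] n by simp
    then show "i = j" using ij by (metis atLeastLessThan_iff mod_eq_dvd_iff mod_pos_pos_trivial)
  qed
  moreover have "(\<lambda>i::int. a [^] i) ` {0..<int n} = generate G {a}"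
  proof -
    have "a [^] i \<in> (\<lambda>i::int. a [^] i) ` {0..<int n}" for i :: int
      using modn[of i] n by (metis atLeastLessThan_iff image_eqI of_nat_0_less_iff pos_mod_bound pos_mod_sign)
    then show ?thesis unfolding mem by auto
  qed
  ultimately show ?thesis
    unfolding iso_def hom_def using car a by (auto simp: bij_betw_def modn int_pow_mult)
qed

text \<open>
  Both exponents are multiples of \<open>p\<^bsup>m-1\<^esup>\<close>, and the cofactor of \<open>i\<close> is invertible modulo \<open>p\<^sup>m\<close>.
\<close>

lemma (in group) cyclic_prime_elements_dependent:
  fixes p m i j r s :: nat
  assumes a: "a \<in> carrier G" and p: "prime p" and ord: "ord a = p ^ m"
    and r: "prime r" "a [^] i \<noteq> \<one>" "(a [^] i) [^] r = \<one>" and s: "prime s" "a [^] j \<noteq> \<one>" "(a [^] j) [^] s = \<one>"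
  shows "\<exists>k::nat. a [^] j = (a [^] i) [^] k"
proof -
  have m: "m \<noteq> 0" using r ord ord_eq_1[OF a] by (cases m) auto
  have pm: "p ^ m = p * p ^ (m - 1)" using m by (cases m) auto
  have decomp: "\<exists>i'. i = p ^ (m - 1) * i' \<and> \<not> p dvd i'"
    if r: "prime r" "a [^] i \<noteq> \<one>" "(a [^] i) [^] r = \<one>" for i r :: nat
  proof -
    have "(a [^] i) [^] ord a = \<one>" using a by (metis nat_pow_pow mult.commute nat_pow_one pow_ord_eq_1)
    then have "ord (a [^] i) dvd p ^ m" using ord pow_eq_id[of "a [^] i"] a by simp
    then have "r dvd p ^ m" using ord_prime[OF r(1) _ r(2,3)] a by simp
    then have "r = p" using r(1) p prime_dvd_power primes_dvd_imp_eq by blast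
    then have "a [^] (i * p) = \<one>" using r(3) a by (simp add: nat_pow_pow)
    then have "p ^ m dvd i * p" using pow_eq_id[OF a] ord by simp
    then have "p * p ^ (m - 1) dvd p * i" unfolding pm by (simp only: mult.commute)
    then have "p ^ (m - 1) dvd i" using p by (simp add: prime_gt_0_nat)
    then obtain i' where i': "i = p ^ (m - 1) * i'" by (elim dvdE)
    have "\<not> p dvd i'"
    proof
      assume "p dvd i'"
      then have "p ^ (m - 1) * p dvd i" using i' by simp
      then have "p ^ m dvd i" unfolding pm by (simp only: mult.commute)
      then show False using r(2) pow_eq_id[OF a] ord by simp
    qed
    then show ?thesis using i' by blast
  qed
  obtain i' where i': "i = p ^ (m - 1) * i'" "\<not> p dvd i'" using decomp[OF r] by blast
  obtain j' where j': "j = p ^ (m - 1) * j'" using decomp[OF s] by blast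
  obtain l where l: "[i' * l = 1] (mod p ^ m)" using prime_power_cong_inverse[OF p i'(2)] .
  have "[p ^ (m - 1) * j' * (i' * l) = p ^ (m - 1) * j' * 1] (mod p ^ m)"
    using l by (intro cong_mult) auto
  then have "[i * (l * j') = j] (mod p ^ m)" by (simp add: i' j' ac_simps)
  then have "a [^] (i * (l * j')) = a [^] j" using pow_cong_ord[OF a] ord by simp
  then have "a [^] j = (a [^] i) [^] (l * j')" using a by (simp add: nat_pow_pow)
  then show ?thesis by blast
qed

lemma prime_rank_one_integer_mod_group:
  fixes p n :: nat
  assumes p: "prime p"
  shows "prime_rank_one (integer_mod_group (p ^ n))"
proof -
  let ?Z = "integer_mod_group (p ^ n)"
  interpret Z: group ?Z by simp
  \<comment> \<open>the reduction matters for \<open>n = 0\<close>, where \<open>1\<close> itself is not in the carrier\<close>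
  define a where "a = 1 mod int (p ^ n)"
  have pos: "p ^ n > 0" using p prime_gt_0_nat by simp
  have car: "carrier ?Z = {0..<int (p ^ n)}" using pos carrier_integer_mod_group[of "p ^ n"] by (metis less_irrefl)
  have a: "a \<in> carrier ?Z" using pos by (simp add: car a_def)
  have pow: "a [^]\<^bsub>?Z\<^esub> k = int k mod int (p ^ n)" for k :: nat
    by (simp add: a_def mod_mult_right_eq)
  have ord: "Z.ord a = p ^ n"
    unfolding Z.ord_unique[OF a] pow one_integer_mod_group
    by (metis dvd_eq_mod_eq_0 of_nat_dvd_iff)
  have gen: "\<exists>i::nat. x = a [^]\<^bsub>?Z\<^esub> i" if "x \<in> carrier ?Z" for x
    unfolding pow using that by (intro exI[of _ "nat x"]) (simp add: car)
  show ?thesis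
    unfolding prime_rank_one_def
  proof (intro allI ballI impI)
    fix r s :: nat and x y
    assume *: "x \<in> carrier ?Z" "y \<in> carrier ?Z" "prime r" "prime s" "x \<noteq> \<one>\<^bsub>?Z\<^esub>" "y \<noteq> \<one>\<^bsub>?Z\<^esub>"
      "x [^]\<^bsub>?Z\<^esub> r = \<one>\<^bsub>?Z\<^esub>" "y [^]\<^bsub>?Z\<^esub> s = \<one>\<^bsub>?Z\<^esub>"
    obtain i j :: nat where ij: "x = a [^]\<^bsub>?Z\<^esub> i" "y = a [^]\<^bsub>?Z\<^esub> j" using gen * by metis
    show "\<exists>k::nat. y = x [^]\<^bsub>?Z\<^esub> k"
      using Z.cyclic_prime_elements_dependent[OF a p ord *(3) _ _ *(4), of i j] * unfolding ij by blast
  qed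
qed

section \<open>Semidirect products\<close>

text \<open>
  The automorphism \<open>\<phi> h\<close> is conjugation by \<open>\<eta> h\<close>, transported from \<open>N\<close> to \<open>N'\<close> along \<open>\<theta>\<close>.
\<close>

lemma (in group) internal_semidirect_product:
  assumes N': "group N'" and H': "group H'" and N: "N \<lhd> G" and H: "subgroup H G"
    and int: "N \<inter> H = {\<one>}" and prod: "N <#> H = carrier G"
    and \<theta>: "\<theta> \<in> iso N' (G\<lparr>carrier := N\<rparr>)" and \<eta>: "\<eta> \<in> iso H' (G\<lparr>carrier := H\<rparr>)"
  obtains \<phi> where "\<phi> \<in> hom H' (AutoGroup N')" "G \<cong> semidirect_product N' H' \<phi>"
    "\<And>h n. h \<in> carrier H' \<Longrightarrow> n \<in> carrier N' \<Longrightarrow> \<theta> (\<phi> h n) = \<eta> h \<otimes> \<theta> n \<otimes> inv (\<eta> h)"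
proof -
  interpret N': group N' by fact
  interpret H': group H' by fact
  interpret N: normal N G by fact
  interpret group_disjoint_sum G N H
    using N.subgroup_axioms H by (simp add: group_disjoint_sum_def group_axioms)
  have \<theta>_in: "\<theta> n \<in> N" if "n \<in> carrier N'" for n
    using \<theta> that by (auto simp: iso_def hom_def)
  have \<theta>_mult: "\<theta> (m \<otimes>\<^bsub>N'\<^esub> n) = \<theta> m \<otimes> \<theta> n" if "m \<in> carrier N'" "n \<in> carrier N'" for m n
    using \<theta> that by (auto simp: iso_def hom_def)
  have \<theta>_bij: "bij_betw \<theta> (carrier N') N" using \<theta> by (auto simp: iso_def)
  have \<theta>_inj: "m = n" if "\<theta> m = \<theta> n" "m \<in> carrier N'" "n \<in> carrier N'" for m n
    using \<theta>_bij that by (meson bij_betw_def inj_onD)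
  have \<eta>_in: "\<eta> h \<in> H" if "h \<in> carrier H'" for h
    using \<eta> that by (auto simp: iso_def hom_def)
  have \<eta>_mult: "\<eta> (h \<otimes>\<^bsub>H'\<^esub> k) = \<eta> h \<otimes> \<eta> k" if "h \<in> carrier H'" "k \<in> carrier H'" for h k
    using \<eta> that by (auto simp: iso_def hom_def)
  have \<eta>_bij: "bij_betw \<eta> (carrier H') H" using \<eta> by (auto simp: iso_def)
  have \<theta>G: "\<theta> n \<in> carrier G" if "n \<in> carrier N'" for n using \<theta>_in[OF that] by (rule N.mem_carrier)
  have \<eta>G: "\<eta> h \<in> carrier G" if "h \<in> carrier H'" for h using \<eta>_in[OF that] by (rule BG.mem_carrier)
  define \<phi> where "\<phi> h = (\<lambda>n\<in>carrier N'. inv_into (carrier N') \<theta> (\<eta> h \<otimes> \<theta> n \<otimes> inv (\<eta> h)))" for h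
  have \<theta>\<phi>: "\<theta> (\<phi> h n) = \<eta> h \<otimes> \<theta> n \<otimes> inv (\<eta> h)" and \<phi>_in: "\<phi> h n \<in> carrier N'"
    if "h \<in> carrier H'" "n \<in> carrier N'" for h n
  proof -
    have "\<eta> h \<otimes> \<theta> n \<otimes> inv (\<eta> h) \<in> \<theta> ` carrier N'"
      using N.inv_op_closed2[OF \<eta>G \<theta>_in] that \<theta>_bij by (simp add: bij_betw_def)
    then show "\<theta> (\<phi> h n) = \<eta> h \<otimes> \<theta> n \<otimes> inv (\<eta> h)" "\<phi> h n \<in> carrier N'"
      using that by (simp_all add: \<phi>_def f_inv_into_f inv_into_into)
  qed
  have \<phi>_mult: "\<phi> (h \<otimes>\<^bsub>H'\<^esub> k) n = \<phi> h (\<phi> k n)"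
    if "h \<in> carrier H'" "k \<in> carrier H'" "n \<in> carrier N'" for h k n
  proof (rule \<theta>_inj)
    have "\<theta> (\<phi> h (\<phi> k n)) = \<eta> h \<otimes> (\<eta> k \<otimes> \<theta> n \<otimes> inv (\<eta> k)) \<otimes> inv (\<eta> h)"
      using that \<theta>\<phi> \<phi>_in by simp
    also have "\<dots> = \<eta> h \<otimes> \<eta> k \<otimes> \<theta> n \<otimes> inv (\<eta> h \<otimes> \<eta> k)"
      using that \<theta>G \<eta>G by (simp add: m_assoc inv_mult_group)
    finally show "\<theta> (\<phi> (h \<otimes>\<^bsub>H'\<^esub> k) n) = \<theta> (\<phi> h (\<phi> k n))"
      using that \<theta>\<phi> \<eta>_mult by simp
  qed (use that \<phi>_in in auto)
  have \<phi>_one: "\<phi> \<one>\<^bsub>H'\<^esub> n = n" if "n \<in> carrier N'" for n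
  proof (rule \<theta>_inj)
    have "\<eta> \<one>\<^bsub>H'\<^esub> \<otimes> \<eta> \<one>\<^bsub>H'\<^esub> = \<eta> \<one>\<^bsub>H'\<^esub>" using \<eta>_mult[of "\<one>\<^bsub>H'\<^esub>" "\<one>\<^bsub>H'\<^esub>"] by simp
    then have "\<eta> \<one>\<^bsub>H'\<^esub> = \<one>" using \<eta>G by simp
    then show "\<theta> (\<phi> \<one>\<^bsub>H'\<^esub> n) = \<theta> n" using \<theta>\<phi> \<theta>G that by simp
  qed (use that \<phi>_in in auto)
  have \<phi>_auto: "\<phi> h \<in> auto N'" if h: "h \<in> carrier H'" for h
  proof -
    have "\<phi> h (m \<otimes>\<^bsub>N'\<^esub> n) = \<phi> h m \<otimes>\<^bsub>N'\<^esub> \<phi> h n" if "m \<in> carrier N'" "n \<in> carrier N'" for m n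
    proof (rule \<theta>_inj)
      have "\<theta> (\<phi> h (m \<otimes>\<^bsub>N'\<^esub> n)) = \<eta> h \<otimes> (\<theta> m \<otimes> \<theta> n) \<otimes> inv (\<eta> h)"
        using that h \<theta>\<phi> \<theta>_mult by simp
      also have "\<dots> = (\<eta> h \<otimes> \<theta> m \<otimes> inv (\<eta> h)) \<otimes> (\<eta> h \<otimes> \<theta> n \<otimes> inv (\<eta> h))"
      proof -
        have "inv (\<eta> h) \<otimes> (\<eta> h \<otimes> (\<theta> n \<otimes> inv (\<eta> h))) = \<theta> n \<otimes> inv (\<eta> h)"
          using that h \<theta>G \<eta>G by (simp add: m_assoc[symmetric])
        then show ?thesis using that h \<theta>G \<eta>G by (simp add: m_assoc)
      qed
      finally show "\<theta> (\<phi> h (m \<otimes>\<^bsub>N'\<^esub> n)) = \<theta> (\<phi> h m \<otimes>\<^bsub>N'\<^esub> \<phi> h n)"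
        using that h \<theta>\<phi> \<theta>_mult \<phi>_in by simp
    qed (use that h \<phi>_in in auto)
    then have "\<phi> h \<in> hom N' N'" using h \<phi>_in by (auto simp: hom_def)
    moreover have "bij_betw (\<phi> h) (carrier N') (carrier N')"
      by (rule bij_betw_byWitness[of _ "\<phi> (inv\<^bsub>H'\<^esub> h)"])
        (use h \<phi>_in \<phi>_one in \<open>auto simp flip: \<phi>_mult\<close>)
    ultimately show ?thesis by (simp add: auto_def Bij_def \<phi>_def)
  qed
  have \<phi>_hom: "\<phi> \<in> hom H' (AutoGroup N')"
  proof -
    have "\<phi> (h \<otimes>\<^bsub>H'\<^esub> k) = compose (carrier N') (\<phi> h) (\<phi> k)" if hk: "h \<in> carrier H'" "k \<in> carrier H'" for h k
    proof
      fix n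
      show "\<phi> (h \<otimes>\<^bsub>H'\<^esub> k) n = compose (carrier N') (\<phi> h) (\<phi> k) n"
        by (cases "n \<in> carrier N'") (simp_all add: compose_eq \<phi>_mult hk, simp add: \<phi>_def compose_def)
    qed
    then show ?thesis
      using \<phi>_auto by (auto simp: hom_def AutoGroup_def BijGroup_def auto_def)
  qed
  let ?S = "semidirect_product N' H' \<phi>"
  let ?f = "\<lambda>(n, h). \<theta> n \<otimes> \<eta> h"
  have "?f \<in> iso ?S G"
  proof (rule isoI)
    show "?f \<in> hom ?S G"
    proof (rule homI)
      fix x assume "x \<in> carrier ?S"
      then show "?f x \<in> carrier G" using \<theta>G \<eta>G by (auto simp: semidirect_product_def)
    next
      fix x y assume "x \<in> carrier ?S" "y \<in> carrier ?S"
      then obtain n h m k where xy: "x = (n, h)" "y = (m, k)"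
        "n \<in> carrier N'" "h \<in> carrier H'" "m \<in> carrier N'" "k \<in> carrier H'"
        by (auto simp: semidirect_product_def)
      have c: "inv (\<eta> h) \<otimes> (\<eta> h \<otimes> \<eta> k) = \<eta> k" using xy \<eta>G by (simp add: m_assoc[symmetric])
      have "?f (x \<otimes>\<^bsub>?S\<^esub> y) = \<theta> n \<otimes> (\<eta> h \<otimes> \<theta> m \<otimes> inv (\<eta> h)) \<otimes> (\<eta> h \<otimes> \<eta> k)"
        using xy \<theta>\<phi> \<theta>_mult \<eta>_mult \<phi>_in by (simp add: semidirect_product_def)
      also have "\<dots> = \<theta> n \<otimes> \<eta> h \<otimes> (\<theta> m \<otimes> \<eta> k)" using xy \<theta>G \<eta>G c by (simp add: m_assoc)
      finally show "?f (x \<otimes>\<^bsub>?S\<^esub> y) = ?f x \<otimes> ?f y" using xy by simp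
    qed
    have "inj_on ?f (carrier N' \<times> carrier H')"
    proof (rule inj_onI, clarify)
      fix n h m k assume *: "n \<in> carrier N'" "h \<in> carrier H'" "m \<in> carrier N'" "k \<in> carrier H'"
        and eq: "\<theta> n \<otimes> \<eta> h = \<theta> m \<otimes> \<eta> k"
      have "\<forall>x\<in>N. \<forall>y\<in>H. \<forall>x'\<in>N. \<forall>y'\<in>H. x \<otimes> y = x' \<otimes> y' \<longrightarrow> x = x' \<and> y = y'"
        using cancel int by (metis subset_refl)
      then have "\<theta> n = \<theta> m" "\<eta> h = \<eta> k" using eq \<theta>_in[OF *(1)] \<theta>_in[OF *(3)] \<eta>_in[OF *(2)] \<eta>_in[OF *(4)] by blast+
      then show "n = m \<and> h = k" using \<theta>_inj[of n m] inj_onD[OF bij_betw_imp_inj_on[OF \<eta>_bij], of h k] * by blast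
    qed
    moreover have "?f ` (carrier N' \<times> carrier H') = carrier G"
    proof -
      have "?f ` (carrier N' \<times> carrier H') = N <#> H"
        using \<theta>_bij \<eta>_bij unfolding set_mult_def bij_betw_def by (auto simp: image_iff)+
      then show ?thesis using prod by simp
    qed
    ultimately show "bij_betw ?f (carrier ?S) (carrier G)"
      by (simp add: bij_betw_def semidirect_product_def)
  qed
  then have "G \<cong> ?S"
    using group.iso_sym[OF group_semidirect_product[OF N' H' \<phi>_hom] is_isoI] by blast
  then show ?thesis using that[OF \<phi>_hom] \<theta>\<phi> by blast
qed

text \<open>
  Let \<open>x\<close> and \<open>y\<close> commute and have prime order. If one of them is in the kernel, so is the other by
  hypothesis. If both are outside, then \<open>\<pi> y = (\<pi> x)\<^sup>k\<close> for some \<open>k\<close>; now \<open>y x\<^sup>-\<^sup>k\<close> is in the kernel and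
  commutes with \<open>x\<close>, so it is trivial.
\<close>

lemma prime_rank_one_extension:
  assumes "group G" "group K" and \<pi>: "\<pi> \<in> hom G K" and K: "prime_rank_one K"
    and ker: "prime_rank_one (G\<lparr>carrier := kernel G K \<pi>\<rparr>)"
    and free: "\<And>x z. x \<in> carrier G \<Longrightarrow> x \<notin> kernel G K \<pi> \<Longrightarrow> z \<in> kernel G K \<pi> \<Longrightarrow>
      x \<otimes>\<^bsub>G\<^esub> z = z \<otimes>\<^bsub>G\<^esub> x \<Longrightarrow> z = \<one>\<^bsub>G\<^esub>"
  shows "prime_rank_one G"
proof -
  interpret group_hom G K \<pi>
    using assms by (simp add: group_hom_def group_hom_axioms_def)
  let ?N = "kernel G K \<pi>"
  show ?thesis
    unfolding prime_rank_one_def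
  proof (intro allI ballI impI)
    fix p q :: nat and x y
    assume x: "x \<in> carrier G" and y: "y \<in> carrier G" and pq: "prime p" "prime q"
      and ne: "x \<noteq> \<one>\<^bsub>G\<^esub>" "y \<noteq> \<one>\<^bsub>G\<^esub>"
      and pow: "x [^]\<^bsub>G\<^esub> p = \<one>\<^bsub>G\<^esub>" "y [^]\<^bsub>G\<^esub> q = \<one>\<^bsub>G\<^esub>" and comm: "x \<otimes>\<^bsub>G\<^esub> y = y \<otimes>\<^bsub>G\<^esub> x"
    show "\<exists>k::nat. y = x [^]\<^bsub>G\<^esub> k"
    proof (cases "x \<in> ?N")
      case True
      then have yN: "y \<in> ?N" using free[OF y _ True] comm ne by auto
      have npow: "u [^]\<^bsub>G\<lparr>carrier := ?N\<rparr>\<^esub> (i::nat) = u [^]\<^bsub>G\<^esub> i" for u i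
        by (simp add: nat_pow_def)
      obtain k :: nat where "y = x [^]\<^bsub>G\<lparr>carrier := ?N\<rparr>\<^esub> k"
        by (rule prime_rank_oneD[OF ker pq, of x y]) (use True yN ne pow comm npow in auto)
      then show ?thesis using npow by auto
    next
      case False
      have yN: "y \<notin> ?N" using free[OF x False] comm ne by auto
      have "\<pi> x \<noteq> \<one>\<^bsub>K\<^esub>" "\<pi> y \<noteq> \<one>\<^bsub>K\<^esub>" using x y False yN by (auto simp: kernel_def)
      moreover have "\<pi> x [^]\<^bsub>K\<^esub> p = \<one>\<^bsub>K\<^esub>" "\<pi> y [^]\<^bsub>K\<^esub> q = \<one>\<^bsub>K\<^esub>"
        using pow x y by (metis hom_nat_pow hom_one)+
      moreover have "\<pi> x \<otimes>\<^bsub>K\<^esub> \<pi> y = \<pi> y \<otimes>\<^bsub>K\<^esub> \<pi> x" using comm x y by (metis hom_mult)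
      ultimately obtain k :: nat where k: "\<pi> y = \<pi> x [^]\<^bsub>K\<^esub> k"
        using prime_rank_oneD[OF K pq, of "\<pi> x" "\<pi> y"] x y by auto
      let ?w = "x [^]\<^bsub>G\<^esub> k"
      have w: "?w \<in> carrier G" using x by simp
      let ?z = "y \<otimes>\<^bsub>G\<^esub> inv\<^bsub>G\<^esub> ?w"
      have "\<pi> ?z = \<one>\<^bsub>K\<^esub>" using k x y by (simp add: hom_nat_pow)
      then have zN: "?z \<in> ?N" using x y by (simp add: kernel_def)
      have "x \<otimes>\<^bsub>G\<^esub> ?w = ?w \<otimes>\<^bsub>G\<^esub> x" using x by (metis G.nat_pow_comm G.nat_pow_eone)
      then have xw: "x \<otimes>\<^bsub>G\<^esub> inv\<^bsub>G\<^esub> ?w = inv\<^bsub>G\<^esub> ?w \<otimes>\<^bsub>G\<^esub> x" using G.commute_inv x w by blast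
      have "x \<otimes>\<^bsub>G\<^esub> ?z = (x \<otimes>\<^bsub>G\<^esub> y) \<otimes>\<^bsub>G\<^esub> inv\<^bsub>G\<^esub> ?w" using x y w by (simp add: G.m_assoc)
      also have "\<dots> = y \<otimes>\<^bsub>G\<^esub> (x \<otimes>\<^bsub>G\<^esub> inv\<^bsub>G\<^esub> ?w)" unfolding comm using x y w by (simp add: G.m_assoc)
      also have "\<dots> = ?z \<otimes>\<^bsub>G\<^esub> x" unfolding xw using x y w by (simp add: G.m_assoc)
      finally have "?z = \<one>\<^bsub>G\<^esub>" using free[OF x False zN] by blast
      then have "y = ?w" using y w by (metis G.inv_closed G.inv_inv G.inv_equality)
      then show ?thesis by blast
    qed
  qed
qed

text \<open>
  In \<open>u\<^sup>Q - 1 = (u - 1) (1 + u + \<dots> + u\<^bsup>Q-1\<^esup>)\<close> the second factor is congruent to \<open>Q\<close> modulo \<open>p\<close>, hence prime to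
  \<open>p\<close>.
\<close>

lemma cong_one_lift_prime_power:
  fixes u :: int and p Q a :: nat
  assumes p: "prime p" and Q: "\<not> p dvd Q" and u: "[u = 1] (mod int p)" and uQ: "[u ^ Q = 1] (mod int p ^ a)"
  shows "[u = 1] (mod int p ^ a)"
proof -
  have "[(\<Sum>i<Q. u ^ i) = (\<Sum>i<Q. 1 ^ i)] (mod int p)"
    using u by (intro cong_sum cong_pow)
  then have s: "[(\<Sum>i<Q. u ^ i) = int Q] (mod int p)" by simp
  have "\<not> int p dvd (\<Sum>i<Q. u ^ i)" using s Q by (simp add: cong_dvd_iff)
  then have "coprime (int p) (\<Sum>i<Q. u ^ i)" using p by (intro prime_imp_coprime) auto
  then have cop: "coprime (int p ^ a) (\<Sum>i<Q. u ^ i)" by simp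
  have "int p ^ a dvd (u - 1) * (\<Sum>i<Q. u ^ i)"
    using uQ by (simp add: cong_iff_dvd_diff power_diff_1_eq)
  then have "int p ^ a dvd u - 1" using cop by (simp add: coprime_dvd_mult_left_iff)
  then show ?thesis by (simp add: cong_iff_dvd_diff)
qed

lemma AutoGroup_integer_mod_group_mult:
  fixes n :: nat
  assumes n: "n > 0" and f: "f \<in> auto (integer_mod_group n)" and i: "i \<in> {0..<int n}"
  shows "f i = i * f (1 mod int n) mod int n"
proof -
  let ?Z = "integer_mod_group n"
  have car: "carrier ?Z = {0..<int n}" using n carrier_integer_mod_group[of n] by auto
  interpret group_hom ?Z ?Z f
    using f by (simp add: group_hom_def group_hom_axioms_def auto_def)
  have 1: "1 mod int n \<in> carrier ?Z" using n by (simp add: car)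
  have "i = (1 mod int n) [^]\<^bsub>?Z\<^esub> nat i" using i by (simp add: mod_mult_right_eq)
  then have "f i = f (1 mod int n) [^]\<^bsub>?Z\<^esub> nat i" using hom_nat_pow[OF 1, of "nat i"] by simp
  then show ?thesis using i by simp
qed

lemma hom_AutoGroup_mult:
  assumes \<phi>: "\<phi> \<in> hom H (AutoGroup N)" and "h \<in> carrier H" "k \<in> carrier H" "n \<in> carrier N"
  shows "\<phi> (h \<otimes>\<^bsub>H\<^esub> k) n = \<phi> h (\<phi> k n)"
proof -
  have "\<phi> h \<in> auto N" "\<phi> k \<in> auto N" using assms by (auto simp: hom_def AutoGroup_def)
  then have "\<phi> (h \<otimes>\<^bsub>H\<^esub> k) = compose (carrier N) (\<phi> h) (\<phi> k)"
    using assms by (auto simp: hom_def AutoGroup_def BijGroup_def auto_def)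
  then show ?thesis using assms by (simp add: compose_eq)
qed

text \<open>
  The automorphism \<open>\<phi> h\<close> is multiplication by some \<open>u\<close>. A nonzero fixed point forces \<open>u = 1\<close> modulo \<open>p\<close>.
  Since \<open>u\<close> to the power \<open>q\<^sup>\<beta>\<close> is \<open>1\<close> modulo \<open>p\<^sup>\<alpha>\<close>, this lifts to \<open>u = 1\<close> modulo \<open>p\<^sup>\<alpha>\<close>, and \<open>h\<close> acts
  trivially.
\<close>

lemma faithful_action_fixed_point_free:
  fixes p q \<alpha> \<beta> :: nat
  defines "N \<equiv> integer_mod_group (p ^ \<alpha>)" and "H \<equiv> integer_mod_group (q ^ \<beta>)"
  assumes p: "prime p" and q: "prime q" and pq: "p \<noteq> q"
    and \<phi>: "\<phi> \<in> hom H (AutoGroup N)" and inj: "inj_on \<phi> (carrier H)"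
    and h: "h \<in> carrier H" "h \<noteq> \<one>\<^bsub>H\<^esub>" and z: "z \<in> carrier N" and fixed: "\<phi> h z = z"
  shows "z = \<one>\<^bsub>N\<^esub>"
proof (rule ccontr)
  assume z0: "z \<noteq> \<one>\<^bsub>N\<^esub>"
  let ?n = "int (p ^ \<alpha>)"
  have pos: "p ^ \<alpha> > 0" "q ^ \<beta> > 0" using p q prime_gt_0_nat by simp_all
  have carN: "carrier N = {0..<?n}" using pos carrier_integer_mod_group[of "p ^ \<alpha>"] unfolding N_def by auto
  have carH: "carrier H = {0..<int (q ^ \<beta>)}" using pos carrier_integer_mod_group[of "q ^ \<beta>"] unfolding H_def by auto
  interpret N: group N by (simp add: N_def)
  interpret H: group H by (simp add: H_def)
  have auto: "\<phi> k \<in> auto N" if "k \<in> carrier H" for k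
    using \<phi> that by (auto simp: hom_def AutoGroup_def)
  define u where "u = \<phi> h (1 mod ?n)"
  have one_in: "1 mod ?n \<in> carrier N" using pos by (simp add: carN)
  have lin: "\<phi> h i = i * u mod ?n" if "i \<in> carrier N" for i
    using AutoGroup_integer_mod_group_mult[OF pos(1), of "\<phi> h" i] auto[OF h(1)] that
    unfolding N_def[symmetric] carN u_def by blast
  have iter: "\<phi> (h [^]\<^bsub>H\<^esub> k) i = i * u ^ k mod ?n" if i: "i \<in> carrier N" and k: "k > 0" for i and k :: nat
    using k
  proof (induction k rule: nat_induct_non_zero)
    case 1
    then show ?case using lin[OF i] h by simp
  next
    case (Suc k)
    have "\<phi> (h [^]\<^bsub>H\<^esub> Suc k) i = \<phi> (h \<otimes>\<^bsub>H\<^esub> h [^]\<^bsub>H\<^esub> k) i"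
      using h by (metis H.nat_pow_Suc2)
    also have "\<dots> = \<phi> h (i * u ^ k mod ?n)"
      using hom_AutoGroup_mult[OF \<phi> h(1) _ i] h Suc by simp
    also have "\<dots> = (i * u ^ k mod ?n) * u mod ?n"
      using lin[of "i * u ^ k mod ?n"] pos by (simp add: carN)
    also have "\<dots> = i * u ^ Suc k mod ?n" by (metis mod_mult_left_eq mult.assoc power_Suc2)
    finally show ?case .
  qed
  have oneH: "\<phi> \<one>\<^bsub>H\<^esub> i = i" if i: "i \<in> carrier N" for i
  proof -
    have "\<phi> \<one>\<^bsub>H\<^esub> (\<phi> \<one>\<^bsub>H\<^esub> i) = \<phi> \<one>\<^bsub>H\<^esub> i"
      using hom_AutoGroup_mult[OF \<phi> _ _ i, of "\<one>\<^bsub>H\<^esub>" "\<one>\<^bsub>H\<^esub>"] by simp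
    moreover have "inj_on (\<phi> \<one>\<^bsub>H\<^esub>) (carrier N)" "\<phi> \<one>\<^bsub>H\<^esub> i \<in> carrier N"
      using auto[of "\<one>\<^bsub>H\<^esub>"] i by (auto simp: auto_def Bij_def bij_betw_def hom_def)
    ultimately show ?thesis using i by (meson inj_onD)
  qed
  have "h [^]\<^bsub>H\<^esub> (q ^ \<beta>) = \<one>\<^bsub>H\<^esub>" by (simp add: H_def)
  then have "\<phi> (h [^]\<^bsub>H\<^esub> (q ^ \<beta>)) (1 mod ?n) = 1 mod ?n" using oneH[OF one_in] by simp
  then have "(1 mod ?n) * u ^ (q ^ \<beta>) mod ?n = 1 mod ?n" using iter[OF one_in pos(2)] by simp
  then have uQ: "[u ^ (q ^ \<beta>) = 1] (mod int p ^ \<alpha>)" by (simp add: cong_def mod_mult_left_eq)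
  have "z * u mod ?n = z" using lin[OF z] fixed by simp
  then have "[z * u = z] (mod ?n)" using z by (simp add: cong_def carN)
  then have dvd: "int p ^ \<alpha> dvd z * (u - 1)" by (simp add: cong_iff_dvd_diff algebra_simps)
  have u1: "[u = 1] (mod int p)"
  proof (rule ccontr)
    assume "\<not> [u = 1] (mod int p)"
    then have "\<not> int p dvd u - 1" by (simp add: cong_iff_dvd_diff)
    then have "coprime (int p ^ \<alpha>) (u - 1)" using p prime_imp_coprime[of "int p" "u - 1"] by simp
    then have "int p ^ \<alpha> dvd z" using dvd by (simp add: coprime_dvd_mult_left_iff)
    moreover have "z \<noteq> 0" using z0 by (simp add: N_def)
    ultimately show False using z zdvd_imp_le[of "int p ^ \<alpha>" z] by (auto simp: carN)
  qed
  have "\<not> p dvd q ^ \<beta>" using p q pq prime_dvd_power primes_dvd_imp_eq by blast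
  then have u: "[u = 1] (mod int p ^ \<alpha>)" using cong_one_lift_prime_power[OF p _ u1 uQ] by blast
  have "\<phi> h = \<phi> \<one>\<^bsub>H\<^esub>"
  proof
    fix i
    show "\<phi> h i = \<phi> \<one>\<^bsub>H\<^esub> i"
    proof (cases "i \<in> carrier N")
      case True
      have "[i * u = i * 1] (mod ?n)" using u by (intro cong_mult) auto
      then have "\<phi> h i = i" using lin[OF True] True by (simp add: cong_def carN)
      then show ?thesis using oneH[OF True] by simp
    next
      case False
      then show ?thesis using auto[OF h(1)] auto[of "\<one>\<^bsub>H\<^esub>"] by (auto simp: auto_def Bij_def extensional_def)
    qed
  qed
  then show False using inj h by (meson H.one_closed inj_onD)
qed

lemma prime_rank_one_semidirect_product:
  fixes p q \<alpha> \<beta> :: nat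
  defines "N \<equiv> integer_mod_group (p ^ \<alpha>)" and "H \<equiv> integer_mod_group (q ^ \<beta>)"
  assumes p: "prime p" and q: "prime q" and pq: "p \<noteq> q"
    and \<phi>: "\<phi> \<in> hom H (AutoGroup N)" and inj: "inj_on \<phi> (carrier H)"
  shows "prime_rank_one (semidirect_product N H \<phi>)"
proof -
  interpret N: group N by (simp add: N_def)
  interpret H: group H by (simp add: H_def)
  let ?S = "semidirect_product N H \<phi>"
  interpret S: group ?S by (rule group_semidirect_product[OF N.group_axioms H.group_axioms \<phi>])
  have snd_hom: "snd \<in> hom ?S H" by (auto simp: hom_def semidirect_product_def)
  interpret snd: group_hom ?S H snd
    using snd_hom by (simp add: group_hom_def group_hom_axioms_def S.group_axioms H.group_axioms)
  let ?K = "kernel ?S H snd"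
  have K: "x \<in> ?K \<longleftrightarrow> (\<exists>n\<in>carrier N. x = (n, \<one>\<^bsub>H\<^esub>))" for x
    by (cases x) (auto simp: kernel_def semidirect_product_def)
  have one: "\<phi> \<one>\<^bsub>H\<^esub> n = n" if "n \<in> carrier N" for n
  proof -
    have "(\<one>\<^bsub>N\<^esub>, \<one>\<^bsub>H\<^esub>) \<otimes>\<^bsub>?S\<^esub> (n, \<one>\<^bsub>H\<^esub>) = (n, \<one>\<^bsub>H\<^esub>)"
      using S.l_one[of "(n, \<one>\<^bsub>H\<^esub>)"] that by (simp add: semidirect_product_def)
    moreover have "\<phi> \<one>\<^bsub>H\<^esub> n \<in> carrier N"
      using \<phi> that H.one_closed by (fastforce simp: hom_def AutoGroup_def auto_def)
    ultimately show ?thesis using that by (simp add: semidirect_product_def)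
  qed
  have kerK: "prime_rank_one (?S\<lparr>carrier := ?K\<rparr>)"
  proof (rule prime_rank_one_embed[of _ N fst])
    show "group (?S\<lparr>carrier := ?K\<rparr>)"
      using snd.subgroup_kernel S.subgroup_imp_group by blast
    show "fst \<in> hom (?S\<lparr>carrier := ?K\<rparr>) N"
      by (auto simp: hom_def K one) (auto simp: semidirect_product_def one)
    show "inj_on fst (carrier (?S\<lparr>carrier := ?K\<rparr>))" by (auto simp: inj_on_def K)
    show "prime_rank_one N" unfolding N_def by (rule prime_rank_one_integer_mod_group[OF p])
  qed (rule N.group_axioms)
  show ?thesis
  proof (rule prime_rank_one_extension[OF S.group_axioms H.group_axioms snd_hom _ kerK])
    show "prime_rank_one H" unfolding H_def by (rule prime_rank_one_integer_mod_group[OF q])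
    fix x z assume x: "x \<in> carrier ?S" "x \<notin> ?K" and z: "z \<in> ?K" and comm: "x \<otimes>\<^bsub>?S\<^esub> z = z \<otimes>\<^bsub>?S\<^esub> x"
    obtain n h where nh: "x = (n, h)" "n \<in> carrier N" "h \<in> carrier H"
      using x by (auto simp: semidirect_product_def)
    obtain m where m: "z = (m, \<one>\<^bsub>H\<^esub>)" "m \<in> carrier N" using z K by blast
    have h: "h \<noteq> \<one>\<^bsub>H\<^esub>" using x nh K by blast
    have \<phi>m: "\<phi> h m \<in> carrier N"
      using \<phi> nh m by (fastforce simp: hom_def AutoGroup_def auto_def)
    have "n \<otimes>\<^bsub>N\<^esub> \<phi> h m = m \<otimes>\<^bsub>N\<^esub> n"
      using comm nh m one by (simp add: semidirect_product_def)
    also have "\<dots> = n \<otimes>\<^bsub>N\<^esub> m" using comm_groupE(4)[OF abelian_integer_mod_group] nh m unfolding N_def by blast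
    finally have "\<phi> h m = m" using nh m \<phi>m by simp
    then have "m = \<one>\<^bsub>N\<^esub>"
      using faithful_action_fixed_point_free[OF p q pq] \<phi> inj nh h m unfolding N_def H_def by blast
    then show "z = \<one>\<^bsub>?S\<^esub>" using m by (simp add: semidirect_product_def)
  qed
qed

section \<open>Generalized quaternion groups\<close>

lemma two_times_power_minus_two:
  assumes "n \<ge> 2"
  shows "2 * 2 ^ (n - 2) = (2::nat) ^ (n - 1)"
proof -
  obtain m where "n = m + 2" using assms by (metis le_add_diff_inverse2)
  then show ?thesis by simp
qed

text \<open>
  These are the defining relations of \<open>Q\<^sub>n\<close> for \<open>k = 2\<^bsup>n-2\<^esup>\<close>; for general \<open>k\<close> they belong to the dicyclic
  group of order \<open>4 k\<close>.
\<close>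

locale quaternion_generators = group G for G (structure) +
  fixes x y and k :: nat
  assumes x_closed [simp]: "x \<in> carrier G" and y_closed [simp]: "y \<in> carrier G" and k_pos: "k > 0"
    and x_pow: "x [^] (2 * k) = \<one>" and y_square: "y \<otimes> y = x [^] k" and conj: "inv y \<otimes> x \<otimes> y = inv x"
begin

lemma inv_x: "inv x = x [^] (2 * k - 1)"
proof -
  have "x [^] (2 * k - 1) \<otimes> x = x [^] Suc (2 * k - 1)" by simp
  also have "\<dots> = \<one>" using x_pow k_pos by simp
  finally show ?thesis by (intro inv_equality) auto
qed

lemma y_x_pow: "y \<otimes> x [^] i = x [^] ((2 * k - 1) * i) \<otimes> y" for i :: nat
proof -
  have "inv y \<otimes> x = inv x \<otimes> inv y"
    by (rule iffD1[OF conj_eq_iff, rotated -1]) (use conj in auto)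
  then have "inv (inv y) \<otimes> x = inv x \<otimes> inv (inv y)"
    using inverting_element(2)[of "inv y" x] by simp
  then have "y \<otimes> x = x [^] (2 * k - 1) \<otimes> y" by (simp add: inv_x)
  then show ?thesis using twisted_commute[of x y "2 * k - 1" 1 i] by simp
qed

lemma x_pow_mult: "x [^] (2 * k * i) = \<one>" for i :: nat
  using x_pow by (simp add: nat_pow_pow[symmetric])

lemma x_pow_mod: "x [^] (i mod (2 * k)) = x [^] i" for i :: nat
proof -
  have "x [^] i = x [^] (2 * k * (i div (2 * k)) + i mod (2 * k))" by simp
  also have "\<dots> = x [^] (2 * k * (i div (2 * k))) \<otimes> x [^] (i mod (2 * k))"
    by (simp only: nat_pow_mult x_closed)
  finally show ?thesis by (simp add: x_pow_mult)
qed

lemma square_outside: "(x [^] i \<otimes> y) \<otimes> (x [^] i \<otimes> y) = x [^] k" for i :: nat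
proof -
  have "(x [^] i \<otimes> y) \<otimes> (x [^] i \<otimes> y) = x [^] i \<otimes> (y \<otimes> x [^] i) \<otimes> y" by (simp add: m_assoc)
  also have "\<dots> = x [^] (i + (2 * k - 1) * i) \<otimes> (y \<otimes> y)"
    unfolding y_x_pow by (simp add: m_assoc nat_pow_mult[symmetric])
  also have "i + (2 * k - 1) * i = 2 * k * i" using k_pos by (simp add: diff_mult_distrib)
  finally show ?thesis by (simp add: x_pow_mult y_square)
qed

definition normal_forms :: "'a set" where
  "normal_forms = (\<lambda>(i, b). if b then x [^] i \<otimes> y else x [^] i) ` ({..<2 * k} \<times> UNIV)"

lemma normal_forms_iff: "s \<in> normal_forms \<longleftrightarrow> (\<exists>i::nat. s = x [^] i \<or> s = x [^] i \<otimes> y)"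
proof
  assume "\<exists>i::nat. s = x [^] i \<or> s = x [^] i \<otimes> y"
  then obtain i :: nat where "s = x [^] i \<or> s = x [^] i \<otimes> y" by blast
  then have "s = x [^] (i mod (2 * k)) \<or> s = x [^] (i mod (2 * k)) \<otimes> y" by (simp add: x_pow_mod)
  moreover have "i mod (2 * k) < 2 * k" using k_pos by simp
  then have "(i mod (2 * k), False) \<in> {..<2 * k} \<times> UNIV" "(i mod (2 * k), True) \<in> {..<2 * k} \<times> UNIV" by auto
  ultimately show "s \<in> normal_forms"
    unfolding normal_forms_def by (elim disjE) (erule image_eqI[rotated], simp)+
qed (auto simp: normal_forms_def split: if_splits)

lemma card_normal_forms: "card normal_forms \<le> 4 * k"
proof -
  have "card normal_forms \<le> card ({..<2 * k} \<times> (UNIV :: bool set))"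
    unfolding normal_forms_def by (rule card_image_le) simp
  then show ?thesis by (simp add: card_cartesian_product)
qed

lemma normal_forms_closed:
  assumes s: "s \<in> normal_forms"
  shows "x \<otimes> s \<in> normal_forms" "y \<otimes> s \<in> normal_forms"
    "inv x \<otimes> s \<in> normal_forms" "inv y \<otimes> s \<in> normal_forms"
proof -
  have xs: "x [^] (j::nat) \<otimes> s \<in> normal_forms" if s: "s \<in> normal_forms" for j s
  proof -
    obtain i :: nat where "s = x [^] i \<or> s = x [^] i \<otimes> y" using s normal_forms_iff by blast
    then have "x [^] j \<otimes> s = x [^] (j + i) \<or> x [^] j \<otimes> s = x [^] (j + i) \<otimes> y"
      by (auto simp: nat_pow_mult[symmetric] m_assoc)
    then show ?thesis using normal_forms_iff by blast
  qed
  have ys: "y \<otimes> s \<in> normal_forms" if s: "s \<in> normal_forms" for s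
  proof -
    obtain i :: nat where i: "s = x [^] i \<or> s = x [^] i \<otimes> y" using s normal_forms_iff by blast
    have 1: "y \<otimes> x [^] i = x [^] ((2 * k - 1) * i) \<otimes> y" by (rule y_x_pow)
    have "y \<otimes> (x [^] i \<otimes> y) = (y \<otimes> x [^] i) \<otimes> y" by (simp add: m_assoc)
    also have "\<dots> = x [^] ((2 * k - 1) * i + k)"
      unfolding 1 by (simp add: m_assoc y_square nat_pow_mult)
    finally show ?thesis using 1 i normal_forms_iff by metis
  qed
  have sG: "s \<in> carrier G" using s normal_forms_iff by auto
  show "x \<otimes> s \<in> normal_forms" using xs[OF s, of 1] by simp
  show "y \<otimes> s \<in> normal_forms" by (rule ys[OF s])
  show "inv x \<otimes> s \<in> normal_forms" unfolding inv_x by (rule xs[OF s])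
  have "inv y = y \<otimes> x [^] k"
  proof (rule inv_equality)
    have "y \<otimes> x [^] k \<otimes> y = (y \<otimes> y) \<otimes> (y \<otimes> y)" by (simp add: m_assoc flip: y_square)
    also have "\<dots> = x [^] (2 * k)" by (simp add: y_square nat_pow_mult mult_2)
    finally show "y \<otimes> x [^] k \<otimes> y = \<one>" by (simp add: x_pow)
  qed auto
  then show "inv y \<otimes> s \<in> normal_forms" using ys[OF xs[OF s, of k]] sG by (simp add: m_assoc)
qed

text \<open>
  The square of \<open>x\<^sup>i y\<close> is \<open>x\<^sup>k\<close>, which has order \<open>2\<close>. So \<open>x\<^sup>i y\<close> has order \<open>4\<close>, and all elements of prime order
  lie in the cyclic \<open>2\<close>-group \<open>\<langle>x\<rangle>\<close>.
\<close>

lemma prime_rank_one_if_generated: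
  assumes gen: "carrier G = normal_forms" and k: "2 * k = 2 ^ m" and z: "x [^] k \<noteq> \<one>"
  shows "prime_rank_one G"
proof -
  have "ord x dvd 2 ^ m" using pow_eq_id[of x "2 * k"] x_pow k by simp
  then obtain l where l: "ord x = 2 ^ l" using divides_primepow_nat[OF two_is_prime_nat] by blast
  have inside: "\<exists>i::nat. w = x [^] i" if w: "w \<in> carrier G" "prime p" "w \<noteq> \<one>" "w [^] p = \<one>" for w and p :: nat
  proof (rule ccontr)
    assume no: "\<not> ?thesis"
    obtain i :: nat where i: "w = x [^] i \<or> w = x [^] i \<otimes> y" using w gen normal_forms_iff by blast
    then have ww: "w \<otimes> w = x [^] k" using no square_outside by blast
    have "w [^] (4::nat) = (w \<otimes> w) \<otimes> (w \<otimes> w)" using w by (simp add: numeral_eq_Suc m_assoc)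
    also have "\<dots> = x [^] (2 * k)" unfolding ww by (simp add: nat_pow_mult mult_2)
    finally have "w [^] (4::nat) = \<one>" by (simp add: x_pow)
    then have "p dvd 2 ^ 2" using ord_prime[OF w(2,1,3,4)] pow_eq_id[OF w(1), of 4] by simp
    then have "p dvd 2" using w(2) prime_dvd_power by blast
    then have "p = 2" using w(2) primes_dvd_imp_eq two_is_prime_nat by blast
    then have "w \<otimes> w = \<one>" using w by (simp add: numeral_2_eq_2)
    then show False using ww z by simp
  qed
  show ?thesis
    unfolding prime_rank_one_def
  proof (intro allI ballI impI)
    fix p q :: nat and v w
    assume *: "v \<in> carrier G" "w \<in> carrier G" "prime p" "prime q" "v \<noteq> \<one>" "w \<noteq> \<one>" "v [^] p = \<one>" "w [^] q = \<one>"
    obtain i j :: nat where ij: "v = x [^] i" "w = x [^] j" using inside * by metis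
    show "\<exists>k::nat. w = v [^] k"
      using cyclic_prime_elements_dependent[OF x_closed two_is_prime_nat l *(3) _ _ *(4), of i j] * unfolding ij by blast
  qed
qed

end

lemma word_class_replicate:
  "word_class R (replicate i (g, True)) = word_class R [(g, True)] [^]\<^bsub>presented_group R\<^esub> i"
proof (induction i)
  case (Suc i)
  have "replicate (Suc i) (g, True) = replicate i (g, True) @ [(g, True)]"
    by (simp add: replicate_append_same)
  then show ?case using Suc by (metis mult_presented_group nat_pow_Suc)
qed simp

lemma inv_word_class_letter:
  "inv\<^bsub>presented_group R\<^esub> word_class R [(g, True)] = word_class R [(g, False)]"
proof -
  interpret group "presented_group R" by (rule group_presented_group)
  have "word_class R [(g, False)] \<otimes>\<^bsub>presented_group R\<^esub> word_class R [(g, True)] = \<one>\<^bsub>presented_group R\<^esub>"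
    using pres_cong.cancel[of R g False] by (simp add: word_class_eq_iff)
  then show ?thesis by (intro inv_equality) auto
qed

abbreviation quat_x :: "nat \<Rightarrow> quat_gen word set" where "quat_x n \<equiv> word_class (quat_relations n) [(QX, True)]"
abbreviation quat_y :: "nat \<Rightarrow> quat_gen word set" where "quat_y n \<equiv> word_class (quat_relations n) [(QY, True)]"

lemma quaternion_generators_gen_quaternion:
  assumes n: "n \<ge> 2"
  shows "quaternion_generators (gen_quaternion n) (quat_x n) (quat_y n) (2 ^ (n - 2))"
proof -
  let ?R = "quat_relations n"
  let ?Q = "presented_group ?R"
  interpret group ?Q by (rule group_presented_group)
  have rel: "word_class ?R u = word_class ?R v" if "(u, v) \<in> ?R" for u v
    using that by (simp add: word_class_eq_iff pres_cong.relation)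
  have two: "2 * 2 ^ (n - 2) = (2::nat) ^ (n - 1)"
    using two_times_power_minus_two[OF n] .
  have 1: "quat_x n [^]\<^bsub>?Q\<^esub> ((2::nat) ^ (n - 1)) = \<one>\<^bsub>?Q\<^esub>"
    unfolding word_class_replicate[symmetric] one_presented_group by (rule rel) (simp add: quat_relations_def)
  have 2: "quat_y n \<otimes>\<^bsub>?Q\<^esub> quat_y n = quat_x n [^]\<^bsub>?Q\<^esub> ((2::nat) ^ (n - 2))"
    unfolding word_class_replicate[symmetric] mult_presented_group
    by (rule rel) (simp add: quat_relations_def)
  have 3: "inv\<^bsub>?Q\<^esub> quat_y n \<otimes>\<^bsub>?Q\<^esub> quat_x n \<otimes>\<^bsub>?Q\<^esub> quat_y n = inv\<^bsub>?Q\<^esub> quat_x n"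
    unfolding inv_word_class_letter mult_presented_group
    by (rule rel) (simp add: quat_relations_def)
  show ?thesis
    unfolding gen_quaternion_def
    by unfold_locales (use 1 2 3 two in auto)
qed

text \<open>
  A word is brought into normal form from right to left, one letter at a time.
\<close>

lemma carrier_gen_quaternion:
  assumes n: "n \<ge> 2"
  shows "carrier (gen_quaternion n) = quaternion_generators.normal_forms (gen_quaternion n) (quat_x n) (quat_y n) (2 ^ (n - 2))"
proof -
  interpret quaternion_generators "gen_quaternion n" "quat_x n" "quat_y n" "2 ^ (n - 2)"
    by (rule quaternion_generators_gen_quaternion[OF n])
  have "word_class (quat_relations n) w \<in> normal_forms" for w
  proof (induction w)
    case Nil
    have "word_class (quat_relations n) [] = quat_x n [^]\<^bsub>gen_quaternion n\<^esub> (0::nat)"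
      by (simp add: gen_quaternion_def)
    then show ?case using normal_forms_iff by blast
  next
    case (Cons l w)
    obtain g b where l: "l = (g, b)" by fastforce
    have "word_class (quat_relations n) (l # w) =
        word_class (quat_relations n) [l] \<otimes>\<^bsub>gen_quaternion n\<^esub> word_class (quat_relations n) w"
      by (simp add: gen_quaternion_def)
    moreover have "word_class (quat_relations n) [l] \<in> {quat_x n, quat_y n, inv\<^bsub>gen_quaternion n\<^esub> quat_x n, inv\<^bsub>gen_quaternion n\<^esub> quat_y n}"
      unfolding gen_quaternion_def inv_word_class_letter l by (cases g; cases b) auto
    ultimately show ?case using normal_forms_closed[OF Cons] by auto
  qed
  moreover have "normal_forms \<subseteq> carrier (gen_quaternion n)" using normal_forms_iff by auto
  ultimately show ?thesis by (auto simp: gen_quaternion_def)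
qed

lemma (in group) word_value_replicate:
  assumes "f g \<in> carrier G"
  shows "word_value G f (replicate i (g, True)) = f g [^] i"
proof (induction i)
  case (Suc i)
  then show ?case using assms nat_pow_Suc2[OF assms, of i] by (simp add: word_value_def del: nat_pow_Suc)
qed (simp add: word_value_def)

lemma (in quaternion_generators) hom_from_gen_quaternion:
  assumes n: "n \<ge> 2" and k: "k = 2 ^ (n - 2)"
  obtains F where "F \<in> hom (gen_quaternion n) G" "F (quat_x n) = x" "F (quat_y n) = y"
proof -
  define f where "f = case_quat_gen x y"
  have f: "f QX = x" "f QY = y" by (simp_all add: f_def)
  have rf: "range f \<subseteq> carrier G" by (auto simp: f_def split: quat_gen.split)
  have two: "2 * k = 2 ^ (n - 1)"
    using two_times_power_minus_two[OF n] k by simp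
  have rel: "word_value G f u = word_value G f v" if uv: "(u, v) \<in> quat_relations n" for u v
  proof -
    consider "u = replicate (2 ^ (n - 1)) (QX, True)" "v = []"
      | "u = [(QY, True), (QY, True)]" "v = replicate (2 ^ (n - 2)) (QX, True)"
      | "u = [(QY, False), (QX, True), (QY, True)]" "v = [(QX, False)]"
      using uv by (auto simp: quat_relations_def)
    then show ?thesis
    proof cases
      case 1
      then show ?thesis using x_pow two f by (simp add: word_value_replicate) (simp add: word_value_def)
    next
      case 2
      have "word_value G f u = y \<otimes> y" using 2 f by (simp add: word_value_def)
      then show ?thesis using y_square 2 f k by (simp add: word_value_replicate)
    next
      case 3
      then show ?thesis using conj f by (simp add: word_value_def m_assoc)
    qed
  qed
  show ?thesis
    using presented_group_universal[OF rf rel] f that unfolding gen_quaternion_def by metis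
qed

lemma group_bijections:
  "group \<lparr>carrier = {f. bij f}, monoid.mult = (\<circ>), one = (id :: 'c \<Rightarrow> 'c)\<rparr>"
proof (rule groupI)
  fix f :: "'c \<Rightarrow> 'c" assume "f \<in> carrier \<lparr>carrier = {f. bij f}, monoid.mult = (\<circ>), one = id\<rparr>"
  then have "bij (inv_into UNIV f)" "inv_into UNIV f \<circ> f = id"
    by (simp_all add: bij_imp_bij_inv bij_is_inj)
  then show "\<exists>g\<in>carrier \<lparr>carrier = {f. bij f}, monoid.mult = (\<circ>), one = id\<rparr>.
      g \<otimes>\<^bsub>\<lparr>carrier = {f. bij f}, monoid.mult = (\<circ>), one = id\<rparr>\<^esub> f = \<one>\<^bsub>\<lparr>carrier = {f. bij f}, monoid.mult = (\<circ>), one = id\<rparr>\<^esub>"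
    by auto
qed (auto simp: bij_comp comp_assoc)

text \<open>
  The relations by themselves do not show that \<open>x\<^sup>k\<close> survives in the presented group; a concrete group in
  which they hold and \<open>x\<^sup>k \<noteq> \<one>\<close> does. With \<open>\<zeta> = exp (\<i> \<pi> / k)\<close>, the matrices \<open>diag (\<zeta>, \<zeta>\<^sup>-\<^sup>1)\<close> and
  \<open>((0, -1), (1, 0))\<close> serve as \<open>x\<close> and \<open>y\<close>; they are written here as maps on pairs of complex numbers, and
  \<open>x\<^sup>k\<close> is \<open>-1\<close>.
\<close>

lemma quaternion_model:
  assumes k: "k > 0"
  shows "\<exists>(M :: (complex \<times> complex \<Rightarrow> complex \<times> complex) monoid) x y.
    quaternion_generators M x y k \<and> x [^]\<^bsub>M\<^esub> k \<noteq> \<one>\<^bsub>M\<^esub>"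
proof -
  define M :: "(complex \<times> complex \<Rightarrow> complex \<times> complex) monoid" where
    "M = \<lparr>carrier = {f. bij f}, monoid.mult = (\<circ>), one = id\<rparr>"
  interpret group M unfolding M_def by (rule group_bijections)
  define \<zeta> where "\<zeta> = cis (pi / real k)"
  have \<zeta>k: "\<zeta> ^ k = -1" using k by (simp add: \<zeta>_def DeMoivre)
  have \<zeta>0: "\<zeta> \<noteq> 0" by (simp add: \<zeta>_def)
  define x :: "complex \<times> complex \<Rightarrow> complex \<times> complex" where "x = (\<lambda>(v, w). (\<zeta> * v, inverse \<zeta> * w))"
  define x' :: "complex \<times> complex \<Rightarrow> complex \<times> complex" where "x' = (\<lambda>(v, w). (inverse \<zeta> * v, \<zeta> * w))"
  define y :: "complex \<times> complex \<Rightarrow> complex \<times> complex" where "y = (\<lambda>(v, w). (- w, v))"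
  define y' :: "complex \<times> complex \<Rightarrow> complex \<times> complex" where "y' = (\<lambda>(v, w). (w, - v))"
  have xx': "x \<circ> x' = id" "x' \<circ> x = id" using \<zeta>0 by (auto simp: x_def x'_def fun_eq_iff)
  have yy': "y \<circ> y' = id" "y' \<circ> y = id" by (auto simp: y_def y'_def fun_eq_iff)
  have carr: "x \<in> carrier M" "x' \<in> carrier M" "y \<in> carrier M" "y' \<in> carrier M"
    using o_bij[OF xx'] o_bij[OF xx'(2,1)] o_bij[OF yy'] o_bij[OF yy'(2,1)] by (simp_all add: M_def)
  have inv: "inv\<^bsub>M\<^esub> x = x'" "inv\<^bsub>M\<^esub> y = y'"
    by (rule inv_equality; use xx' yy' carr in \<open>simp add: M_def\<close>)+
  have pow: "x [^]\<^bsub>M\<^esub> i = (\<lambda>(v, w). (\<zeta> ^ i * v, inverse \<zeta> ^ i * w))" for i :: nat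
  proof (induction i)
    case 0
    then show ?case by (auto simp: M_def fun_eq_iff)
  next
    case (Suc i)
    then have "x [^]\<^bsub>M\<^esub> Suc i = (\<lambda>(v, w). (\<zeta> ^ i * v, inverse \<zeta> ^ i * w)) \<circ> x" by (simp add: M_def)
    then show ?case by (auto simp: x_def fun_eq_iff)
  qed
  have inv\<zeta>: "inverse \<zeta> ^ k = -1" by (simp add: power_inverse \<zeta>k)
  have "quaternion_generators M x y k"
  proof unfold_locales
    show "x [^]\<^bsub>M\<^esub> (2 * k) = \<one>\<^bsub>M\<^esub>"
      unfolding pow using \<zeta>k inv\<zeta> by (auto simp: M_def fun_eq_iff power_mult mult.commute[of 2])
    show "y \<otimes>\<^bsub>M\<^esub> y = x [^]\<^bsub>M\<^esub> k"
      unfolding pow using \<zeta>k inv\<zeta> by (auto simp: M_def y_def fun_eq_iff)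
    show "inv\<^bsub>M\<^esub> y \<otimes>\<^bsub>M\<^esub> x \<otimes>\<^bsub>M\<^esub> y = inv\<^bsub>M\<^esub> x"
      unfolding inv by (auto simp: M_def x_def x'_def y_def y'_def fun_eq_iff)
  qed (use carr k in auto)
  moreover have "x [^]\<^bsub>M\<^esub> k \<noteq> \<one>\<^bsub>M\<^esub>"
  proof
    assume "x [^]\<^bsub>M\<^esub> k = \<one>\<^bsub>M\<^esub>"
    then have "(\<lambda>(v, w). (\<zeta> ^ k * v, inverse \<zeta> ^ k * w)) (1, 1) = id (1, 1)"
      unfolding pow by (simp add: M_def)
    then show False using \<zeta>k by simp
  qed
  ultimately show ?thesis by blast
qed

theorem prime_rank_one_gen_quaternion:
  assumes n: "n \<ge> 3"
  shows "prime_rank_one (gen_quaternion n)"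
proof -
  let ?k = "2 ^ (n - 2) :: nat"
  have n2: "n \<ge> 2" using n by simp
  interpret Q: quaternion_generators "gen_quaternion n" "quat_x n" "quat_y n" ?k
    by (rule quaternion_generators_gen_quaternion[OF n2])
  obtain M :: "(complex \<times> complex \<Rightarrow> complex \<times> complex) monoid" and x y where
    M: "quaternion_generators M x y ?k" and ne: "x [^]\<^bsub>M\<^esub> ?k \<noteq> \<one>\<^bsub>M\<^esub>"
    using quaternion_model[of ?k] by auto
  interpret M: quaternion_generators M x y ?k by (rule M)
  obtain F where F: "F \<in> hom (gen_quaternion n) M" "F (quat_x n) = x"
    using M.hom_from_gen_quaternion[OF n2 HOL.refl] by metis
  interpret F: group_hom "gen_quaternion n" M F
    using F by (simp add: group_hom_def group_hom_axioms_def Q.group_axioms M.group_axioms)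
  have z: "quat_x n [^]\<^bsub>gen_quaternion n\<^esub> ?k \<noteq> \<one>\<^bsub>gen_quaternion n\<^esub>"
    using ne F F.hom_nat_pow[of "quat_x n" ?k] F.hom_one by fastforce
  have "2 * ?k = 2 ^ (n - 1)"
    using two_times_power_minus_two[OF n2] .
  then show ?thesis
    using Q.prime_rank_one_if_generated[OF carrier_gen_quaternion[OF n2] _ z] by blast
qed

text \<open>
  By the universal property \<open>G\<close> is an image of the presented group, which has at most \<open>4 k\<close> elements because
  of the normal forms.
\<close>

theorem (in quaternion_generators) iso_gen_quaternion:
  assumes n: "n \<ge> 2" and k: "k = 2 ^ (n - 2)" and gen: "carrier G = normal_forms" and card: "order G = 4 * k"
  shows "G \<cong> gen_quaternion n"
proof -
  interpret Q: quaternion_generators "gen_quaternion n" "quat_x n" "quat_y n" "2 ^ (n - 2)"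
    by (rule quaternion_generators_gen_quaternion[OF n])
  obtain F where F: "F \<in> hom (gen_quaternion n) G" "F (quat_x n) = x" "F (quat_y n) = y"
    using hom_from_gen_quaternion[OF n k] .
  interpret F: group_hom "gen_quaternion n" G F
    using F by (simp add: group_hom_def group_hom_axioms_def Q.group_axioms group_axioms)
  have surj: "F ` carrier (gen_quaternion n) = carrier G"
  proof
    show "carrier G \<subseteq> F ` carrier (gen_quaternion n)"
    proof
      fix s assume "s \<in> carrier G"
      then obtain i :: nat where "s = x [^] i \<or> s = x [^] i \<otimes> y" using gen normal_forms_iff by blast
      then have "s = F (quat_x n [^]\<^bsub>gen_quaternion n\<^esub> i) \<or>
          s = F (quat_x n [^]\<^bsub>gen_quaternion n\<^esub> i \<otimes>\<^bsub>gen_quaternion n\<^esub> quat_y n)"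
        using F by (simp add: F.hom_nat_pow)
      then show "s \<in> F ` carrier (gen_quaternion n)" by fastforce
    qed
  qed auto
  have fin: "finite (carrier (gen_quaternion n))"
    unfolding carrier_gen_quaternion[OF n] Q.normal_forms_def by simp
  have "card (carrier (gen_quaternion n)) \<le> 4 * k"
    unfolding carrier_gen_quaternion[OF n] k by (rule Q.card_normal_forms)
  moreover have "card (F ` carrier (gen_quaternion n)) = 4 * k" using surj card by (simp add: order_def)
  ultimately have "inj_on F (carrier (gen_quaternion n))"
    using fin card_image_le[OF fin, of F] by (intro eq_card_imp_inj_on) auto
  then have "F \<in> iso (gen_quaternion n) G" using F surj by (simp add: iso_def bij_betw_def)
  then show ?thesis using Q.iso_sym is_isoI by blast
qed

section \<open>The classification\<close>

lemma (in group) cyclic_prime_power_iso: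
  assumes a: "a \<in> carrier G" "carrier G = generate G {a}" and ord: "order G = p ^ n" and p: "prime (p::nat)"
  shows "G \<cong> integer_mod_group (p ^ n)"
proof -
  have oa: "ord a = p ^ n" using generate_pow_card[OF a(1)] a(2) ord by (simp add: order_def)
  have pos: "p ^ n > 0" using p prime_gt_0_nat by simp
  have "(\<lambda>i::int. a [^] i) \<in> iso (integer_mod_group (p ^ n)) (G\<lparr>carrier := generate G {a}\<rparr>)"
    by (rule cyclic_iso[OF a(1) oa pos])
  then have "integer_mod_group (p ^ n) \<cong> G\<lparr>carrier := carrier G\<rparr>" unfolding a(2)[symmetric] by (rule is_isoI)
  then show ?thesis using group.iso_sym[OF group_integer_mod_group] by simp
qed

lemma (in group) quaternion_iso:
  assumes fin: "finite (carrier G)" and m: "m \<ge> 2" and a: "a \<in> carrier G" "ord a = 2 ^ m"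
    and g: "g \<in> carrier G" "g \<notin> generate G {a}"
    and gen: "carrier G = generate G {a} \<union> (generate G {a} #> g)"
    and inv: "g \<otimes> a \<otimes> inv g = inv a" and sq: "g \<otimes> g = a [^] ((2::nat) ^ (m - 1))"
  shows "G \<cong> gen_quaternion (m + 1)"
proof -
  let ?A = "generate G {a}" and ?k = "2 ^ (m - 1) :: nat"
  have two: "2 * ?k = 2 ^ m" using m by (cases m) auto
  have sA: "subgroup ?A G" using generate_is_subgroup a by simp
  have ga: "g \<otimes> a = inv a \<otimes> g" using inv conj_eq_iff[OF g(1) a(1)] a by simp
  have "inv g \<otimes> a \<otimes> inv (inv g) = inv a"
    using inverting_element(2)[OF g(1) a(1) ga] conj_eq_iff[of "inv g" a "inv a"] a g by simp
  then have conj: "inv g \<otimes> a \<otimes> g = inv a" using g by simp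
  interpret quaternion_generators G a g ?k
    by unfold_locales (use a g sq conj two pow_ord_eq_1[OF a(1)] in auto)
  have "s \<in> ?A #> g \<longleftrightarrow> (\<exists>i::nat. s = a [^] i \<otimes> g)" for s
    by (auto simp: r_coset_def Bex_def mem_generate_iff[OF fin a(1)])
  then have "s \<in> carrier G \<longleftrightarrow> s \<in> normal_forms" for s
    using gen mem_generate_iff[OF fin a(1), of s] normal_forms_iff[of s] by blast
  then have "carrier G = normal_forms" by blast
  moreover have "order G = 4 * ?k"
  proof -
    have cA: "card ?A = 2 * ?k" using generate_pow_card[OF a(1)] a two by simp
    have "?A #> g \<in> rcosets ?A" using rcosetsI[OF subgroup.subset[OF sA] g(1)] .
    then have cB: "card (?A #> g) = 2 * ?k"
      using card_rcosets_equal[OF _ subgroup.subset[OF sA]] cA by simp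
    have "?A \<inter> (?A #> g) = {}"
    proof (rule ccontr)
      assume "\<not> ?thesis"
      then obtain h where h: "h \<in> ?A" "h \<otimes> g \<in> ?A" unfolding r_coset_def by blast
      have "inv h \<otimes> (h \<otimes> g) \<in> ?A"
        using h subgroup.m_closed[OF sA] subgroup.m_inv_closed[OF sA] by blast
      then show False using h g subgroup.mem_carrier[OF sA h(1)] by (simp add: m_assoc[symmetric])
    qed
    moreover have "finite ?A" "finite (?A #> g)" using fin gen by (metis finite_Un)+
    ultimately have "card (carrier G) = card ?A + card (?A #> g)"
      using gen card_Un_disjoint by metis
    then show ?thesis using cA cB by (simp add: order_def)
  qed
  ultimately show ?thesis
    using iso_gen_quaternion[of "m + 1"] m by simp
qed

lemma (in group) prime_power_iso:
  assumes p: "prime (p::nat)" and ord: "order G = p ^ n" and P: "prime_rank_one G"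
  shows "G \<cong> integer_mod_group (p ^ n) \<or> (\<exists>n\<ge>3. G \<cong> gen_quaternion n)"
proof (rule prime_power_group_cases[OF p ord P])
  fix a assume "a \<in> carrier G" "carrier G = generate G {a}"
  then have "G \<cong> integer_mod_group (p ^ n)" by (rule cyclic_prime_power_iso[OF _ _ ord p])
  then show ?thesis by blast
next
  fix a g m
  assume m: "m \<ge> 2" and gens: "a \<in> carrier G" "ord a = 2 ^ m" "g \<in> carrier G" "g \<notin> generate G {a}"
    "carrier G = generate G {a} \<union> (generate G {a} #> g)"
    "g \<otimes> a \<otimes> inv g = inv a" "g \<otimes> g = a [^] ((2::nat) ^ (m - 1))"
  have "finite (carrier G)" using ord p order_gt_0_iff_finite by (simp add: prime_gt_0_nat)
  then have "G \<cong> gen_quaternion (m + 1)" using m gens by (rule quaternion_iso)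
  moreover have "m + 1 \<ge> 3" using m by simp
  ultimately show ?thesis by blast
qed

lemma card_carrier_integer_mod_group: "n > 0 \<Longrightarrow> card (carrier (integer_mod_group n)) = n"
  by (simp add: carrier_integer_mod_group)

text \<open>
  The action is faithful: if \<open>h\<close> and \<open>k\<close> act in the same way, then \<open>b\<^bsup>h-k\<^esup>\<close> commutes with \<open>a\<close> and is trivial.
\<close>

lemma (in group) frobenius_iso:
  assumes fin: "finite (carrier G)" and P: "prime_rank_one G"
    and not_pp: "\<not> (\<exists>p n. prime p \<and> order G = p ^ n)"
  shows "\<exists>(p::nat) (q::nat) (\<alpha>::nat) (\<beta>::nat) \<phi>.
        prime p \<and> prime q \<and> p \<noteq> q \<and> odd p \<and> \<alpha> \<ge> 1 \<and> \<beta> \<ge> 1 \<and> q ^ \<beta> dvd p - 1 \<and>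
        \<phi> \<in> hom (integer_mod_group (q ^ \<beta>)) (AutoGroup (integer_mod_group (p ^ \<alpha>))) \<and>
        card (\<phi> ` carrier (integer_mod_group (q ^ \<beta>))) = q ^ \<beta> \<and>
        G \<cong> semidirect_product (integer_mod_group (p ^ \<alpha>)) (integer_mod_group (q ^ \<beta>)) \<phi>"
proof -
  obtain p q \<alpha> \<beta> :: nat and a b where p: "prime p" and q: "prime q" and qp: "q < p"
    and \<alpha>: "\<alpha> \<ge> 1" and \<beta>: "\<beta> \<ge> 1" and dvd: "q ^ \<beta> dvd p - 1"
    and a: "a \<in> carrier G" and b: "b \<in> carrier G" and oa: "ord a = p ^ \<alpha>" and ob: "ord b = q ^ \<beta>"
    and nA: "generate G {a} \<lhd> G" and int: "generate G {a} \<inter> generate G {b} = {\<one>}"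
    and prod: "generate G {a} <#> generate G {b} = carrier G"
    and free: "\<And>y. y \<in> generate G {b} \<Longrightarrow> y \<otimes> a = a \<otimes> y \<Longrightarrow> y = \<one>"
    by (rule frobenius_structure[OF fin P not_pp]) (rule that; blast)
  let ?N = "integer_mod_group (p ^ \<alpha>)" and ?H = "integer_mod_group (q ^ \<beta>)"
  let ?\<theta> = "\<lambda>i::int. a [^] i" and ?\<eta> = "\<lambda>i::int. b [^] i"
  have pos: "p ^ \<alpha> > 0" "q ^ \<beta> > 0" using p q prime_gt_0_nat by simp_all
  have \<theta>: "?\<theta> \<in> iso ?N (G\<lparr>carrier := generate G {a}\<rparr>)" by (rule cyclic_iso[OF a oa pos(1)])
  have \<eta>: "?\<eta> \<in> iso ?H (G\<lparr>carrier := generate G {b}\<rparr>)" by (rule cyclic_iso[OF b ob pos(2)])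
  have sB: "subgroup (generate G {b}) G" using generate_is_subgroup b by simp
  obtain \<phi> where \<phi>: "\<phi> \<in> hom ?H (AutoGroup ?N)" and iso: "G \<cong> semidirect_product ?N ?H \<phi>"
    and \<phi>_conj: "\<And>h n. h \<in> carrier ?H \<Longrightarrow> n \<in> carrier ?N \<Longrightarrow> ?\<theta> (\<phi> h n) = ?\<eta> h \<otimes> ?\<theta> n \<otimes> inv (?\<eta> h)"
    using internal_semidirect_product[OF group_integer_mod_group group_integer_mod_group nA sB int prod \<theta> \<eta>]
    by metis
  have "a \<in> ?\<theta> ` carrier ?N"
    using \<theta> by (simp add: iso_def bij_betw_def generate.incl)
  then obtain n where n': "a = ?\<theta> n" and n: "n \<in> carrier ?N" by (rule imageE)
  note \<theta>n = n'[symmetric]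
  have "inj_on \<phi> (carrier ?H)"
  proof (rule inj_onI)
    fix h k assume hk: "h \<in> carrier ?H" "k \<in> carrier ?H" and eq: "\<phi> h = \<phi> k"
    have hB: "?\<eta> h \<in> generate G {b}" "?\<eta> k \<in> generate G {b}"
      using \<eta> hk by (auto simp: iso_def hom_def)
    have hG: "?\<eta> h \<in> carrier G" "?\<eta> k \<in> carrier G" using b by simp_all
    let ?y = "inv (?\<eta> k) \<otimes> ?\<eta> h"
    have yB: "?y \<in> generate G {b}"
      using hB subgroup.m_closed[OF sB] subgroup.m_inv_closed[OF sB] by blast
    have "?\<eta> h \<otimes> a \<otimes> inv (?\<eta> h) = ?\<eta> k \<otimes> a \<otimes> inv (?\<eta> k)"
      using \<phi>_conj[OF hk(1) n] \<phi>_conj[OF hk(2) n] eq unfolding \<theta>n by simp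
    then have "?\<eta> h \<otimes> a = ?\<eta> k \<otimes> a \<otimes> inv (?\<eta> k) \<otimes> ?\<eta> h"
      using conj_eq_iff[OF hG(1) a] hG a by simp
    then have "inv (?\<eta> k) \<otimes> (?\<eta> h \<otimes> a) = inv (?\<eta> k) \<otimes> (?\<eta> k \<otimes> (a \<otimes> inv (?\<eta> k) \<otimes> ?\<eta> h))"
      using hG a by (simp add: m_assoc)
    also have "\<dots> = a \<otimes> inv (?\<eta> k) \<otimes> ?\<eta> h"
    proof -
      have "inv (?\<eta> k) \<otimes> (?\<eta> k \<otimes> w) = w" if "w \<in> carrier G" for w
        using hG that by (simp add: m_assoc[symmetric])
      then show ?thesis using hG a by simp
    qed
    finally have "?y \<otimes> a = a \<otimes> ?y" using hG a by (simp add: m_assoc)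
    then have "?y = \<one>" by (rule free[OF yB])
    then have "?\<eta> h = ?\<eta> k" using hG by (metis inv_closed inv_equality inv_inv)
    moreover have "inj_on ?\<eta> (carrier ?H)" using \<eta> by (simp add: iso_def bij_betw_def)
    ultimately show "h = k" using hk by (auto dest: inj_onD)
  qed
  moreover have "card (carrier ?H) = q ^ \<beta>"
    by (rule card_carrier_integer_mod_group[OF pos(2)])
  ultimately have "card (\<phi> ` carrier ?H) = q ^ \<beta>" by (simp add: card_image)
  moreover have "odd p" using p qp prime_ge_2_nat[OF q] prime_odd_nat by simp
  ultimately show ?thesis using p q qp \<alpha> \<beta> dvd \<phi> iso by blast
qed

theorem theorem1p2:
  fixes G :: "('a, 'b) monoid_scheme"
  assumes "group G" and "finite (carrier G)"
  shows "(\<forall>H. subgroup H G \<longrightarrow> indecomposable (G\<lparr>carrier := H\<rparr>)) \<longleftrightarrow>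
     (\<exists>(p::nat) (n::nat). prime p \<and> G \<cong> integer_mod_group (p ^ n)) \<or>
     (\<exists>n\<ge>3. G \<cong> gen_quaternion n) \<or>
     (\<exists>(p::nat) (q::nat) (\<alpha>::nat) (\<beta>::nat) \<phi>.
        prime p \<and> prime q \<and> p \<noteq> q \<and> odd p \<and> \<alpha> \<ge> 1 \<and> \<beta> \<ge> 1 \<and> q ^ \<beta> dvd p - 1 \<and>
        \<phi> \<in> hom (integer_mod_group (q ^ \<beta>)) (AutoGroup (integer_mod_group (p ^ \<alpha>))) \<and>
        card (\<phi> ` carrier (integer_mod_group (q ^ \<beta>))) = q ^ \<beta> \<and>
        G \<cong> semidirect_product (integer_mod_group (p ^ \<alpha>)) (integer_mod_group (q ^ \<beta>)) \<phi>)"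
    (is "?indec \<longleftrightarrow> ?cyclic \<or> ?quaternion \<or> ?frobenius")
proof -
  interpret group G by fact
  have "?indec \<longleftrightarrow> prime_rank_one G"
    by (rule all_subgroups_indecomposable_iff[OF assms(2)])
  also have "\<dots> \<longleftrightarrow> ?cyclic \<or> ?quaternion \<or> ?frobenius"
  proof
    assume P: "prime_rank_one G"
    show "?cyclic \<or> ?quaternion \<or> ?frobenius"
    proof (cases "\<exists>p n. prime p \<and> order G = p ^ n")
      case True
      then obtain p n where p: "prime p" "order G = p ^ n" by blast
      then show ?thesis using prime_power_iso[OF p P] by blast
    next
      case False
      then show ?thesis using frobenius_iso[OF assms(2) P] by blast
    qed
  next
    assume "?cyclic \<or> ?quaternion \<or> ?frobenius"
    then show "prime_rank_one G"
    proof (elim disjE exE conjE)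
      fix p n :: nat assume "prime p" "G \<cong> integer_mod_group (p ^ n)"
      then show ?thesis
        using prime_rank_one_iso[OF assms(1) group_integer_mod_group] prime_rank_one_integer_mod_group by blast
    next
      fix n :: nat assume n: "n \<ge> 3" "G \<cong> gen_quaternion n"
      have "group (gen_quaternion n)" unfolding gen_quaternion_def by (rule group_presented_group)
      then show ?thesis
        using prime_rank_one_iso[OF assms(1) _ n(2)] prime_rank_one_gen_quaternion[OF n(1)] by blast
    next
      fix p q \<alpha> \<beta> :: nat and \<phi>
      let ?N = "integer_mod_group (p ^ \<alpha>)" and ?H = "integer_mod_group (q ^ \<beta>)"
      assume pq: "prime p" "prime q" "p \<noteq> q" and \<phi>: "\<phi> \<in> hom ?H (AutoGroup ?N)"
        and card: "card (\<phi> ` carrier ?H) = q ^ \<beta>" and iso: "G \<cong> semidirect_product ?N ?H \<phi>"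
      have "q ^ \<beta> > 0" using pq prime_gt_0_nat by simp
      then have "card (carrier ?H) = q ^ \<beta>" by (rule card_carrier_integer_mod_group)
      then have "inj_on \<phi> (carrier ?H)"
        using card \<open>q ^ \<beta> > 0\<close> by (intro eq_card_imp_inj_on card_ge_0_finite) auto
      then have "prime_rank_one (semidirect_product ?N ?H \<phi>)"
        by (rule prime_rank_one_semidirect_product[OF pq \<phi>])
      then show ?thesis
        by (rule prime_rank_one_iso[OF assms(1) group_semidirect_product[OF _ _ \<phi>] iso, rotated -1]) auto
    qed
  qed
  finally show ?thesis .
qed

end
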